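(* Let $R$ be a unital ring, let $P$ be a monoid, let $\mathcal G$ be a discrete group, and let $\vartheta_p\colon\mathcal G\to\mathcal G$, $p\in P$, be injective group homomorphisms with $\vartheta_p\vartheta_q=\vartheta_{pq}$ for all $p,q\in P$, $\vartheta_1=\mathrm{id}_{\mathcal G}$, and $[\mathcal G:\vartheta_p(\mathcal G)]<\infty$ for all $p\in P$. Let $(P,\mathcal G,\mathcal X_p,\mu_{p,q})$ be the associated diagram of proper groupoid correspondences. Then the covariance ring of the associated diagram of rings and proper bimodules $(A_R(\mathcal G),A_R(\mathcal X_p))$ is the $R$-algebra generated by elements $\delta_{g,p}$ and $\delta^*_{g,p}$ for $g\in\mathcal G$, $p\in P$, subject to the relations (1) $\delta_{g,p}\delta_{h,q}=\delta_{g\vartheta_p(h),pq}$ and $\delta^*_{g,p}\delta^*_{h,q}=\delta^*_{h\vartheta_q(g),qp}$ for all $g,h\in\mathcal G$, $p,q\in P$; (2) for $g,h\in\mathcal G$, $p\in P$: $\delta_{g,p}^*\delta_{h,p}=\delta_{k,1}$ if there is $k\in\mathcal G$ with $g\vartheta_p(k)=h$, and $\delta_{g,p}^*\delta_{h,p}=0$ otherwise; (3) if $p\in P$ and $g_1,\dots,g_n$ is a system of representatives for the cosets $\mathcal G/\vartheta_p(\mathcal G)$, then $\delta_{1,1}=\sum_{j=1}^n\delta_{g_j,p}\delta^*_{g_j,p}$.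
   Context: **The diagram.** $\mathcal X_p$ is the set $\mathcal G$ (discrete) with left and right $\mathcal G$-actions $g_1\bullet x\bullet g_2=g_1x\vartheta_p(g_2)$. The multiplication maps are $\mu_{p,q}\colon\mathcal X_p\circ\mathcal X_q\to\mathcal X_{pq}$, $\mu_{p,q}(x_1,x_2)=x_1\vartheta_p(x_2)$, where $\mathcal X_p\circ\mathcal X_q$ is the quotient of $\mathcal X_p\times\mathcal X_q$ by $(x_1\bullet g,x_2)\sim(x_1,g\bullet x_2)$. **The rings and bimodules.** $A_R(\mathcal G)$ is the group ring of finitely supported functions $\mathcal G\to R$ with convolution. $A_R(\mathcal X_p)$ is the $R$-module of finitely supported functions $\mathcal X_p\to R$ with the $A_R(\mathcal G)$-bimodule structure extending the two actions of $\mathcal G$ on $\mathcal X_p$. The multiplication isomorphisms $A_R(\mathcal X_p)\otimes_{A_R(\mathcal G)}A_R(\mathcal X_q)\to A_R(\mathcal X_{pq})$ map $1_{x}\otimes1_{y}\mapsto1_{\mu_{p,q}(x,y)}$, where $1_x$ is the characteristic function of $\{x\}$. **Covariance ring.** A ring $D$ has local units if every finite subset $F$ admits an idempotent $e$ with $ed=d=de$ for $d\in F$. With $F_p=A_R(\mathcal X_p)$, $F_1=A_R(\mathcal G)$, a covariant representation in $D$ is a family of additive maps $\tilde\nu_p\colon F_p\to D$, $p\in P$, multiplicative with respect to the maps $F_p\otimes_{F_1}F_q\to F_{pq}$, such that $F_p\otimes_{F_1}D\to D$, $x\otimes d\mapsto\tilde\nu_p(x)d$, is an isomorphism for each $p\in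 P$. The covariance ring is the ring with local units representing the functor $D\mapsto\{\text{covariant representations in }D\}$ on the category of rings with local units and nondegenerate homomorphisms ($f\colon A\to B$ with $f(A)B=B$). "$R$-algebra generated by ... subject to relations" means the quotient of the free not necessarily unital $R$-algebra on the generators (scalars commuting with generators) by the relations.
   Formalization: The relation δ*_{1,1} = δ_{1,1} is added to (1)–(3); without it the claim fails: for trivial G and P and R = ℤ, relations (1)–(3) present ℤ×ℤ, while the covariance ring is ℤ. *)

theory Defs
  imports "HOL-Algebra.Module" "HOL-Algebra.QuotRing" "HOL-Algebra.Generated_Groups"
    "HOL-Algebra.Left_Coset" "HOL-Algebra.Free_Abelian_Groups"
begin

section \<open>Rings without unit and with local units\<close>

text \<open>Rings that need not be unital are carried by the library's ring records; the field
  \<open>one\<close> is ignored for them.\<close>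

locale nonunital_ring = abelian_group D for D (structure) +
  assumes m_closed: "\<lbrakk>x \<in> carrier D; y \<in> carrier D\<rbrakk> \<Longrightarrow> x \<otimes> y \<in> carrier D"
    and m_assoc: "\<lbrakk>x \<in> carrier D; y \<in> carrier D; z \<in> carrier D\<rbrakk> \<Longrightarrow> (x \<otimes> y) \<otimes> z = x \<otimes> (y \<otimes> z)"
    and l_distr: "\<lbrakk>x \<in> carrier D; y \<in> carrier D; z \<in> carrier D\<rbrakk> \<Longrightarrow> (x \<oplus> y) \<otimes> z = x \<otimes> z \<oplus> y \<otimes> z"
    and r_distr: "\<lbrakk>x \<in> carrier D; y \<in> carrier D; z \<in> carrier D\<rbrakk> \<Longrightarrow> z \<otimes> (x \<oplus> y) = z \<otimes> x \<oplus> z \<otimes> y"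

definition has_local_units :: "('d, 'k) ring_scheme \<Rightarrow> bool" where
  "has_local_units D \<longleftrightarrow>
    (\<forall>F. finite F \<and> F \<subseteq> carrier D \<longrightarrow>
      (\<exists>e\<in>carrier D. e \<otimes>\<^bsub>D\<^esub> e = e \<and> (\<forall>d\<in>F. e \<otimes>\<^bsub>D\<^esub> d = d \<and> d \<otimes>\<^bsub>D\<^esub> e = d)))"

definition local_unit_ring :: "('d, 'k) ring_scheme \<Rightarrow> bool" where
  "local_unit_ring D \<longleftrightarrow> nonunital_ring D \<and> has_local_units D"

text \<open>Here \<open>f(A)B\<close> is the additive span of the products \<open>f(a)b\<close>.  Homomorphisms are taken to be
  extensional, so that equality of elements of this set is equality of maps on the carrier.\<close>

definition nondegenerate_homs ::
  "('a, 'k) ring_scheme \<Rightarrow> ('b, 'l) ring_scheme \<Rightarrow> ('a \<Rightarrow> 'b) set" where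
  "nondegenerate_homs A B =
    {f \<in> hom (add_monoid A) (add_monoid B) \<inter> hom A B \<inter> extensional (carrier A).
      generate (add_monoid B) {f a \<otimes>\<^bsub>B\<^esub> b | a b. a \<in> carrier A \<and> b \<in> carrier B} = carrier B}"


section \<open>Tensor products over a not necessarily commutative ring\<close>

text \<open>\<open>rs\<close> is a right \<open>S\<close>-action on \<open>M\<close> and \<open>ls\<close> a left \<open>S\<close>-action on \<open>N\<close>; of \<open>M\<close> and \<open>N\<close> only the
  additive structure is used.\<close>

definition tensor_relations ::
  "('s, 'k) ring_scheme \<Rightarrow> ('m, 'l) ring_scheme \<Rightarrow> ('m \<Rightarrow> 's \<Rightarrow> 'm) \<Rightarrow>
   ('n, 'j) ring_scheme \<Rightarrow> ('s \<Rightarrow> 'n \<Rightarrow> 'n) \<Rightarrow> ('m \<times> 'n \<Rightarrow>\<^sub>0 int) set" where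
  "tensor_relations S M rs N ls =
    {frag_of (x \<oplus>\<^bsub>M\<^esub> y, d) - frag_of (x, d) - frag_of (y, d) | x y d.
       x \<in> carrier M \<and> y \<in> carrier M \<and> d \<in> carrier N} \<union>
    {frag_of (x, d \<oplus>\<^bsub>N\<^esub> c) - frag_of (x, d) - frag_of (x, c) | x d c.
       x \<in> carrier M \<and> d \<in> carrier N \<and> c \<in> carrier N} \<union>
    {frag_of (rs x s, d) - frag_of (x, ls s d) | x s d.
       x \<in> carrier M \<and> s \<in> carrier S \<and> d \<in> carrier N}"

definition tensor_kernel where
  "tensor_kernel S M rs N ls =
    generate (free_Abelian_group (carrier M \<times> carrier N)) (tensor_relations S M rs N ls)"

definition tensor_product where
  "tensor_product S M rs N ls =
    free_Abelian_group (carrier M \<times> carrier N) Mod tensor_kernel S M rs N ls"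

definition elem_tensor where
  "elem_tensor S M rs N ls x d =
    tensor_kernel S M rs N ls #>\<^bsub>free_Abelian_group (carrier M \<times> carrier N)\<^esub> frag_of (x, d)"


section \<open>Diagrams of rings and bimodules, covariant representations\<close>

text \<open>As for the library's modules, the fields \<open>mult\<close> and \<open>one\<close> of the record are not used.\<close>

record ('s, 'm) bimodule = "('s, 'm) module" +
  rsmult :: "'m \<Rightarrow> 's \<Rightarrow> 'm"

text \<open>The ring \<open>base_ring\<close> is the fibre \<open>F\<^sub>1\<close> at the unit with its ring structure.  The value
  \<open>pairing p q x y\<close> is the image of \<open>x \<otimes> y\<close> under \<open>F\<^sub>p \<otimes> F\<^sub>q \<rightarrow> F\<^sub>p\<^sub>q\<close>.\<close>

record ('p, 'f) bimodule_diagram =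
  shape :: "'p monoid"
  base_ring :: "'f ring"
  fibre :: "'p \<Rightarrow> ('f, 'f) bimodule"
  pairing :: "'p \<Rightarrow> 'p \<Rightarrow> 'f \<Rightarrow> 'f \<Rightarrow> 'f"

text \<open>In the last condition, \<open>D\<close> is a left \<open>F\<^sub>1\<close>-module through \<open>\<nu>\<^sub>1\<close>.\<close>

definition covariant_reps ::
  "('p, 'f) bimodule_diagram \<Rightarrow> ('d, 'k) ring_scheme \<Rightarrow> ('p \<Rightarrow> 'f \<Rightarrow> 'd) set" where
  "covariant_reps F D =
    {\<nu> \<in> (\<Pi>\<^sub>E p\<in>carrier (shape F).
            hom (add_monoid (fibre F p)) (add_monoid D) \<inter> extensional (carrier (fibre F p))).
      (\<forall>p\<in>carrier (shape F). \<forall>q\<in>carrier (shape F).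
         \<forall>x\<in>carrier (fibre F p). \<forall>y\<in>carrier (fibre F q).
           \<nu> p x \<otimes>\<^bsub>D\<^esub> \<nu> q y = \<nu> (p \<otimes>\<^bsub>shape F\<^esub> q) (pairing F p q x y)) \<and>
      (\<forall>p\<in>carrier (shape F).
         let ls = (\<lambda>s d. \<nu> \<one>\<^bsub>shape F\<^esub> s \<otimes>\<^bsub>D\<^esub> d) in
         \<exists>\<phi>\<in>iso (tensor_product (base_ring F) (fibre F p) (rsmult (fibre F p)) D ls) (add_monoid D).
           \<forall>x\<in>carrier (fibre F p). \<forall>d\<in>carrier D.
             \<phi> (elem_tensor (base_ring F) (fibre F p) (rsmult (fibre F p)) D ls x d)
               = \<nu> p x \<otimes>\<^bsub>D\<^esub> d)}"

text \<open>The ring \<open>A\<close> with universal element \<open>u\<close> represents the functor of covariant representations: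
  the natural transformation induced by \<open>u\<close> is bijective.  The type argument is the type in which
  the test rings \<open>D\<close> live; a theorem polymorphic in it speaks about all \<open>D\<close>.\<close>

definition is_covariance_ring ::
  "'d itself \<Rightarrow> ('p, 'f) bimodule_diagram \<Rightarrow> 'a ring \<Rightarrow> ('p \<Rightarrow> 'f \<Rightarrow> 'a) \<Rightarrow> bool" where
  "is_covariance_ring _ F A u \<longleftrightarrow>
    local_unit_ring A \<and> u \<in> covariant_reps F A \<and>
    (\<forall>D :: 'd ring. local_unit_ring D \<longrightarrow>
      bij_betw (\<lambda>f. \<lambda>p\<in>carrier (shape F). \<lambda>x\<in>carrier (fibre F p). f (u p x))
        (nondegenerate_homs A D) (covariant_reps F D))"


section \<open>Finitely supported functions\<close>

definition fin_supp :: "('r, 'k) ring_scheme \<Rightarrow> 'x set \<Rightarrow> ('x \<Rightarrow> 'r) set" where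
  "fin_supp R X = {a. (\<forall>x\<in>X. a x \<in> carrier R) \<and> (\<forall>x. x \<notin> X \<longrightarrow> a x = \<zero>\<^bsub>R\<^esub>) \<and> finite {x. a x \<noteq> \<zero>\<^bsub>R\<^esub>}}"

definition single :: "('r, 'k) ring_scheme \<Rightarrow> 'x \<Rightarrow> 'x \<Rightarrow> 'r" where
  "single R x = (\<lambda>y. if y = x then \<one>\<^bsub>R\<^esub> else \<zero>\<^bsub>R\<^esub>)"

text \<open>The extension of a map \<open>m\<close> on points to finitely supported functions, that is,
  \<open>(r 1\<^sub>x, s 1\<^sub>y) \<mapsto> rs 1\<^bsub>m x y\<^esub>\<close>.  It gives the convolution, both module structures, the
  multiplication maps of the diagram and the product of the free algebra.\<close>

definition conv :: "('r, 'k) ring_scheme \<Rightarrow> ('x \<Rightarrow> 'y \<Rightarrow> 'z) \<Rightarrow> ('x \<Rightarrow> 'r) \<Rightarrow> ('y \<Rightarrow> 'r) \<Rightarrow> 'z \<Rightarrow> 'r" where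
  "conv R m a b = (\<lambda>z. finsum R (\<lambda>(x, y). a x \<otimes>\<^bsub>R\<^esub> b y)
     {(x, y). a x \<noteq> \<zero>\<^bsub>R\<^esub> \<and> b y \<noteq> \<zero>\<^bsub>R\<^esub> \<and> m x y = z})"


section \<open>Diagrams of correspondences over a discrete group\<close>

record ('g, 'x) biset = "'x partial_object" +
  lact :: "'g \<Rightarrow> 'x \<Rightarrow> 'x"
  ract :: "'x \<Rightarrow> 'g \<Rightarrow> 'x"

text \<open>The map \<open>\<mu>\<^sub>p\<^sub>,\<^sub>q\<close> on the balanced product is given by its values on pairs of points.\<close>

record ('p, 'g) corr_diagram =
  corr_shape :: "'p monoid"
  corr_group :: "'g monoid"
  corr :: "'p \<Rightarrow> ('g, 'g) biset"
  corr_mult :: "'p \<Rightarrow> 'p \<Rightarrow> 'g \<Rightarrow> 'g \<Rightarrow> 'g"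

definition endo_diagram :: "'p monoid \<Rightarrow> 'g monoid \<Rightarrow> ('p \<Rightarrow> 'g \<Rightarrow> 'g) \<Rightarrow> ('p, 'g) corr_diagram" where
  "endo_diagram P G \<theta> =
    \<lparr>corr_shape = P,
     corr_group = G,
     corr = (\<lambda>p. \<lparr>carrier = carrier G,
                  lact = (\<lambda>g x. g \<otimes>\<^bsub>G\<^esub> x),
                  ract = (\<lambda>x g. x \<otimes>\<^bsub>G\<^esub> \<theta> p g)\<rparr>),
     corr_mult = (\<lambda>p q x y. x \<otimes>\<^bsub>G\<^esub> \<theta> p y)\<rparr>"

definition group_ring :: "('r, 'k) ring_scheme \<Rightarrow> ('g, 'l) monoid_scheme \<Rightarrow> ('g \<Rightarrow> 'r) ring" where
  "group_ring R G =
    \<lparr>carrier = fin_supp R (carrier G),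
     monoid.mult = conv R (\<lambda>g h. g \<otimes>\<^bsub>G\<^esub> h),
     monoid.one = single R \<one>\<^bsub>G\<^esub>,
     ring.zero = (\<lambda>_. \<zero>\<^bsub>R\<^esub>),
     ring.add = (\<lambda>a b x. a x \<oplus>\<^bsub>R\<^esub> b x)\<rparr>"

definition biset_module :: "('r, 'k) ring_scheme \<Rightarrow> ('g, 'x) biset \<Rightarrow> ('g \<Rightarrow> 'r, 'x \<Rightarrow> 'r) bimodule" where
  "biset_module R X =
    \<lparr>carrier = fin_supp R (carrier X),
     monoid.mult = undefined,
     monoid.one = undefined,
     ring.zero = (\<lambda>_. \<zero>\<^bsub>R\<^esub>),
     ring.add = (\<lambda>a b x. a x \<oplus>\<^bsub>R\<^esub> b x),
     smult = conv R (lact X),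
     rsmult = conv R (ract X)\<rparr>"

definition ring_diagram :: "('r, 'k) ring_scheme \<Rightarrow> ('p, 'g) corr_diagram \<Rightarrow> ('p, 'g \<Rightarrow> 'r) bimodule_diagram" where
  "ring_diagram R C =
    \<lparr>shape = corr_shape C,
     base_ring = group_ring R (corr_group C),
     fibre = (\<lambda>p. biset_module R (corr C p)),
     pairing = (\<lambda>p q. conv R (corr_mult C p q))\<rparr>"


section \<open>Algebras given by generators and relations\<close>

text \<open>The free not necessarily unital algebra consists of the linear combinations of nonempty
  words, multiplied by concatenation.  Scalars commute with generators, but \<open>R\<close> need not be
  commutative, so scalars act on both sides.  The field \<open>one\<close> is meaningless.\<close>

definition free_algebra :: "('r, 'k) ring_scheme \<Rightarrow> 'x set \<Rightarrow> ('x list \<Rightarrow> 'r) ring" where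
  "free_algebra R X =
    \<lparr>carrier = fin_supp R (lists X - {[]}),
     monoid.mult = conv R (@),
     monoid.one = undefined,
     ring.zero = (\<lambda>_. \<zero>\<^bsub>R\<^esub>),
     ring.add = (\<lambda>a b w. a w \<oplus>\<^bsub>R\<^esub> b w)\<rparr>"

definition lscale :: "('r, 'k) ring_scheme \<Rightarrow> 'r \<Rightarrow> ('x \<Rightarrow> 'r) \<Rightarrow> 'x \<Rightarrow> 'r" where
  "lscale R r a = (\<lambda>w. r \<otimes>\<^bsub>R\<^esub> a w)"

definition rscale :: "('r, 'k) ring_scheme \<Rightarrow> ('x \<Rightarrow> 'r) \<Rightarrow> 'r \<Rightarrow> 'x \<Rightarrow> 'r" where
  "rscale R a r = (\<lambda>w. a w \<otimes>\<^bsub>R\<^esub> r)"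

definition algebra_ideal :: "('r, 'k) ring_scheme \<Rightarrow> 'x set \<Rightarrow> ('x list \<Rightarrow> 'r) set \<Rightarrow> bool" where
  "algebra_ideal R X J \<longleftrightarrow>
    additive_subgroup J (free_algebra R X) \<and>
    (\<forall>a\<in>carrier (free_algebra R X). \<forall>j\<in>J.
       a \<otimes>\<^bsub>free_algebra R X\<^esub> j \<in> J \<and> j \<otimes>\<^bsub>free_algebra R X\<^esub> a \<in> J) \<and>
    (\<forall>r\<in>carrier R. \<forall>j\<in>J. lscale R r j \<in> J \<and> rscale R j r \<in> J)"

definition relation_ideal ::
  "('r, 'k) ring_scheme \<Rightarrow> 'x set \<Rightarrow> (('x list \<Rightarrow> 'r) \<times> ('x list \<Rightarrow> 'r)) set \<Rightarrow> ('x list \<Rightarrow> 'r) set" where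
  "relation_ideal R X E =
    \<Inter>{J. algebra_ideal R X J \<and> (\<forall>(a, b)\<in>E. a \<ominus>\<^bsub>free_algebra R X\<^esub> b \<in> J)}"

definition presented_algebra ::
  "('r, 'k) ring_scheme \<Rightarrow> 'x set \<Rightarrow> (('x list \<Rightarrow> 'r) \<times> ('x list \<Rightarrow> 'r)) set \<Rightarrow> ('x list \<Rightarrow> 'r) set ring" where
  "presented_algebra R X E = free_algebra R X Quot relation_ideal R X E"


section \<open>The algebra generated by \<open>\<delta>\<close> and \<open>\<delta>\<^sup>*\<close>\<close>

datatype ('g, 'p) gen = Delta 'g 'p | DeltaStar 'g 'p

definition gens :: "('p, 'k) monoid_scheme \<Rightarrow> ('g, 'l) monoid_scheme \<Rightarrow> ('g, 'p) gen set" where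
  "gens P G = {Delta g p | g p. g \<in> carrier G \<and> p \<in> carrier P} \<union>
              {DeltaStar g p | g p. g \<in> carrier G \<and> p \<in> carrier P}"

definition \<delta> :: "('r, 'k) ring_scheme \<Rightarrow> 'g \<Rightarrow> 'p \<Rightarrow> ('g, 'p) gen list \<Rightarrow> 'r" where
  "\<delta> R g p = single R [Delta g p]"

definition \<delta>s :: "('r, 'k) ring_scheme \<Rightarrow> 'g \<Rightarrow> 'p \<Rightarrow> ('g, 'p) gen list \<Rightarrow> 'r" where
  "\<delta>s R g p = single R [DeltaStar g p]"

definition left_transversal :: "('g, 'k) monoid_scheme \<Rightarrow> 'g set \<Rightarrow> 'g set \<Rightarrow> bool" where
  "left_transversal G H T \<longleftrightarrow> T \<subseteq> carrier G \<and> bij_betw (\<lambda>t. t <#\<^bsub>G\<^esub> H) T (lcosets\<^bsub>G\<^esub> H)"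

inductive_set delta_relations ::
  "'r ring \<Rightarrow> 'p monoid \<Rightarrow> 'g monoid \<Rightarrow> ('p \<Rightarrow> 'g \<Rightarrow> 'g) \<Rightarrow>
   ((('g, 'p) gen list \<Rightarrow> 'r) \<times> (('g, 'p) gen list \<Rightarrow> 'r)) set"
  for R :: "'r ring" and P :: "'p monoid" and G :: "'g monoid" and \<theta> :: "'p \<Rightarrow> 'g \<Rightarrow> 'g" where
  mult_delta:
    "\<lbrakk>g \<in> carrier G; h \<in> carrier G; p \<in> carrier P; q \<in> carrier P\<rbrakk> \<Longrightarrow>
      (\<delta> R g p \<otimes>\<^bsub>free_algebra R (gens P G)\<^esub> \<delta> R h q,
       \<delta> R (g \<otimes>\<^bsub>G\<^esub> \<theta> p h) (p \<otimes>\<^bsub>P\<^esub> q)) \<in> delta_relations R P G \<theta>"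
| mult_delta_star:
    "\<lbrakk>g \<in> carrier G; h \<in> carrier G; p \<in> carrier P; q \<in> carrier P\<rbrakk> \<Longrightarrow>
      (\<delta>s R g p \<otimes>\<^bsub>free_algebra R (gens P G)\<^esub> \<delta>s R h q,
       \<delta>s R (h \<otimes>\<^bsub>G\<^esub> \<theta> q g) (q \<otimes>\<^bsub>P\<^esub> p)) \<in> delta_relations R P G \<theta>"
| star_delta_same_coset:
    "\<lbrakk>g \<in> carrier G; h \<in> carrier G; p \<in> carrier P; k \<in> carrier G; g \<otimes>\<^bsub>G\<^esub> \<theta> p k = h\<rbrakk> \<Longrightarrow>
      (\<delta>s R g p \<otimes>\<^bsub>free_algebra R (gens P G)\<^esub> \<delta> R h p,
       \<delta> R k \<one>\<^bsub>P\<^esub>) \<in> delta_relations R P G \<theta>"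
| star_delta_other_coset:
    "\<lbrakk>g \<in> carrier G; h \<in> carrier G; p \<in> carrier P; \<not> (\<exists>k\<in>carrier G. g \<otimes>\<^bsub>G\<^esub> \<theta> p k = h)\<rbrakk> \<Longrightarrow>
      (\<delta>s R g p \<otimes>\<^bsub>free_algebra R (gens P G)\<^esub> \<delta> R h p,
       \<zero>\<^bsub>free_algebra R (gens P G)\<^esub>) \<in> delta_relations R P G \<theta>"
| sum_over_cosets:
    "\<lbrakk>p \<in> carrier P; left_transversal G (\<theta> p ` carrier G) T\<rbrakk> \<Longrightarrow>
      (\<delta> R \<one>\<^bsub>G\<^esub> \<one>\<^bsub>P\<^esub>,
       finsum (free_algebra R (gens P G))
         (\<lambda>t. \<delta> R t p \<otimes>\<^bsub>free_algebra R (gens P G)\<^esub> \<delta>s R t p) T) \<in> delta_relations R P G \<theta>"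

text \<open>The relation \<open>\<delta>\<^sup>*\<^sub>1\<^sub>,\<^sub>1 = \<delta>\<^sub>1\<^sub>,\<^sub>1\<close> says that \<open>\<delta>\<^sub>1\<^sub>,\<^sub>1\<close> is the unit of the algebra: modulo
  \<open>delta_relations\<close> the unit is \<open>\<delta>\<^sup>*\<^sub>1\<^sub>,\<^sub>1\<close>, and \<open>\<delta>\<^sub>1\<^sub>,\<^sub>1\<close> is only a central idempotent.  The relation
  does not follow from the others: these also hold in \<open>R \<times> R\<close> for \<open>\<delta>\<^sub>g\<^sub>,\<^sub>p = (1, 0)\<close> and
  \<open>\<delta>\<^sup>*\<^sub>g\<^sub>,\<^sub>p = (1, 1)\<close> if \<open>G\<close> is trivial, for any nonzero \<open>R\<close>.\<close>

definition delta_unit_relation ::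
  "'r ring \<Rightarrow> 'p monoid \<Rightarrow> 'g monoid \<Rightarrow> (('g, 'p) gen list \<Rightarrow> 'r) \<times> (('g, 'p) gen list \<Rightarrow> 'r)" where
  "delta_unit_relation R P G = (\<delta>s R \<one>\<^bsub>G\<^esub> \<one>\<^bsub>P\<^esub>, \<delta> R \<one>\<^bsub>G\<^esub> \<one>\<^bsub>P\<^esub>)"

definition all_delta_relations where
  "all_delta_relations R P G \<theta> = insert (delta_unit_relation R P G) (delta_relations R P G \<theta>)"

definition delta_algebra ::
  "'r ring \<Rightarrow> 'p monoid \<Rightarrow> 'g monoid \<Rightarrow> ('p \<Rightarrow> 'g \<Rightarrow> 'g) \<Rightarrow> (('g, 'p) gen list \<Rightarrow> 'r) set ring" where
  "delta_algebra R P G \<theta> = presented_algebra R (gens P G) (all_delta_relations R P G \<theta>)"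

text \<open>The universal covariant representation maps \<open>x \<in> A\<^sub>R(X\<^sub>p)\<close> to the class of
  \<open>\<Sum>\<^sub>g x(g) \<delta>\<^sub>g\<^sub>,\<^sub>p\<close>.\<close>

definition delta_rep ::
  "'r ring \<Rightarrow> 'p monoid \<Rightarrow> 'g monoid \<Rightarrow> ('p \<Rightarrow> 'g \<Rightarrow> 'g) \<Rightarrow>
   'p \<Rightarrow> ('g \<Rightarrow> 'r) \<Rightarrow> (('g, 'p) gen list \<Rightarrow> 'r) set" where
  "delta_rep R P G \<theta> =
    (\<lambda>p\<in>carrier P. \<lambda>x\<in>fin_supp R (carrier G).
      relation_ideal R (gens P G) (all_delta_relations R P G \<theta>) +>\<^bsub>free_algebra R (gens P G)\<^esub>
        finsum (free_algebra R (gens P G)) (\<lambda>g. lscale R (x g) (\<delta> R g p)) {g. x g \<noteq> \<zero>\<^bsub>R\<^esub>})"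

end

theory Submission
  imports Defs
begin

text \<open>If a ring \<open>D\<close> with local units admits a covariant representation \<open>\<nu>\<close> or a nondegenerate
  homomorphism from the algebra of the \<open>\<delta>\<^sub>g\<^sub>,\<^sub>p\<close> and \<open>\<delta>\<^sup>*\<^sub>g\<^sub>,\<^sub>p\<close>, then the image of \<open>\<delta>\<^sub>1\<^sub>,\<^sub>1\<close> is a left unit
  of \<open>D\<close>, hence a unit.  For unital \<open>D\<close>, both kinds of data amount to a unital homomorphism
  \<open>\<rho>: R \<rightarrow> D\<close> and elements \<open>V\<^sub>g\<^sub>,\<^sub>p\<close>, \<open>S\<^sub>g\<^sub>,\<^sub>p\<close> of \<open>D\<close> that commute with \<open>\<rho>(R)\<close> and satisfy the relations.
  Given these, \<open>\<nu>\<^sub>p(r 1\<^sub>g) = \<rho>(r) V\<^sub>g\<^sub>,\<^sub>p\<close> is covariant because \<open>d \<mapsto> \<Sum>\<^sub>t 1\<^sub>t \<otimes> S\<^sub>t\<^sub>,\<^sub>p d\<close>, with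
  \<open>t\<close> running through coset representatives, inverts \<open>x \<otimes> d \<mapsto> \<nu>\<^sub>p(x) d\<close>.  Conversely, the isomorphism
  \<open>F\<^sub>p \<otimes> D \<cong> D\<close> followed by the projection to the coset of \<open>g\<close> gives a right \<open>D\<close>-linear map
  \<open>D \<rightarrow> D\<close>, that is, left multiplication by an element \<open>S\<^sub>g\<^sub>,\<^sub>p\<close>.  The elements \<open>V\<^sub>h\<^sub>,\<^sub>p\<close> are jointly
  right cancellable.  Hence the \<open>S\<^sub>g\<^sub>,\<^sub>p\<close> are determined by their products with the \<open>V\<^sub>h\<^sub>,\<^sub>p\<close>, and the
  remaining relations follow.\<close>

section \<open>Finitely supported functions\<close>

text \<open>The left unit comes from the unit of \<open>F\<^sub>1\<close> or of the algebra: its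
  image fixes every product \<open>\<nu>\<^sub>1(x)d\<close> or \<open>f(a)d\<close>, and these
  products generate \<open>D\<close> additively. Cancellation of the
  \<open>V\<^sub>h\<^sub>,\<^sub>p\<close> is forced by covariance: 1 is the image of a tensor in
  \<open>F\<^sub>p \<otimes> D\<close>, hence a sum of terms \<open>\<nu>\<^sub>p(x)d\<close>, so
  \<open>y\<close> is recovered from the products \<open>y \<nu>\<^sub>p(x)\<close>. The same
  cancellation gives injectivity of \<open>f \<mapsto> f \<circ> u\<close>: the universal
  representation \<open>u\<close> involves only the \<open>\<delta>\<close>, and homomorphisms that
  agree on these must agree on the \<open>\<delta>\<^sup>*\<close>. It also makes the product rule
  for the \<open>\<delta>\<^sup>*\<close> a consequence of the other relations. Since
  \<open>R\<close> may be noncommutative, \<rho>(R) need not be central. It commutes with the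
  generators, so every monomial is a scalar times a word. Representations are merely additive, so
  maps are compared on all r 1_x, not only on the 1_x.\<close>

definition monomial :: "('r, 'k) ring_scheme \<Rightarrow> 'x \<Rightarrow> 'r \<Rightarrow> 'x \<Rightarrow> 'r" where
  "monomial R x r = (\<lambda>y. if y = x then r else \<zero>\<^bsub>R\<^esub>)"

text \<open>The universal property of a direct sum of copies of \<open>R\<close>, one for each
  point. The coefficient is an argument of \<phi> and not a factor, so the target is just an abelian
  group.\<close>

definition lin_ext ::
  "('r, 'k) ring_scheme \<Rightarrow> ('d, 'l) ring_scheme \<Rightarrow> ('x \<Rightarrow> 'r \<Rightarrow> 'd) \<Rightarrow> ('x \<Rightarrow> 'r) \<Rightarrow> 'd" where
  "lin_ext R D \<phi> a = finsum D (\<lambda>x. \<phi> x (a x)) {x. a x \<noteq> \<zero>\<^bsub>R\<^esub>}"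

lemma single_eq_monomial: "single R x = monomial R x \<one>\<^bsub>R\<^esub>"
  by (simp add: single_def monomial_def)

lemma add_hom_zero:
  assumes "abelian_group A" "abelian_group B" "f \<in> hom (add_monoid A) (add_monoid B)"
  shows "f \<zero>\<^bsub>A\<^esub> = \<zero>\<^bsub>B\<^esub>"
  using hom_one[OF assms(3)] assms(1,2)
  by (simp add: abelian_group.a_group)

context ring
begin

lemma fin_supp_value: "a \<in> fin_supp R X \<Longrightarrow> a x \<in> carrier R"
  by (cases "x \<in> X") (auto simp: fin_supp_def)

lemma fin_supp_finite: "a \<in> fin_supp R X \<Longrightarrow> finite {x. a x \<noteq> \<zero>}"
  by (simp add: fin_supp_def)

lemma fin_supp_subset: "a \<in> fin_supp R X \<Longrightarrow> {x. a x \<noteq> \<zero>} \<subseteq> X"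
  by (auto simp: fin_supp_def)

lemma fin_supp_zero: "(\<lambda>_. \<zero>) \<in> fin_supp R X"
  by (simp add: fin_supp_def)

lemma fin_supp_add:
  assumes "a \<in> fin_supp R X" "b \<in> fin_supp R X"
  shows "(\<lambda>x. a x \<oplus> b x) \<in> fin_supp R X"
proof -
  have "{x. a x \<oplus> b x \<noteq> \<zero>} \<subseteq> {x. a x \<noteq> \<zero>} \<union> {x. b x \<noteq> \<zero>}" by auto
  then show ?thesis
    using assms by (auto simp: fin_supp_def intro: finite_subset)
qed

lemma fin_supp_monomial: "\<lbrakk>x \<in> X; r \<in> carrier R\<rbrakk> \<Longrightarrow> monomial R x r \<in> fin_supp R X"
  by (auto simp: fin_supp_def monomial_def)

lemma monomial_add:
  "\<lbrakk>r \<in> carrier R; s \<in> carrier R\<rbrakk> \<Longrightarrow> monomial R x (r \<oplus> s) = (\<lambda>y. monomial R x r y \<oplus> monomial R x s y)"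
  by (auto simp: monomial_def)

lemma monomial_zero: "monomial R x \<zero> = (\<lambda>_. \<zero>)"
  by (auto simp: monomial_def)

text \<open>Phrased for any record with this carrier and addition, so that it covers the fibres of
  the diagram as well as the free algebra.\<close>

lemma fin_supp_abelian_group:
  assumes "carrier S = fin_supp R X" "ring.zero S = (\<lambda>_. \<zero>)" "ring.add S = (\<lambda>a b x. a x \<oplus> b x)"
  shows "abelian_group S"
proof (rule abelian_groupI)
  fix a assume a: "a \<in> carrier S"
  have "(\<lambda>x. \<ominus> a x) \<in> fin_supp R X"
  proof -
    have "{x. \<ominus> a x \<noteq> \<zero>} \<subseteq> {x. a x \<noteq> \<zero>}" by auto
    then have "finite {x. \<ominus> a x \<noteq> \<zero>}"
      using a by (simp add: finite_subset fin_supp_def assms)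
    then show ?thesis
      using a by (auto simp: fin_supp_def assms)
  qed
  moreover have "(\<lambda>x. \<ominus> a x \<oplus> a x) = (\<lambda>_. \<zero>)"
    using a fin_supp_value[of a X] by (simp add: assms l_neg)
  ultimately show "\<exists>y\<in>carrier S. y \<oplus>\<^bsub>S\<^esub> a = \<zero>\<^bsub>S\<^esub>" unfolding assms
    by (rule_tac x = "\<lambda>x. \<ominus> a x" in bexI) simp_all
qed (use fin_supp_value[where X = X] in \<open>auto simp: assms fin_supp_zero fin_supp_add a_ac\<close>)

lemma fin_supp_induct [consumes 1, case_names zero add]:
  assumes a: "a \<in> fin_supp R X"
    and zero: "P (\<lambda>_. \<zero>)"
    and add: "\<And>a x r. \<lbrakk>a \<in> fin_supp R X; x \<in> X; r \<in> carrier R; P a\<rbrakk> \<Longrightarrow> P (\<lambda>y. a y \<oplus> monomial R x r y)"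
  shows "P a"
proof -
  \<comment> \<open>Induction runs over a finite set containing the support, so that a point where
    \<open>a\<close> vanishes can simply be dropped.\<close>
  have "P a" if "finite A" "a \<in> fin_supp R X" "{x. a x \<noteq> \<zero>} \<subseteq> A" for A a
    using that
  proof (induction A arbitrary: a)
    case empty
    then have "a = (\<lambda>_. \<zero>)" by auto
    then show ?case using zero by simp
  next
    case (insert z A)
    show ?case
    proof (cases "a z = \<zero>")
      case True
      then show ?thesis using insert by auto
    next
      case False
      then have z: "z \<in> X" using insert.prems by (auto simp: fin_supp_def)
      let ?b = "a(z := \<zero>)"
      have b: "?b \<in> fin_supp R X"
        using insert.prems(1) by (auto simp: fin_supp_def elim: rev_finite_subset)
      have "P ?b"
        by (rule insert.IH[OF b]) (use insert.prems(2) in auto)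
      then have "P (\<lambda>y. ?b y \<oplus> monomial R z (a z) y)"
        by (rule add[OF b z fin_supp_value[OF insert.prems(1)]])
      moreover have "(\<lambda>y. ?b y \<oplus> monomial R z (a z) y) = a"
        using fin_supp_value[OF insert.prems(1)] by (auto simp: monomial_def)
      ultimately show ?thesis by simp
    qed
  qed
  then show ?thesis using fin_supp_finite a by blast
qed

text \<open>The operation \<open>h\<close> is arbitrary, so one lemma serves sums in
  \<open>D\<close>, pointwise sums of functions and products in the multiplicatively written tensor
  group. Agreement at zero is therefore a premise of its own.\<close>

lemma fin_supp_hom_eq:
  assumes f: "\<And>a b. \<lbrakk>a \<in> fin_supp R X; b \<in> fin_supp R X\<rbrakk> \<Longrightarrow> f (\<lambda>x. a x \<oplus> b x) = h (f a) (f b)"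
    and g: "\<And>a b. \<lbrakk>a \<in> fin_supp R X; b \<in> fin_supp R X\<rbrakk> \<Longrightarrow> g (\<lambda>x. a x \<oplus> b x) = h (g a) (g b)"
    and eq: "\<And>x r. \<lbrakk>x \<in> X; r \<in> carrier R\<rbrakk> \<Longrightarrow> f (monomial R x r) = g (monomial R x r)"
    and zero: "f (\<lambda>_. \<zero>) = g (\<lambda>_. \<zero>)"
    and a: "a \<in> fin_supp R X"
  shows "f a = g a"
  using a by (induction a rule: fin_supp_induct) (simp_all add: zero f g eq fin_supp_monomial)

text \<open>The supports of two functions and of their sum differ. Over a common finite set the sums
  can be compared, and the extra terms vanish because additive maps preserve zero.\<close>

lemma lin_ext_superset:
  assumes D: "abelian_group D"
    and \<phi>: "\<And>x. x \<in> X \<Longrightarrow> \<phi> x \<in> hom (add_monoid R) (add_monoid D)"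
    and a: "a \<in> fin_supp R X" and A: "finite A" "A \<subseteq> X" "{x. a x \<noteq> \<zero>} \<subseteq> A"
  shows "lin_ext R D \<phi> a = finsum D (\<lambda>x. \<phi> x (a x)) A"
proof -
  interpret D: abelian_group D by fact
  show ?thesis unfolding lin_ext_def
  proof (rule D.add.finprod_mono_neutral_cong_left)
    fix i assume "i \<in> A - {x. a x \<noteq> \<zero>}"
    then show "\<phi> i (a i) = \<zero>\<^bsub>D\<^esub>"
      using A(2) add_hom_zero[OF is_abelian_group D \<phi>] by auto
  next
    show "(\<lambda>x. \<phi> x (a x)) \<in> A \<rightarrow> carrier D"
      using A(2) \<phi> fin_supp_value[OF a] by (auto simp: hom_def Pi_iff)
  qed (use A in auto)
qed

lemma lin_ext_hom:
  assumes D: "abelian_group D"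
    and \<phi>: "\<And>x. x \<in> X \<Longrightarrow> \<phi> x \<in> hom (add_monoid R) (add_monoid D)"
  shows lin_ext_closed: "a \<in> fin_supp R X \<Longrightarrow> lin_ext R D \<phi> a \<in> carrier D"
    and lin_ext_add: "\<lbrakk>a \<in> fin_supp R X; b \<in> fin_supp R X\<rbrakk> \<Longrightarrow>
      lin_ext R D \<phi> (\<lambda>x. a x \<oplus> b x) = lin_ext R D \<phi> a \<oplus>\<^bsub>D\<^esub> lin_ext R D \<phi> b"
    and lin_ext_monomial: "\<lbrakk>x \<in> X; r \<in> carrier R\<rbrakk> \<Longrightarrow> lin_ext R D \<phi> (monomial R x r) = \<phi> x r"
    and lin_ext_zero: "lin_ext R D \<phi> (\<lambda>_. \<zero>) = \<zero>\<^bsub>D\<^esub>"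
proof -
  interpret D: abelian_group D by fact
  note sup = lin_ext_superset[OF D, of X \<phi>, OF \<phi>]
  have cl: "\<phi> x r \<in> carrier D" if "x \<in> X" "r \<in> carrier R" for x r
    using that \<phi> by (auto simp: hom_def Pi_iff)
  show "lin_ext R D \<phi> a \<in> carrier D" if "a \<in> fin_supp R X"
    unfolding lin_ext_def using cl fin_supp_value[OF that] fin_supp_subset[OF that]
    by (intro D.finsum_closed) auto
  show "lin_ext R D \<phi> (\<lambda>x. a x \<oplus> b x) = lin_ext R D \<phi> a \<oplus>\<^bsub>D\<^esub> lin_ext R D \<phi> b"
    if a: "a \<in> fin_supp R X" and b: "b \<in> fin_supp R X"
  proof -
    let ?A = "{x. a x \<noteq> \<zero>} \<union> {x. b x \<noteq> \<zero>}"
    have A: "finite ?A" "?A \<subseteq> X"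
      using fin_supp_finite[OF a] fin_supp_finite[OF b] fin_supp_subset[OF a] fin_supp_subset[OF b]
      by auto
    have "lin_ext R D \<phi> (\<lambda>x. a x \<oplus> b x) = finsum D (\<lambda>x. \<phi> x (a x \<oplus> b x)) ?A"
      by (rule sup[OF _ fin_supp_add[OF a b] A]) auto
    also have "\<dots> = finsum D (\<lambda>x. \<phi> x (a x) \<oplus>\<^bsub>D\<^esub> \<phi> x (b x)) ?A"
    proof (rule D.finsum_cong')
      fix x assume "x \<in> ?A"
      then show "\<phi> x (a x \<oplus> b x) = \<phi> x (a x) \<oplus>\<^bsub>D\<^esub> \<phi> x (b x)"
        using A(2) \<phi>[of x] fin_supp_value[OF a, of x] fin_supp_value[OF b, of x]
        by (auto simp: hom_def)
    qed (use A(2) fin_supp_value[OF a] fin_supp_value[OF b] cl in auto)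
    also have "\<dots> = finsum D (\<lambda>x. \<phi> x (a x)) ?A \<oplus>\<^bsub>D\<^esub> finsum D (\<lambda>x. \<phi> x (b x)) ?A"
      by (rule D.finsum_addf) (use A(2) fin_supp_value[OF a] fin_supp_value[OF b] cl in auto)
    also have "\<dots> = lin_ext R D \<phi> a \<oplus>\<^bsub>D\<^esub> lin_ext R D \<phi> b"
      using sup[OF _ a A] sup[OF _ b A] by auto
    finally show ?thesis .
  qed
  show "lin_ext R D \<phi> (monomial R x r) = \<phi> x r" if "x \<in> X" "r \<in> carrier R"
  proof -
    have "lin_ext R D \<phi> (monomial R x r) = finsum D (\<lambda>y. \<phi> y (monomial R x r y)) {x}"
      by (rule sup[OF _ fin_supp_monomial]) (use that in \<open>auto simp: monomial_def\<close>)
    also have "\<dots> = \<phi> x r" using cl that by (simp add: monomial_def)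
    finally show ?thesis .
  qed
  show "lin_ext R D \<phi> (\<lambda>_. \<zero>) = \<zero>\<^bsub>D\<^esub>" by (simp add: lin_ext_def)
qed

section \<open>Convolution is biadditive and determined by monomials\<close>

lemma conv_superset:
  assumes a: "a \<in> fin_supp R X" and b: "b \<in> fin_supp R Y"
    and A: "finite A" "{x. a x \<noteq> \<zero>} \<subseteq> A" and B: "finite B" "{y. b y \<noteq> \<zero>} \<subseteq> B"
  shows "conv R m a b z = finsum R (\<lambda>(x, y). a x \<otimes> b y) {(x, y) \<in> A \<times> B. m x y = z}"
  unfolding conv_def
proof (rule add.finprod_mono_neutral_cong_left)
  show "finite {(x, y) \<in> A \<times> B. m x y = z}"
    by (rule finite_subset[of _ "A \<times> B"]) (use A B in auto)
qed (use A B fin_supp_value[OF a] fin_supp_value[OF b] in \<open>auto simp: Pi_iff\<close>)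

lemma conv_closed:
  assumes a: "a \<in> fin_supp R X" and b: "b \<in> fin_supp R Y"
    and m: "\<And>x y. \<lbrakk>x \<in> X; y \<in> Y\<rbrakk> \<Longrightarrow> m x y \<in> Z"
  shows "conv R m a b \<in> fin_supp R Z"
proof -
  let ?S = "\<lambda>z. {(x, y). a x \<noteq> \<zero> \<and> b y \<noteq> \<zero> \<and> m x y = z}"
  have out: "conv R m a b z = \<zero>" if "?S z = {}" for z
    unfolding conv_def that by simp
  have "{z. conv R m a b z \<noteq> \<zero>} \<subseteq> (\<lambda>(x, y). m x y) ` ({x. a x \<noteq> \<zero>} \<times> {y. b y \<noteq> \<zero>})"
    using out by force
  then have "finite {z. conv R m a b z \<noteq> \<zero>}"
    by (rule finite_subset) (use fin_supp_finite[OF a] fin_supp_finite[OF b] in simp)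
  moreover have "conv R m a b z \<in> carrier R" for z
    unfolding conv_def using fin_supp_value[OF a] fin_supp_value[OF b]
    by (intro finsum_closed) auto
  moreover have "conv R m a b z = \<zero>" if "z \<notin> Z" for z
    by (rule out) (use that m fin_supp_subset[OF a] fin_supp_subset[OF b] in auto)
  ultimately show ?thesis by (simp add: fin_supp_def)
qed

lemma conv_add_left:
  assumes a: "a \<in> fin_supp R X" and a': "a' \<in> fin_supp R X" and b: "b \<in> fin_supp R Y"
  shows "conv R m (\<lambda>x. a x \<oplus> a' x) b = (\<lambda>z. conv R m a b z \<oplus> conv R m a' b z)"
proof
  fix z
  let ?A = "{x. a x \<noteq> \<zero>} \<union> {x. a' x \<noteq> \<zero>}"
  have A: "finite ?A" using fin_supp_finite a a' by auto
  note s = conv_superset[OF _ b A _ fin_supp_finite[OF b] subset_refl]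
  have "conv R m (\<lambda>x. a x \<oplus> a' x) b z =
      finsum R (\<lambda>(x, y). (a x \<oplus> a' x) \<otimes> b y) {(x, y) \<in> ?A \<times> {y. b y \<noteq> \<zero>}. m x y = z}"
    by (rule s[OF fin_supp_add[OF a a']]) auto
  also have "\<dots> = finsum R (\<lambda>p. (\<lambda>(x, y). a x \<otimes> b y) p \<oplus> (\<lambda>(x, y). a' x \<otimes> b y) p)
      {(x, y) \<in> ?A \<times> {y. b y \<noteq> \<zero>}. m x y = z}"
    by (rule finsum_cong') (use fin_supp_value[OF a] fin_supp_value[OF a'] fin_supp_value[OF b] in \<open>auto simp: l_distr\<close>)
  also have "\<dots> = finsum R (\<lambda>(x, y). a x \<otimes> b y) {(x, y) \<in> ?A \<times> {y. b y \<noteq> \<zero>}. m x y = z}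
     \<oplus> finsum R (\<lambda>(x, y). a' x \<otimes> b y) {(x, y) \<in> ?A \<times> {y. b y \<noteq> \<zero>}. m x y = z}"
    by (rule finsum_addf) (use fin_supp_value[OF a] fin_supp_value[OF a'] fin_supp_value[OF b] in auto)
  also have "\<dots> = conv R m a b z \<oplus> conv R m a' b z"
    by (subst (1 2) s[symmetric]) (use a a' in auto)
  finally show "conv R m (\<lambda>x. a x \<oplus> a' x) b z = conv R m a b z \<oplus> conv R m a' b z" .
qed

lemma conv_add_right:
  assumes a: "a \<in> fin_supp R X" and b: "b \<in> fin_supp R Y" and b': "b' \<in> fin_supp R Y"
  shows "conv R m a (\<lambda>y. b y \<oplus> b' y) = (\<lambda>z. conv R m a b z \<oplus> conv R m a b' z)"
proof
  fix z
  let ?B = "{x. b x \<noteq> \<zero>} \<union> {x. b' x \<noteq> \<zero>}"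
  have B: "finite ?B" using fin_supp_finite b b' by auto
  note s = conv_superset[OF a _ fin_supp_finite[OF a] subset_refl B]
  have "conv R m a (\<lambda>x. b x \<oplus> b' x) z =
      finsum R (\<lambda>(x, y). a x \<otimes> (b y \<oplus> b' y)) {(x, y) \<in> {x. a x \<noteq> \<zero>} \<times> ?B. m x y = z}"
    by (rule s[OF fin_supp_add[OF b b']]) auto
  also have "\<dots> = finsum R (\<lambda>p. (\<lambda>(x, y). a x \<otimes> b y) p \<oplus> (\<lambda>(x, y). a x \<otimes> b' y) p)
      {(x, y) \<in> {x. a x \<noteq> \<zero>} \<times> ?B. m x y = z}"
    by (rule finsum_cong') (use fin_supp_value[OF a] fin_supp_value[OF b] fin_supp_value[OF b'] in \<open>auto simp: r_distr\<close>)
  also have "\<dots> = finsum R (\<lambda>(x, y). a x \<otimes> b y) {(x, y) \<in> {x. a x \<noteq> \<zero>} \<times> ?B. m x y = z}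
     \<oplus> finsum R (\<lambda>(x, y). a x \<otimes> b' y) {(x, y) \<in> {x. a x \<noteq> \<zero>} \<times> ?B. m x y = z}"
    by (rule finsum_addf) (use fin_supp_value[OF a] fin_supp_value[OF b] fin_supp_value[OF b'] in auto)
  also have "\<dots> = conv R m a b z \<oplus> conv R m a b' z"
    by (subst (1 2) s[symmetric]) (use b b' in auto)
  finally show "conv R m a (\<lambda>y. b y \<oplus> b' y) z = conv R m a b z \<oplus> conv R m a b' z" .
qed

lemma conv_zero_left: "conv R m (\<lambda>_. \<zero>) b = (\<lambda>_. \<zero>)"
  by (simp add: conv_def)

lemma conv_zero_right: "conv R m a (\<lambda>_. \<zero>) = (\<lambda>_. \<zero>)"
  by (simp add: conv_def)

lemma conv_monomial:
  assumes "r \<in> carrier R" "s \<in> carrier R"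
  shows "conv R m (monomial R x r) (monomial R y s) = monomial R (m x y) (r \<otimes> s)"
proof
  fix z
  have "conv R m (monomial R x r) (monomial R y s) z =
     finsum R (\<lambda>(x', y'). monomial R x r x' \<otimes> monomial R y s y') {(x', y') \<in> {x} \<times> {y}. m x' y' = z}"
    by (rule conv_superset[OF fin_supp_monomial[of _ UNIV] fin_supp_monomial[of _ UNIV]])
      (use assms in \<open>auto simp: monomial_def\<close>)
  also have "{(x', y') \<in> {x} \<times> {y}. m x' y' = z} = (if m x y = z then {(x, y)} else {})"
    by auto
  finally show "conv R m (monomial R x r) (monomial R y s) z = monomial R (m x y) (r \<otimes> s) z"
    using assms by (auto simp: monomial_def)
qed

text \<open>\<open>fin_supp_hom_eq\<close> is applied twice: to the first variable with
  \<open>b\<close> fixed, then to the second one with a monomial in the first place.\<close>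

lemma biadditive_eq:
  assumes f: "\<And>a a' b. \<lbrakk>a \<in> fin_supp R X; a' \<in> fin_supp R X; b \<in> fin_supp R Y\<rbrakk> \<Longrightarrow>
      f (\<lambda>x. a x \<oplus> a' x) b = h (f a b) (f a' b)"
    "\<And>a b b'. \<lbrakk>a \<in> fin_supp R X; b \<in> fin_supp R Y; b' \<in> fin_supp R Y\<rbrakk> \<Longrightarrow>
      f a (\<lambda>x. b x \<oplus> b' x) = h (f a b) (f a b')"
    and g: "\<And>a a' b. \<lbrakk>a \<in> fin_supp R X; a' \<in> fin_supp R X; b \<in> fin_supp R Y\<rbrakk> \<Longrightarrow>
      g (\<lambda>x. a x \<oplus> a' x) b = h (g a b) (g a' b)"
    "\<And>a b b'. \<lbrakk>a \<in> fin_supp R X; b \<in> fin_supp R Y; b' \<in> fin_supp R Y\<rbrakk> \<Longrightarrow>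
      g a (\<lambda>x. b x \<oplus> b' x) = h (g a b) (g a b')"
    and z: "\<And>b. b \<in> fin_supp R Y \<Longrightarrow> f (\<lambda>_. \<zero>) b = g (\<lambda>_. \<zero>) b"
      "\<And>a. a \<in> fin_supp R X \<Longrightarrow> f a (\<lambda>_. \<zero>) = g a (\<lambda>_. \<zero>)"
    and eq: "\<And>x r y s. \<lbrakk>x \<in> X; r \<in> carrier R; y \<in> Y; s \<in> carrier R\<rbrakk> \<Longrightarrow>
      f (monomial R x r) (monomial R y s) = g (monomial R x r) (monomial R y s)"
    and ab: "a \<in> fin_supp R X" "b \<in> fin_supp R Y"
  shows "f a b = g a b"
proof (rule fin_supp_hom_eq[where f = "\<lambda>a. f a b" and g = "\<lambda>a. g a b" and h = h])
  fix x r assume x: "x \<in> X" "r \<in> carrier R"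
  show "f (monomial R x r) b = g (monomial R x r) b"
  proof -
    note m = fin_supp_monomial[OF x]
    show ?thesis
      by (rule fin_supp_hom_eq[where f = "f (monomial R x r)" and h = h,
          OF f(2)[OF m] g(2)[OF m] eq[OF x] z(2)[OF m] ab(2)])
  qed
qed (use f g z ab in auto)

end

section \<open>Tensor products\<close>

lemma free_Abelian_group_diff_closed:
  assumes "u \<in> carrier (free_Abelian_group S)" "v \<in> carrier (free_Abelian_group S)"
  shows "u - v \<in> carrier (free_Abelian_group S)"
  using assms order_trans[OF keys_diff, of u v S] by simp

text \<open>Stated for differences because both the tensor relations and the induction rule for free
  abelian groups are phrased with them.\<close>

lemma hom_free_Abelian_group_diff:
  assumes "group B" "f \<in> hom (free_Abelian_group S) B"
    and u: "u \<in> carrier (free_Abelian_group S)" and v: "v \<in> carrier (free_Abelian_group S)"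
  shows "f (u - v) = f u \<otimes>\<^bsub>B\<^esub> inv\<^bsub>B\<^esub> f v"
proof -
  interpret f: group_hom "free_Abelian_group S" B f
    using assms by (simp add: group_hom_def group_hom_axioms_def)
  have "u - v = u \<otimes>\<^bsub>free_Abelian_group S\<^esub> inv\<^bsub>free_Abelian_group S\<^esub> v" using v by simp
  also have "f \<dots> = f u \<otimes>\<^bsub>B\<^esub> inv\<^bsub>B\<^esub> f v"
    using f.hom_mult[OF u f.G.inv_closed[OF v]] f.hom_inv[OF v] by metis
  finally show ?thesis .
qed

lemma free_Abelian_group_hom_eq:
  assumes B: "group B" and f: "f \<in> hom (free_Abelian_group S) B" and g: "g \<in> hom (free_Abelian_group S) B"
    and eq: "\<And>a. a \<in> S \<Longrightarrow> f (frag_of a) = g (frag_of a)"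
    and z: "z \<in> carrier (free_Abelian_group S)"
  shows "f z = g z"
proof (rule free_Abelian_group_induct[where x = z and S = S and P = "\<lambda>z. f z = g z"])
  show "f 0 = g 0"
    using hom_one[OF f group_free_Abelian_group B] hom_one[OF g group_free_Abelian_group B] by simp
qed (use z eq hom_free_Abelian_group_diff[OF B f] hom_free_Abelian_group_diff[OF B g] in auto)

text \<open>Closure under the two actions puts the balancing relations into the free abelian group
  on pairs, which is what the quotient construction requires.\<close>

locale tensor_factors = M: abelian_group M + N: abelian_group N
  for S :: "('s, 'k) ring_scheme" and M :: "('m, 'l) ring_scheme" and rs :: "'m \<Rightarrow> 's \<Rightarrow> 'm"
    and N :: "('n, 'j) ring_scheme" and ls :: "'s \<Rightarrow> 'n \<Rightarrow> 'n" +
  assumes rs_closed: "\<lbrakk>x \<in> carrier M; s \<in> carrier S\<rbrakk> \<Longrightarrow> rs x s \<in> carrier M"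
    and ls_closed: "\<lbrakk>s \<in> carrier S; d \<in> carrier N\<rbrakk> \<Longrightarrow> ls s d \<in> carrier N"
begin

abbreviation "FAG \<equiv> free_Abelian_group (carrier M \<times> carrier N)"
abbreviation "K \<equiv> tensor_kernel S M rs N ls"
abbreviation "T \<equiv> tensor_product S M rs N ls"
abbreviation elem :: "'m \<Rightarrow> 'n \<Rightarrow> ('m \<times> 'n \<Rightarrow>\<^sub>0 int) set" where
  "elem \<equiv> elem_tensor S M rs N ls"

lemma relations_closed: "tensor_relations S M rs N ls \<subseteq> carrier FAG"
  unfolding tensor_relations_def
  by (auto simp: rs_closed ls_closed simp del: carrier_free_Abelian_group_iff
      intro!: free_Abelian_group_diff_closed)

lemma relations_in_kernel: "tensor_relations S M rs N ls \<subseteq> K"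
  by (auto simp: tensor_kernel_def intro: generate.incl)

lemma kernel_normal: "K \<lhd> FAG"
  unfolding tensor_kernel_def
  by (intro comm_group.subgroup_imp_normal[OF abelian_free_Abelian_group]
      group.generate_is_subgroup[OF group_free_Abelian_group] relations_closed)

lemma tensor_comm_group: "comm_group T"
  unfolding tensor_product_def
  by (rule comm_group.abelian_FactGroup[OF abelian_free_Abelian_group
      normal_imp_subgroup[OF kernel_normal]])

lemma tensor_group: "group T"
  using tensor_comm_group by (simp add: comm_group_def)

lemma quotient_hom: "(\<lambda>z. K #>\<^bsub>FAG\<^esub> z) \<in> hom FAG T"
  unfolding tensor_product_def by (rule normal.r_coset_hom_Mod[OF kernel_normal])

lemma frag_of_closed: "\<lbrakk>x \<in> carrier M; d \<in> carrier N\<rbrakk> \<Longrightarrow> frag_of (x, d) \<in> carrier FAG"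
  by simp

lemma elem_closed: "\<lbrakk>x \<in> carrier M; d \<in> carrier N\<rbrakk> \<Longrightarrow> elem x d \<in> carrier T"
  using hom_in_carrier[OF quotient_hom frag_of_closed] by (simp add: elem_tensor_def)

lemma quotient_eq:
  assumes "a \<in> carrier FAG" "b \<in> carrier FAG" "a - b \<in> K"
  shows "K #>\<^bsub>FAG\<^esub> a = K #>\<^bsub>FAG\<^esub> b"
proof -
  have K: "subgroup K FAG" using kernel_normal by (rule normal_imp_subgroup)
  have "a = (a - b) \<otimes>\<^bsub>FAG\<^esub> b" by simp
  then have "a \<in> K #>\<^bsub>FAG\<^esub> b"
    using assms(3) unfolding r_coset_def by blast
  then show ?thesis
    using group.repr_independence[OF group_free_Abelian_group _ assms(2) K] by metis
qed

lemma elem_add_left: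
  assumes "x \<in> carrier M" "y \<in> carrier M" "d \<in> carrier N"
  shows "elem (x \<oplus>\<^bsub>M\<^esub> y) d = elem x d \<otimes>\<^bsub>T\<^esub> elem y d"
proof -
  have "K #>\<^bsub>FAG\<^esub> frag_of (x \<oplus>\<^bsub>M\<^esub> y, d) = K #>\<^bsub>FAG\<^esub> (frag_of (x, d) \<otimes>\<^bsub>FAG\<^esub> frag_of (y, d))"
  proof (rule quotient_eq)
    have "frag_of (x \<oplus>\<^bsub>M\<^esub> y, d) - frag_of (x, d) - frag_of (y, d) \<in> tensor_relations S M rs N ls"
      unfolding tensor_relations_def using assms by blast
    then show "frag_of (x \<oplus>\<^bsub>M\<^esub> y, d) - frag_of (x, d) \<otimes>\<^bsub>FAG\<^esub> frag_of (y, d) \<in> K"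
      using relations_in_kernel by (auto simp: algebra_simps)
  qed (use assms in \<open>auto intro!: order_trans[OF keys_add]\<close>)
  also have "\<dots> = (K #>\<^bsub>FAG\<^esub> frag_of (x, d)) \<otimes>\<^bsub>T\<^esub> (K #>\<^bsub>FAG\<^esub> frag_of (y, d))"
    by (rule hom_mult[OF quotient_hom]) (use assms in simp_all)
  finally show ?thesis by (simp add: elem_tensor_def)
qed

lemma elem_add_right:
  assumes "x \<in> carrier M" "d \<in> carrier N" "c \<in> carrier N"
  shows "elem x (d \<oplus>\<^bsub>N\<^esub> c) = elem x d \<otimes>\<^bsub>T\<^esub> elem x c"
proof -
  have "K #>\<^bsub>FAG\<^esub> frag_of (x, d \<oplus>\<^bsub>N\<^esub> c) = K #>\<^bsub>FAG\<^esub> (frag_of (x, d) \<otimes>\<^bsub>FAG\<^esub> frag_of (x, c))"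
  proof (rule quotient_eq)
    have "frag_of (x, d \<oplus>\<^bsub>N\<^esub> c) - frag_of (x, d) - frag_of (x, c) \<in> tensor_relations S M rs N ls"
      unfolding tensor_relations_def using assms by blast
    then show "frag_of (x, d \<oplus>\<^bsub>N\<^esub> c) - frag_of (x, d) \<otimes>\<^bsub>FAG\<^esub> frag_of (x, c) \<in> K"
      using relations_in_kernel by (auto simp: algebra_simps)
  qed (use assms in \<open>auto intro!: order_trans[OF keys_add]\<close>)
  also have "\<dots> = (K #>\<^bsub>FAG\<^esub> frag_of (x, d)) \<otimes>\<^bsub>T\<^esub> (K #>\<^bsub>FAG\<^esub> frag_of (x, c))"
    by (rule hom_mult[OF quotient_hom]) (use assms in simp_all)
  finally show ?thesis by (simp add: elem_tensor_def)
qed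

lemma elem_balanced:
  assumes "x \<in> carrier M" "s \<in> carrier S" "d \<in> carrier N"
  shows "elem (rs x s) d = elem x (ls s d)"
  unfolding elem_tensor_def
proof (rule quotient_eq)
  have "frag_of (rs x s, d) - frag_of (x, ls s d) \<in> tensor_relations S M rs N ls"
    unfolding tensor_relations_def using assms by blast
  then show "frag_of (rs x s, d) - frag_of (x, ls s d) \<in> K"
    using relations_in_kernel by auto
qed (use assms in \<open>auto simp: rs_closed ls_closed\<close>)

text \<open>This replaces the choice of a representation as a sum of elementary tensors. Later it is
  applied to a tensor known only through its image 1 under an isomorphism.\<close>

lemma tensor_hom_eq:
  assumes B: "group B" and h: "h \<in> hom T B" and h': "h' \<in> hom T B"
    and eq: "\<And>x d. \<lbrakk>x \<in> carrier M; d \<in> carrier N\<rbrakk> \<Longrightarrow> h (elem x d) = h' (elem x d)"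
    and \<tau>: "\<tau> \<in> carrier T"
  shows "h \<tau> = h' \<tau>"
proof -
  obtain z where z: "z \<in> carrier FAG" "\<tau> = K #>\<^bsub>FAG\<^esub> z"
    using \<tau> by (auto simp: tensor_product_def carrier_FactGroup)
  let ?q = "\<lambda>z. K #>\<^bsub>FAG\<^esub> z"
  have hq: "h \<circ> ?q \<in> hom FAG B" and hq': "h' \<circ> ?q \<in> hom FAG B"
    using Group.hom_compose[OF quotient_hom h] Group.hom_compose[OF quotient_hom h'] by auto
  have "(h \<circ> ?q) z = (h' \<circ> ?q) z"
    by (rule free_Abelian_group_hom_eq[OF B hq hq' _ z(1)]) (auto simp: eq elem_tensor_def[symmetric])
  then show ?thesis by (simp add: z)
qed

text \<open>The target is a multiplicative group record, so that it can be the additive group of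
  \<open>D\<close> and also the tensor product itself.\<close>

lemma tensor_universal:
  fixes B :: "('b, 'i) monoid_scheme"
  assumes B: "comm_group B"
    and closed: "\<And>x d. \<lbrakk>x \<in> carrier M; d \<in> carrier N\<rbrakk> \<Longrightarrow> b x d \<in> carrier B"
    and add_left: "\<And>x y d. \<lbrakk>x \<in> carrier M; y \<in> carrier M; d \<in> carrier N\<rbrakk> \<Longrightarrow>
      b (x \<oplus>\<^bsub>M\<^esub> y) d = b x d \<otimes>\<^bsub>B\<^esub> b y d"
    and add_right: "\<And>x d c. \<lbrakk>x \<in> carrier M; d \<in> carrier N; c \<in> carrier N\<rbrakk> \<Longrightarrow>
      b x (d \<oplus>\<^bsub>N\<^esub> c) = b x d \<otimes>\<^bsub>B\<^esub> b x c"
    and balanced: "\<And>x s d. \<lbrakk>x \<in> carrier M; s \<in> carrier S; d \<in> carrier N\<rbrakk> \<Longrightarrow>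
      b (rs x s) d = b x (ls s d)"
  obtains h where "h \<in> hom T B"
    "\<And>x d. \<lbrakk>x \<in> carrier M; d \<in> carrier N\<rbrakk> \<Longrightarrow> h (elem x d) = b x d"
proof -
  interpret B: comm_group B by fact
  have "(\<lambda>(x, d). b x d) ` (carrier M \<times> carrier N) \<subseteq> carrier B"
    using closed by auto
  then obtain g where g: "g \<in> hom FAG B"
    and g_of: "\<And>p. p \<in> carrier M \<times> carrier N \<Longrightarrow> g (frag_of p) = (\<lambda>(x, d). b x d) p"
    by (rule B.free_Abelian_group_universal) blast
  interpret g: group_hom FAG B g
    using g by (simp add: group_hom_def group_hom_axioms_def)
  note g_diff = hom_free_Abelian_group_diff[OF B.is_group g]
  have cancel: "p \<otimes>\<^bsub>B\<^esub> q \<otimes>\<^bsub>B\<^esub> inv\<^bsub>B\<^esub> p \<otimes>\<^bsub>B\<^esub> inv\<^bsub>B\<^esub> q = \<one>\<^bsub>B\<^esub>"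
    if "p \<in> carrier B" "q \<in> carrier B" for p q
    using that B.r_inv[of "p \<otimes>\<^bsub>B\<^esub> q"] by (simp add: B.m_assoc B.inv_mult)
  have "tensor_relations S M rs N ls \<subseteq> kernel FAG B g"
  proof
    fix z assume z: "z \<in> tensor_relations S M rs N ls"
    then have "g z = \<one>\<^bsub>B\<^esub>"
      unfolding tensor_relations_def
    proof (elim UnE CollectE exE conjE)
      fix x y d assume *: "z = frag_of (x \<oplus>\<^bsub>M\<^esub> y, d) - frag_of (x, d) - frag_of (y, d)"
        "x \<in> carrier M" "y \<in> carrier M" "d \<in> carrier N"
      show ?thesis unfolding *(1)
        by (subst g_diff, (rule free_Abelian_group_diff_closed | simp add: *)+, subst g_diff)
          (simp_all add: * g_of add_left closed cancel)
    next
      fix x d c assume *: "z = frag_of (x, d \<oplus>\<^bsub>N\<^esub> c) - frag_of (x, d) - frag_of (x, c)"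
        "x \<in> carrier M" "d \<in> carrier N" "c \<in> carrier N"
      show ?thesis unfolding *(1)
        by (subst g_diff, (rule free_Abelian_group_diff_closed | simp add: *)+, subst g_diff)
          (simp_all add: * g_of add_right closed cancel)
    next
      fix x s d assume *: "z = frag_of (rs x s, d) - frag_of (x, ls s d)"
        "x \<in> carrier M" "s \<in> carrier S" "d \<in> carrier N"
      show ?thesis unfolding *(1)
        by (subst g_diff) (simp_all add: * g_of balanced closed rs_closed ls_closed)
    qed
    then show "z \<in> kernel FAG B g"
      unfolding kernel_def using relations_closed z
      by (auto simp del: carrier_free_Abelian_group_iff)
  qed
  then have "K \<subseteq> kernel FAG B g"
    unfolding tensor_kernel_def
    by (rule group.generate_subgroup_incl[OF group_free_Abelian_group _ g.subgroup_kernel])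
  then obtain h where "h \<in> hom T B" "\<And>z. z \<in> carrier FAG \<Longrightarrow> h (K #>\<^bsub>FAG\<^esub> z) = g z"
    using g.FactGroup_universal_kernel[OF kernel_normal] unfolding tensor_product_def by blast
  then show thesis
    using that g_of by (simp add: elem_tensor_def)
qed

lemma elem_zero_right:
  assumes "x \<in> carrier M"
  shows "elem x \<zero>\<^bsub>N\<^esub> = \<one>\<^bsub>T\<^esub>"
proof -
  have c: "elem x \<zero>\<^bsub>N\<^esub> \<in> carrier T" using assms by (simp add: elem_closed)
  have "elem x \<zero>\<^bsub>N\<^esub> \<otimes>\<^bsub>T\<^esub> elem x \<zero>\<^bsub>N\<^esub> = elem x \<zero>\<^bsub>N\<^esub>"
    using elem_add_right[of x "\<zero>\<^bsub>N\<^esub>" "\<zero>\<^bsub>N\<^esub>"] assms by simp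
  then show ?thesis using group.r_cancel_one[OF tensor_group c c] by simp
qed

end

section \<open>Rings without unit, their quotients, and free algebras\<close>

lemma hom_finprod:
  assumes A: "comm_group A" and B: "comm_group B" and f: "f \<in> hom A B" and g: "g \<in> I \<rightarrow> carrier A"
  shows "f (finprod A g I) = finprod B (\<lambda>i. f (g i)) I"
proof -
  interpret A: comm_group A by fact
  interpret B: comm_group B by fact
  show ?thesis
    using g
  proof (induction I rule: infinite_finite_induct)
    case (insert i I)
    then have "f (finprod A g (insert i I)) = f (g i \<otimes>\<^bsub>A\<^esub> finprod A g I)"
      by (subst A.finprod_insert) auto
    also have "\<dots> = f (g i) \<otimes>\<^bsub>B\<^esub> f (finprod A g I)"
      using hom_mult[OF f] insert by auto
    also have "\<dots> = finprod B (\<lambda>i. f (g i)) (insert i I)"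
      using insert hom_in_carrier[OF f] by (subst B.finprod_insert) auto
    finally show ?case .
  qed (use hom_one[OF f A.is_group B.is_group] in auto)
qed

lemma hom_finsum:
  assumes "abelian_group A" "abelian_group B" "f \<in> hom (add_monoid A) (add_monoid B)"
    and "g \<in> I \<rightarrow> carrier A"
  shows "f (finsum A g I) = finsum B (\<lambda>i. f (g i)) I"
  using hom_finprod[of "add_monoid A" "add_monoid B" f g I] assms
  by (simp add: finsum_def abelian_group.a_comm_group)

text \<open>Filling in the field \<open>one\<close> changes neither carrier nor operations, but
  turns a ring that happens to have a unit into a \<open>ring\<close>, to which the theory of unital
  rings applies.\<close>

lemma nonunital_ring_update_one:
  assumes "nonunital_ring D" "e \<in> carrier D"
    and "\<And>d. d \<in> carrier D \<Longrightarrow> e \<otimes>\<^bsub>D\<^esub> d = d" "\<And>d. d \<in> carrier D \<Longrightarrow> d \<otimes>\<^bsub>D\<^esub> e = d"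
  shows "ring (D\<lparr>one := e\<rparr>)"
proof -
  interpret D: nonunital_ring D by fact
  have "abelian_group (D\<lparr>one := e\<rparr>)"
    by (rule abelian_groupI) (use D.a_assoc D.a_comm D.add.l_inv_ex in auto)
  then show ?thesis
    by (rule ringI)
      (auto intro!: monoidI simp: assms D.m_closed D.m_assoc D.l_distr D.r_distr)
qed

text \<open>A one-sided unit of a ring with local units is a two-sided unit, because it agrees with any
  local unit for itself.\<close>

lemma local_unit_ring_left_unit:
  assumes D: "local_unit_ring D" and e: "e \<in> carrier D"
    and l: "\<And>d. d \<in> carrier D \<Longrightarrow> e \<otimes>\<^bsub>D\<^esub> d = d"
  shows "ring (D\<lparr>one := e\<rparr>)"
proof (rule nonunital_ring_update_one[OF _ e l])
  show "nonunital_ring D" using D by (simp add: local_unit_ring_def)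
  fix d assume d: "d \<in> carrier D"
  obtain f where f: "f \<in> carrier D" "\<And>x. x \<in> {e, d} \<Longrightarrow> f \<otimes>\<^bsub>D\<^esub> x = x \<and> x \<otimes>\<^bsub>D\<^esub> f = x"
    using D e d unfolding local_unit_ring_def has_local_units_def
    by (metis empty_subsetI finite.emptyI finite.insertI insert_subset)
  have "e = f" using f l[OF f(1)] by auto
  then show "d \<otimes>\<^bsub>D\<^esub> e = d" using f by auto
qed

lemma ring_has_local_units:
  assumes "ring (D\<lparr>one := e\<rparr>)"
  shows "has_local_units D"
proof -
  interpret ring "D\<lparr>one := e\<rparr>" by fact
  have "e \<in> carrier D" using one_closed by simp
  moreover have "e \<otimes>\<^bsub>D\<^esub> d = d" "d \<otimes>\<^bsub>D\<^esub> e = d" if "d \<in> carrier D" for d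
    using l_one[of d] r_one[of d] that by simp_all
  ultimately show ?thesis unfolding has_local_units_def by blast
qed

text \<open>Covariance speaks of addition and multiplication in \<open>D\<close>, so representations
  pass freely between \<open>D\<close> and its version with a unit filled in.\<close>

lemma covariant_reps_update_one: "covariant_reps F (D\<lparr>one := e\<rparr>) = covariant_reps F D"
  unfolding covariant_reps_def tensor_product_def elem_tensor_def tensor_kernel_def
    tensor_relations_def by simp

section \<open>Quotients of rings without unit by two-sided ideals\<close>

context nonunital_ring
begin

lemma m_zero: "x \<in> carrier D \<Longrightarrow> x \<otimes> \<zero> = \<zero>"
  using r_distr[of \<zero> \<zero> x] m_closed[of x \<zero>] add.r_cancel_one'[of "x \<otimes> \<zero>" "x \<otimes> \<zero>"] by simp

lemma zero_m: "x \<in> carrier D \<Longrightarrow> \<zero> \<otimes> x = \<zero>"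
  using l_distr[of \<zero> \<zero> x] m_closed[of \<zero> x] add.r_cancel_one'[of "\<zero> \<otimes> x" "\<zero> \<otimes> x"] by simp

end

locale nonunital_ideal = nonunital_ring D for D (structure) and J +
  assumes ideal_additive: "additive_subgroup J D"
    and ideal_left: "\<lbrakk>a \<in> carrier D; j \<in> J\<rbrakk> \<Longrightarrow> a \<otimes> j \<in> J"
    and ideal_right: "\<lbrakk>a \<in> carrier D; j \<in> J\<rbrakk> \<Longrightarrow> j \<otimes> a \<in> J"
begin

sublocale J: abelian_subgroup J D
  by (rule abelian_subgroupI3[OF ideal_additive abelian_group_axioms])

lemma rcos_eq_iff:
  assumes "a \<in> carrier D" "b \<in> carrier D"
  shows "J +> a = J +> b \<longleftrightarrow> a \<ominus> b \<in> J"
proof -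
  have "a \<ominus> b \<in> J \<longleftrightarrow> a \<in> J +> b"
    using J.a_rcos_module_minus[OF _ assms(2,1)] J.a_rcos_module[OF assms(2,1)] by (simp add: a_minus_def)
  also have "\<dots> \<longleftrightarrow> J +> a = J +> b"
    using J.a_repr_independence'[OF _ assms(2)] J.a_rcos_self[OF assms(1)] by metis
  finally show ?thesis ..
qed

lemma quotient_carrier: "carrier (D Quot J) = (\<lambda>a. J +> a) ` carrier D"
  by (auto simp: FactRing_def A_RCOSETS_def' a_r_coset_def')

lemma quotient_add:
  "\<lbrakk>a \<in> carrier D; b \<in> carrier D\<rbrakk> \<Longrightarrow> (J +> a) \<oplus>\<^bsub>D Quot J\<^esub> (J +> b) = J +> (a \<oplus> b)"
  by (simp add: FactRing_def J.a_rcos_sum)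

lemma quotient_mult:
  assumes a: "a \<in> carrier D" and b: "b \<in> carrier D"
  shows "(J +> a) \<otimes>\<^bsub>D Quot J\<^esub> (J +> b) = J +> (a \<otimes> b)"
proof -
  \<comment> \<open>The product of two cosets in the quotient is a union over all representatives.
    It collapses to one coset because all of them give the same class.\<close>
  have eq: "J +> (a' \<otimes> b') = J +> (a \<otimes> b)" if "a' \<in> J +> a" "b' \<in> J +> b" for a' b'
  proof -
    obtain i j where i: "i \<in> J" "a' = i \<oplus> a" and j: "j \<in> J" "b' = j \<oplus> b"
      using \<open>a' \<in> J +> a\<close> \<open>b' \<in> J +> b\<close> by (auto simp: a_r_coset_def')
    have ij: "i \<in> carrier D" "j \<in> carrier D" using i j by auto
    have "a' \<otimes> b' = (i \<otimes> b' \<oplus> a \<otimes> j) \<oplus> a \<otimes> b"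
      unfolding i(2) j(2) using a b ij by (simp add: l_distr r_distr m_closed a_ac)
    moreover have "i \<otimes> b' \<oplus> a \<otimes> j \<in> J"
      using ideal_left[OF a j(1)] ideal_right[OF _ i(1), of b'] ij b by (simp add: j(2))
    ultimately have "a' \<otimes> b' \<in> J +> a \<otimes> b" by (auto simp: a_r_coset_def')
    then show ?thesis
      using J.a_repr_independence'[OF _ m_closed[OF a b]] by simp
  qed
  have "J +> a \<noteq> {}" "J +> b \<noteq> {}" using J.a_rcos_self a b by auto
  then show ?thesis using eq by (auto simp: FactRing_def rcoset_mult_def)
qed

lemma quotient_abelian_group: "abelian_group (D Quot J)"
  by (rule comm_group_abelian_groupI)
    (simp add: FactRing_def J.a_factorgroup_is_comm_group[unfolded A_FactGroup_def'])

lemma quotient_nonunital_ring: "nonunital_ring (D Quot J)"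
proof -
  interpret Q: abelian_group "D Quot J" by (rule quotient_abelian_group)
  show ?thesis
    by unfold_locales
      (auto simp: quotient_carrier quotient_add quotient_mult m_closed m_assoc l_distr r_distr)
qed

lemma quotient_hom: "(\<lambda>a. J +> a) \<in> hom (add_monoid D) (add_monoid (D Quot J))"
  by (auto simp: hom_def quotient_carrier quotient_add)

end

section \<open>The free algebra and the ideal of relations\<close>

context ring
begin

lemma free_algebra_carrier: "carrier (free_algebra R X) = fin_supp R (lists X - {[]})"
  by (simp add: free_algebra_def)

lemma free_algebra_mult: "a \<otimes>\<^bsub>free_algebra R X\<^esub> b = conv R (@) a b"
  by (simp add: free_algebra_def)

lemma free_algebra_add: "a \<oplus>\<^bsub>free_algebra R X\<^esub> b = (\<lambda>w. a w \<oplus> b w)"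
  by (simp add: free_algebra_def)

lemma free_algebra_zero: "\<zero>\<^bsub>free_algebra R X\<^esub> = (\<lambda>_. \<zero>)"
  by (simp add: free_algebra_def)

lemma free_algebra_abelian_group: "abelian_group (free_algebra R X)"
  by (rule fin_supp_abelian_group) (simp_all add: free_algebra_def)

lemma free_algebra_nonunital_ring: "nonunital_ring (free_algebra R X)"
proof -
  let ?W = "lists X - {[]}"
  interpret F: abelian_group "free_algebra R X" by (rule free_algebra_abelian_group)
  have cl: "conv R (@) a b \<in> fin_supp R ?W" if "a \<in> fin_supp R ?W" "b \<in> fin_supp R ?W" for a b
    using that by (rule conv_closed) auto
  have left: "conv R (@) (\<lambda>x. a x \<oplus> a' x) b = (\<lambda>z. conv R (@) a b z \<oplus> conv R (@) a' b z)"
    if "a \<in> fin_supp R ?W" "a' \<in> fin_supp R ?W" "b \<in> fin_supp R ?W" for a a' b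
    using that by (rule conv_add_left)
  have right: "conv R (@) a (\<lambda>x. b x \<oplus> b' x) = (\<lambda>z. conv R (@) a b z \<oplus> conv R (@) a b' z)"
    if "a \<in> fin_supp R ?W" "b \<in> fin_supp R ?W" "b' \<in> fin_supp R ?W" for a b b'
    using that by (rule conv_add_right)
  show ?thesis
  proof unfold_locales
    fix a b c assume abc: "a \<in> carrier (free_algebra R X)" "b \<in> carrier (free_algebra R X)"
      "c \<in> carrier (free_algebra R X)"
    then have a: "a \<in> fin_supp R ?W" and b: "b \<in> fin_supp R ?W" and c: "c \<in> fin_supp R ?W"
      by (simp_all add: free_algebra_carrier)
    show "(a \<oplus>\<^bsub>free_algebra R X\<^esub> b) \<otimes>\<^bsub>free_algebra R X\<^esub> c =
        a \<otimes>\<^bsub>free_algebra R X\<^esub> c \<oplus>\<^bsub>free_algebra R X\<^esub> b \<otimes>\<^bsub>free_algebra R X\<^esub> c"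
      by (simp add: free_algebra_mult free_algebra_add left a b c)
    show "c \<otimes>\<^bsub>free_algebra R X\<^esub> (a \<oplus>\<^bsub>free_algebra R X\<^esub> b) =
        c \<otimes>\<^bsub>free_algebra R X\<^esub> a \<oplus>\<^bsub>free_algebra R X\<^esub> c \<otimes>\<^bsub>free_algebra R X\<^esub> b"
      by (simp add: free_algebra_mult free_algebra_add right a b c)
    show "a \<otimes>\<^bsub>free_algebra R X\<^esub> b \<in> carrier (free_algebra R X)"
      using cl[OF a b] by (simp add: free_algebra_mult free_algebra_carrier)
    \<comment> \<open>All three factors are reduced to monomials, first \<open>a\<close> and
      \<open>b\<close>, then \<open>c\<close>. What remains is associativity of concatenation and of
      the product in \<open>R\<close>.\<close>
    have "conv R (@) (conv R (@) a b) c = conv R (@) a (conv R (@) b c)"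
    proof (rule biadditive_eq[where f = "\<lambda>a b. conv R (@) (conv R (@) a b) c"
          and g = "\<lambda>a b. conv R (@) a (conv R (@) b c)" and h = "\<lambda>a b w. a w \<oplus> b w", OF _ _ _ _ _ _ _ a b])
      fix x y r s assume x: "x \<in> ?W" "r \<in> carrier R" and y: "y \<in> ?W" "s \<in> carrier R"
      note mx = fin_supp_monomial[OF x] and my = fin_supp_monomial[OF y]
      show "conv R (@) (conv R (@) (monomial R x r) (monomial R y s)) c =
          conv R (@) (monomial R x r) (conv R (@) (monomial R y s) c)"
      proof (rule fin_supp_hom_eq[where f = "\<lambda>c. conv R (@) (conv R (@) (monomial R x r) (monomial R y s)) c"
            and g = "\<lambda>c. conv R (@) (monomial R x r) (conv R (@) (monomial R y s) c)"
            and h = "\<lambda>a b w. a w \<oplus> b w", OF _ _ _ _ c])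
        fix a b assume a: "a \<in> fin_supp R ?W" and b: "b \<in> fin_supp R ?W"
        show "conv R (@) (conv R (@) (monomial R x r) (monomial R y s)) (\<lambda>x. a x \<oplus> b x) =
           (\<lambda>w. conv R (@) (conv R (@) (monomial R x r) (monomial R y s)) a w \<oplus>
                conv R (@) (conv R (@) (monomial R x r) (monomial R y s)) b w)"
          by (rule right[OF cl[OF mx my] a b])
        show "conv R (@) (monomial R x r) (conv R (@) (monomial R y s) (\<lambda>x. a x \<oplus> b x)) =
           (\<lambda>w. conv R (@) (monomial R x r) (conv R (@) (monomial R y s) a) w \<oplus>
             conv R (@) (monomial R x r) (conv R (@) (monomial R y s) b) w)"
          by (simp only: right mx my a b cl)
      qed (use x y in \<open>simp_all add: conv_monomial conv_zero_right m_assoc\<close>)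
    qed (simp_all only: left right cl c conv_zero_left conv_zero_right)
    then show "(a \<otimes>\<^bsub>free_algebra R X\<^esub> b) \<otimes>\<^bsub>free_algebra R X\<^esub> c =
        a \<otimes>\<^bsub>free_algebra R X\<^esub> (b \<otimes>\<^bsub>free_algebra R X\<^esub> c)"
      by (simp add: free_algebra_mult)
  qed
qed

lemma lscale_closed:
  assumes "r \<in> carrier R" "a \<in> fin_supp R X"
  shows "lscale R r a \<in> fin_supp R X"
proof -
  have "{x. r \<otimes> a x \<noteq> \<zero>} \<subseteq> {x. a x \<noteq> \<zero>}" using assms by auto
  then have "finite {x. r \<otimes> a x \<noteq> \<zero>}"
    using fin_supp_finite[OF assms(2)] finite_subset by blast
  then show ?thesis using assms by (auto simp: fin_supp_def lscale_def)
qed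

lemma rscale_closed:
  assumes "r \<in> carrier R" "a \<in> fin_supp R X"
  shows "rscale R a r \<in> fin_supp R X"
proof -
  have "{x. a x \<otimes> r \<noteq> \<zero>} \<subseteq> {x. a x \<noteq> \<zero>}" using assms by auto
  then have "finite {x. a x \<otimes> r \<noteq> \<zero>}"
    using fin_supp_finite[OF assms(2)] finite_subset by blast
  then show ?thesis using assms by (auto simp: fin_supp_def rscale_def)
qed

lemma lscale_add:
  "\<lbrakk>r \<in> carrier R; a \<in> fin_supp R X; b \<in> fin_supp R X\<rbrakk> \<Longrightarrow>
    lscale R r (\<lambda>x. a x \<oplus> b x) = (\<lambda>x. lscale R r a x \<oplus> lscale R r b x)"
  using fin_supp_value[of a X] fin_supp_value[of b X] by (auto simp: lscale_def r_distr)

lemma rscale_add: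
  "\<lbrakk>r \<in> carrier R; a \<in> fin_supp R X; b \<in> fin_supp R X\<rbrakk> \<Longrightarrow>
    rscale R (\<lambda>x. a x \<oplus> b x) r = (\<lambda>x. rscale R a r x \<oplus> rscale R b r x)"
  using fin_supp_value[of a X] fin_supp_value[of b X] by (auto simp: rscale_def l_distr)

lemma lscale_monomial:
  "\<lbrakk>r \<in> carrier R; s \<in> carrier R\<rbrakk> \<Longrightarrow> lscale R r (monomial R x s) = monomial R x (r \<otimes> s)"
  by (auto simp: lscale_def monomial_def)

lemma rscale_monomial:
  "\<lbrakk>r \<in> carrier R; s \<in> carrier R\<rbrakk> \<Longrightarrow> rscale R (monomial R x s) r = monomial R x (s \<otimes> r)"
  by (auto simp: rscale_def monomial_def)

text \<open>Ensures that the family of ideals whose intersection defines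
  \<open>relation_ideal\<close> is not empty, so that the intersection is a subgroup.\<close>

lemma algebra_ideal_carrier: "algebra_ideal R X (carrier (free_algebra R X))"
proof -
  interpret F: nonunital_ring "free_algebra R X" by (rule free_algebra_nonunital_ring)
  show ?thesis
    unfolding algebra_ideal_def
    by (auto simp: F.m_closed[unfolded free_algebra_carrier] free_algebra_carrier lscale_closed rscale_closed
        intro!: additive_subgroupI group.subgroup_self[OF F.a_group, simplified])
qed

lemma relation_ideal_is_ideal:
  assumes "E \<subseteq> carrier (free_algebra R X) \<times> carrier (free_algebra R X)"
  shows "algebra_ideal R X (relation_ideal R X E)"
proof -
  let ?F = "free_algebra R X"
  let ?C = "{J. algebra_ideal R X J \<and> (\<forall>(a, b)\<in>E. a \<ominus>\<^bsub>?F\<^esub> b \<in> J)}"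
  interpret F: abelian_group ?F by (rule free_algebra_abelian_group)
  have "carrier ?F \<in> ?C"
    using assms algebra_ideal_carrier by auto
  then have ne: "?C \<noteq> {}" by blast
  have "subgroup (\<Inter>?C) (add_monoid ?F)"
    by (rule group.subgroups_Inter[OF F.a_group])
      (use ne in \<open>auto simp: algebra_ideal_def additive_subgroup_def\<close>)
  then have "additive_subgroup (\<Inter>?C) ?F" by (rule additive_subgroupI)
  then show ?thesis
    unfolding relation_ideal_def by (auto simp: algebra_ideal_def)
qed

end

lemma relation_in_ideal:
  "(a, b) \<in> E \<Longrightarrow> a \<ominus>\<^bsub>free_algebra R X\<^esub> b \<in> relation_ideal R X E"
  by (auto simp: relation_ideal_def)

lemma relation_ideal_least:
  "\<lbrakk>algebra_ideal R X J; \<And>a b. (a, b) \<in> E \<Longrightarrow> a \<ominus>\<^bsub>free_algebra R X\<^esub> b \<in> J\<rbrakk> \<Longrightarrow>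
    relation_ideal R X E \<subseteq> J"
  by (auto simp: relation_ideal_def)

section \<open>Systems satisfying the relations\<close>

locale endo_action = R: ring R + P: monoid P + G: group G
  for R :: "'r ring" and P :: "'p monoid" and G :: "'g monoid" +
  fixes \<theta> :: "'p \<Rightarrow> 'g \<Rightarrow> 'g"
  assumes \<theta>_hom: "p \<in> carrier P \<Longrightarrow> \<theta> p \<in> hom G G"
    and \<theta>_inj: "p \<in> carrier P \<Longrightarrow> inj_on (\<theta> p) (carrier G)"
    and \<theta>_comp: "\<lbrakk>p \<in> carrier P; q \<in> carrier P; g \<in> carrier G\<rbrakk> \<Longrightarrow> \<theta> p (\<theta> q g) = \<theta> (p \<otimes>\<^bsub>P\<^esub> q) g"
    and \<theta>_id: "g \<in> carrier G \<Longrightarrow> \<theta> \<one>\<^bsub>P\<^esub> g = g"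
    and finite_index: "p \<in> carrier P \<Longrightarrow> finite (lcosets\<^bsub>G\<^esub> (\<theta> p ` carrier G))"
begin

abbreviation FG :: "('g \<Rightarrow> 'r) set" where "FG \<equiv> fin_supp R (carrier G)"
abbreviation diagram :: "('p, 'g \<Rightarrow> 'r) bimodule_diagram" where
  "diagram \<equiv> ring_diagram R (endo_diagram P G \<theta>)"
abbreviation pair :: "'p \<Rightarrow> ('g \<Rightarrow> 'r) \<Rightarrow> ('g \<Rightarrow> 'r) \<Rightarrow> 'g \<Rightarrow> 'r" where
  "pair p \<equiv> conv R (\<lambda>x y. x \<otimes>\<^bsub>G\<^esub> \<theta> p y)"

lemma \<theta>_closed [simp]: "\<lbrakk>p \<in> carrier P; g \<in> carrier G\<rbrakk> \<Longrightarrow> \<theta> p g \<in> carrier G"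
  using hom_in_carrier[OF \<theta>_hom] .

lemma \<theta>_mult: "\<lbrakk>p \<in> carrier P; g \<in> carrier G; h \<in> carrier G\<rbrakk> \<Longrightarrow> \<theta> p (g \<otimes>\<^bsub>G\<^esub> h) = \<theta> p g \<otimes>\<^bsub>G\<^esub> \<theta> p h"
  using hom_mult[OF \<theta>_hom] .

lemma \<theta>_one: "p \<in> carrier P \<Longrightarrow> \<theta> p \<one>\<^bsub>G\<^esub> = \<one>\<^bsub>G\<^esub>"
  using hom_one[OF \<theta>_hom G.is_group G.is_group] .

text \<open>Injectivity of \<open>\<theta> p\<close> makes the right action on
  \<open>X\<^sub>p\<close> free, so the element \<open>k\<close> in relation (2) is determined by
  \<open>g\<close> and \<open>h\<close>.\<close>

lemma \<theta>_unique:
  assumes "p \<in> carrier P" "g \<in> carrier G" "k \<in> carrier G" "l \<in> carrier G"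
    "g \<otimes>\<^bsub>G\<^esub> \<theta> p k = g \<otimes>\<^bsub>G\<^esub> \<theta> p l"
  shows "k = l"
proof (rule inj_onD[OF \<theta>_inj[OF assms(1)] _ assms(3,4)])
  show "\<theta> p k = \<theta> p l"
    using assms G.Units_l_cancel[of g "\<theta> p k" "\<theta> p l"] by (simp add: G.Units_eq)
qed

lemma diagram_simps:
  "shape diagram = P"
  "carrier (base_ring diagram) = FG"
  "carrier (fibre diagram p) = FG"
  "x \<oplus>\<^bsub>fibre diagram p\<^esub> y = (\<lambda>g. x g \<oplus>\<^bsub>R\<^esub> y g)"
  "rsmult (fibre diagram p) = pair p"
  "pairing diagram p q = pair p"
  by (simp_all add: ring_diagram_def endo_diagram_def group_ring_def biset_module_def)

lemma fibre_abelian_group: "abelian_group (fibre diagram p)"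
  by (rule R.fin_supp_abelian_group)
    (simp_all add: ring_diagram_def endo_diagram_def biset_module_def)

lemma pair_closed: "\<lbrakk>p \<in> carrier P; x \<in> FG; y \<in> FG\<rbrakk> \<Longrightarrow> pair p x y \<in> FG"
  by (rule R.conv_closed) auto

section \<open>Cosets and their representatives\<close>

definition in_coset :: "'p \<Rightarrow> 'g \<Rightarrow> 'g \<Rightarrow> bool" where
  "in_coset p g h \<longleftrightarrow> (\<exists>k\<in>carrier G. g \<otimes>\<^bsub>G\<^esub> \<theta> p k = h)"

lemma subgroup_image: "p \<in> carrier P \<Longrightarrow> subgroup (\<theta> p ` carrier G) G"
  using group_hom.img_is_subgroup[of G G "\<theta> p"] \<theta>_hom
  by (simp add: group_hom_def group_hom_axioms_def G.is_group)

lemma lcoset_eq_iff: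
  assumes "p \<in> carrier P" "g \<in> carrier G" "h \<in> carrier G"
  shows "g <#\<^bsub>G\<^esub> (\<theta> p ` carrier G) = h <#\<^bsub>G\<^esub> (\<theta> p ` carrier G) \<longleftrightarrow> in_coset p g h"
proof -
  have mem: "x \<in> g <#\<^bsub>G\<^esub> (\<theta> p ` carrier G) \<longleftrightarrow> in_coset p g x" for x
    by (auto simp: l_coset_def in_coset_def)
  show ?thesis
  proof
    assume eq: "g <#\<^bsub>G\<^esub> (\<theta> p ` carrier G) = h <#\<^bsub>G\<^esub> (\<theta> p ` carrier G)"
    have "h \<in> h <#\<^bsub>G\<^esub> (\<theta> p ` carrier G)"
      unfolding l_coset_def using assms \<theta>_one by (auto intro!: bexI[of _ "\<one>\<^bsub>G\<^esub>"])
    then show "in_coset p g h" using eq mem by simp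
  next
    assume "in_coset p g h"
    then show "g <#\<^bsub>G\<^esub> (\<theta> p ` carrier G) = h <#\<^bsub>G\<^esub> (\<theta> p ` carrier G)"
      using G.l_repr_independence[OF _ assms(2) subgroup_image[OF assms(1)]] mem by simp
  qed
qed

lemma transversal_exists:
  assumes p: "p \<in> carrier P"
  obtains T where "left_transversal G (\<theta> p ` carrier G) T"
proof -
  let ?H = "\<theta> p ` carrier G"
  have "\<forall>c\<in>lcosets\<^bsub>G\<^esub> ?H. \<exists>t. t \<in> carrier G \<and> t <#\<^bsub>G\<^esub> ?H = c"
    by (auto simp: LCOSETS_def)
  then obtain f where f: "\<And>c. c \<in> lcosets\<^bsub>G\<^esub> ?H \<Longrightarrow> f c \<in> carrier G \<and> f c <#\<^bsub>G\<^esub> ?H = c"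
    by metis
  have "bij_betw (\<lambda>t. t <#\<^bsub>G\<^esub> ?H) (f ` (lcosets\<^bsub>G\<^esub> ?H)) (lcosets\<^bsub>G\<^esub> ?H)"
    by (rule bij_betw_byWitness[where f' = f]) (use f in auto)
  then have "left_transversal G ?H (f ` (lcosets\<^bsub>G\<^esub> ?H))"
    using f by (auto simp: left_transversal_def)
  then show thesis by (rule that)
qed

text \<open>Finite index enters the proof here. A sum over an infinite transversal would be 0 by
  convention, which would make relation (3) a different statement.\<close>

lemma transversal_finite:
  assumes "p \<in> carrier P" "left_transversal G (\<theta> p ` carrier G) T"
  shows "finite T"
  using assms finite_index bij_betw_finite unfolding left_transversal_def by blast

lemma transversal_subset: "left_transversal G H T \<Longrightarrow> T \<subseteq> carrier G"
  by (simp add: left_transversal_def)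

text \<open>In module terms: the functions 1_t form a basis of \<open>F\<^sub>p\<close> as a right
  module over \<open>F\<^sub>1\<close>. The last clause singles out the surviving term in later sums
  over the transversal.\<close>

lemma transversal_unique:
  assumes p: "p \<in> carrier P" and T: "left_transversal G (\<theta> p ` carrier G) T" and h: "h \<in> carrier G"
  obtains t k where "t \<in> T" "k \<in> carrier G" "t \<otimes>\<^bsub>G\<^esub> \<theta> p k = h"
    "\<And>t'. t' \<in> T \<Longrightarrow> in_coset p t' h \<longleftrightarrow> t' = t"
proof -
  let ?H = "\<theta> p ` carrier G"
  note TG = transversal_subset[OF T]
  have bij: "bij_betw (\<lambda>t. t <#\<^bsub>G\<^esub> ?H) T (lcosets\<^bsub>G\<^esub> ?H)"
    using T by (simp add: left_transversal_def)
  have "h <#\<^bsub>G\<^esub> ?H \<in> lcosets\<^bsub>G\<^esub> ?H" using h by (auto simp: LCOSETS_def)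
  then have "h <#\<^bsub>G\<^esub> ?H \<in> (\<lambda>t. t <#\<^bsub>G\<^esub> ?H) ` T"
    by (simp only: bij_betw_imp_surj_on[OF bij])
  then obtain t where t: "h <#\<^bsub>G\<^esub> ?H = t <#\<^bsub>G\<^esub> ?H" "t \<in> T" by (rule imageE)
  then have "in_coset p t h" using lcoset_eq_iff[OF p _ h] TG by auto
  then obtain k where k: "k \<in> carrier G" "t \<otimes>\<^bsub>G\<^esub> \<theta> p k = h" by (auto simp: in_coset_def)
  have "in_coset p t' h \<longleftrightarrow> t' = t" if "t' \<in> T" for t'
  proof -
    have "in_coset p t' h \<longleftrightarrow> t' <#\<^bsub>G\<^esub> ?H = t <#\<^bsub>G\<^esub> ?H"
      using lcoset_eq_iff[OF p _ h] TG that t by auto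
    also have "\<dots> \<longleftrightarrow> t' = t"
      using inj_on_eq_iff[OF bij_betw_imp_inj_on[OF bij] that t(2)] .
    finally show ?thesis .
  qed
  then show thesis using that t(2) k by blast
qed

end

text \<open>\<open>V\<close> and \<open>S\<close> are the values of \<open>\<delta>\<close> and
  \<open>\<delta>\<^sup>*\<close>, and \<rho> supplies the action of scalars, since \<open>D\<close>
  is only a ring. The product rule for \<open>S\<close> and
  \<open>S\<^sub>1\<^sub>,\<^sub>1 = 1\<close> are omitted because they follow
  (\<open>S_mult\<close>, \<open>S_one\<close>); this spares verifying them for covariant
  representations.\<close>

locale delta_system = endo_action R P G \<theta> + D: ring D
  for R :: "'r ring" and P :: "'p monoid" and G :: "'g monoid" and \<theta> :: "'p \<Rightarrow> 'g \<Rightarrow> 'g"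
    and D :: "'d ring" +
  fixes \<rho> :: "'r \<Rightarrow> 'd" and V S :: "'g \<Rightarrow> 'p \<Rightarrow> 'd"
  assumes \<rho>_hom: "\<rho> \<in> ring_hom R D"
    and V_closed [simp]: "\<lbrakk>g \<in> carrier G; p \<in> carrier P\<rbrakk> \<Longrightarrow> V g p \<in> carrier D"
    and S_closed [simp]: "\<lbrakk>g \<in> carrier G; p \<in> carrier P\<rbrakk> \<Longrightarrow> S g p \<in> carrier D"
    and \<rho>_V: "\<lbrakk>r \<in> carrier R; g \<in> carrier G; p \<in> carrier P\<rbrakk> \<Longrightarrow> V g p \<otimes>\<^bsub>D\<^esub> \<rho> r = \<rho> r \<otimes>\<^bsub>D\<^esub> V g p"
    and \<rho>_S: "\<lbrakk>r \<in> carrier R; g \<in> carrier G; p \<in> carrier P\<rbrakk> \<Longrightarrow> S g p \<otimes>\<^bsub>D\<^esub> \<rho> r = \<rho> r \<otimes>\<^bsub>D\<^esub> S g p"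
    and V_mult: "\<lbrakk>g \<in> carrier G; h \<in> carrier G; p \<in> carrier P; q \<in> carrier P\<rbrakk> \<Longrightarrow>
      V g p \<otimes>\<^bsub>D\<^esub> V h q = V (g \<otimes>\<^bsub>G\<^esub> \<theta> p h) (p \<otimes>\<^bsub>P\<^esub> q)"
    and V_one: "V \<one>\<^bsub>G\<^esub> \<one>\<^bsub>P\<^esub> = \<one>\<^bsub>D\<^esub>"
    and S_V_same: "\<lbrakk>g \<in> carrier G; p \<in> carrier P; k \<in> carrier G\<rbrakk> \<Longrightarrow>
      S g p \<otimes>\<^bsub>D\<^esub> V (g \<otimes>\<^bsub>G\<^esub> \<theta> p k) p = V k \<one>\<^bsub>P\<^esub>"
    and S_V_other: "\<lbrakk>g \<in> carrier G; h \<in> carrier G; p \<in> carrier P; \<not> in_coset p g h\<rbrakk> \<Longrightarrow>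
      S g p \<otimes>\<^bsub>D\<^esub> V h p = \<zero>\<^bsub>D\<^esub>"
    and V_S_sum: "\<lbrakk>p \<in> carrier P; left_transversal G (\<theta> p ` carrier G) T\<rbrakk> \<Longrightarrow>
      finsum D (\<lambda>t. V t p \<otimes>\<^bsub>D\<^esub> S t p) T = \<one>\<^bsub>D\<^esub>"
begin

lemma \<rho>_closed [simp]: "r \<in> carrier R \<Longrightarrow> \<rho> r \<in> carrier D"
  using ring_hom_closed[OF \<rho>_hom] .

text \<open>Relation (3) recovers \<open>z\<close> from its products with the
  \<open>V\<^sub>t\<^sub>,\<^sub>p\<close>, as the sum of all
  \<open>(z V\<^sub>t\<^sub>,\<^sub>p) S\<^sub>t\<^sub>,\<^sub>p\<close>.\<close>

lemma cancel_V:
  assumes p: "p \<in> carrier P" and x: "x \<in> carrier D" and y: "y \<in> carrier D"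
    and eq: "\<And>h. h \<in> carrier G \<Longrightarrow> x \<otimes>\<^bsub>D\<^esub> V h p = y \<otimes>\<^bsub>D\<^esub> V h p"
  shows "x = y"
proof -
  obtain T where T: "left_transversal G (\<theta> p ` carrier G) T" using transversal_exists[OF p] .
  note TG = transversal_subset[OF T] and fin = transversal_finite[OF p T]
  have exp: "z = finsum D (\<lambda>t. (z \<otimes>\<^bsub>D\<^esub> V t p) \<otimes>\<^bsub>D\<^esub> S t p) T" if z: "z \<in> carrier D" for z
  proof -
    have "z = z \<otimes>\<^bsub>D\<^esub> finsum D (\<lambda>t. V t p \<otimes>\<^bsub>D\<^esub> S t p) T"
      using z V_S_sum[OF p T] by simp
    also have "\<dots> = finsum D (\<lambda>t. z \<otimes>\<^bsub>D\<^esub> (V t p \<otimes>\<^bsub>D\<^esub> S t p)) T"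
      by (rule D.finsum_rdistr[OF fin z]) (use TG p in auto)
    also have "\<dots> = finsum D (\<lambda>t. (z \<otimes>\<^bsub>D\<^esub> V t p) \<otimes>\<^bsub>D\<^esub> S t p) T"
      by (rule D.finsum_cong') (use TG p z in \<open>auto simp: D.m_assoc\<close>)
    finally show ?thesis .
  qed
  have "finsum D (\<lambda>t. (x \<otimes>\<^bsub>D\<^esub> V t p) \<otimes>\<^bsub>D\<^esub> S t p) T = finsum D (\<lambda>t. (y \<otimes>\<^bsub>D\<^esub> V t p) \<otimes>\<^bsub>D\<^esub> S t p) T"
    by (rule D.finsum_cong') (use TG p x y eq in auto)
  then show ?thesis using exp[OF x] exp[OF y] by simp
qed

lemma S_one: "S \<one>\<^bsub>G\<^esub> \<one>\<^bsub>P\<^esub> = \<one>\<^bsub>D\<^esub>"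
  using S_V_same[of "\<one>\<^bsub>G\<^esub>" "\<one>\<^bsub>P\<^esub>" "\<one>\<^bsub>G\<^esub>"] by (simp add: \<theta>_one V_one)

text \<open>Both sides are tested against \<open>V\<^sub>m\<^sub>,\<^sub>q\<^sub>p =
  V\<^sub>m\<^sub>,\<^sub>q V\<^sub>1\<^sub>,\<^sub>p\<close>. On the left,
  \<open>S\<^sub>h\<^sub>,\<^sub>q\<close> asks whether \<open>m = h \<theta>\<^sub>q(k)\<close>,
  and then \<open>S\<^sub>g\<^sub>,\<^sub>p\<close> asks whether
  \<open>k = g \<theta>\<^sub>p(l)\<close>. The right side asks both questions at once, with the
  same \<open>l\<close>.\<close>

lemma S_mult:
  assumes g: "g \<in> carrier G" and h: "h \<in> carrier G" and p: "p \<in> carrier P" and q: "q \<in> carrier P"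
  shows "S g p \<otimes>\<^bsub>D\<^esub> S h q = S (h \<otimes>\<^bsub>G\<^esub> \<theta> q g) (q \<otimes>\<^bsub>P\<^esub> p)"
proof (rule cancel_V[of "q \<otimes>\<^bsub>P\<^esub> p"])
  fix m assume m: "m \<in> carrier G"
  have V: "V m (q \<otimes>\<^bsub>P\<^esub> p) = V m q \<otimes>\<^bsub>D\<^esub> V \<one>\<^bsub>G\<^esub> p"
    using V_mult[OF m G.one_closed q p] m q by (simp add: \<theta>_one)
  then have L: "S g p \<otimes>\<^bsub>D\<^esub> S h q \<otimes>\<^bsub>D\<^esub> V m (q \<otimes>\<^bsub>P\<^esub> p) = S g p \<otimes>\<^bsub>D\<^esub> (S h q \<otimes>\<^bsub>D\<^esub> V m q) \<otimes>\<^bsub>D\<^esub> V \<one>\<^bsub>G\<^esub> p"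
    using assms m by (simp add: D.m_assoc)
  have hg: "h \<otimes>\<^bsub>G\<^esub> \<theta> q (g \<otimes>\<^bsub>G\<^esub> \<theta> p l) = h \<otimes>\<^bsub>G\<^esub> \<theta> q g \<otimes>\<^bsub>G\<^esub> \<theta> (q \<otimes>\<^bsub>P\<^esub> p) l" if "l \<in> carrier G" for l
    using assms that by (simp add: \<theta>_mult \<theta>_comp G.m_assoc)
  show "S g p \<otimes>\<^bsub>D\<^esub> S h q \<otimes>\<^bsub>D\<^esub> V m (q \<otimes>\<^bsub>P\<^esub> p) =
      S (h \<otimes>\<^bsub>G\<^esub> \<theta> q g) (q \<otimes>\<^bsub>P\<^esub> p) \<otimes>\<^bsub>D\<^esub> V m (q \<otimes>\<^bsub>P\<^esub> p)"
  proof (cases "in_coset (q \<otimes>\<^bsub>P\<^esub> p) (h \<otimes>\<^bsub>G\<^esub> \<theta> q g) m")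
    case True
    then obtain l where l: "l \<in> carrier G" "m = h \<otimes>\<^bsub>G\<^esub> \<theta> q (g \<otimes>\<^bsub>G\<^esub> \<theta> p l)"
      by (auto simp: in_coset_def hg)
    have "S h q \<otimes>\<^bsub>D\<^esub> V m q = V (g \<otimes>\<^bsub>G\<^esub> \<theta> p l) \<one>\<^bsub>P\<^esub>"
      unfolding l(2) by (rule S_V_same) (use assms l in auto)
    moreover have "V (g \<otimes>\<^bsub>G\<^esub> \<theta> p l) \<one>\<^bsub>P\<^esub> \<otimes>\<^bsub>D\<^esub> V \<one>\<^bsub>G\<^esub> p = V (g \<otimes>\<^bsub>G\<^esub> \<theta> p l) p"
      using V_mult[of "g \<otimes>\<^bsub>G\<^esub> \<theta> p l" "\<one>\<^bsub>G\<^esub>" "\<one>\<^bsub>P\<^esub>" p] assms l by (simp add: \<theta>_one)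
    ultimately have "S g p \<otimes>\<^bsub>D\<^esub> S h q \<otimes>\<^bsub>D\<^esub> V m (q \<otimes>\<^bsub>P\<^esub> p) = V l \<one>\<^bsub>P\<^esub>"
      using L S_V_same[OF g p l(1)] assms l by (simp add: D.m_assoc)
    moreover have "S (h \<otimes>\<^bsub>G\<^esub> \<theta> q g) (q \<otimes>\<^bsub>P\<^esub> p) \<otimes>\<^bsub>D\<^esub> V m (q \<otimes>\<^bsub>P\<^esub> p) = V l \<one>\<^bsub>P\<^esub>"
      unfolding l(2) hg[OF l(1)] by (rule S_V_same) (use assms l in auto)
    ultimately show ?thesis by simp
  next
    case False
    \<comment> \<open>There are two ways to leave the composed coset: \<open>m\<close> misses the
      coset of \<open>h\<close> for \<open>q\<close>, or \<open>m\<close> lies in it but the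
      resulting \<open>k\<close> misses the coset of \<open>g\<close> for \<open>p\<close>.\<close>
    have "S g p \<otimes>\<^bsub>D\<^esub> (S h q \<otimes>\<^bsub>D\<^esub> V m q) \<otimes>\<^bsub>D\<^esub> V \<one>\<^bsub>G\<^esub> p = \<zero>\<^bsub>D\<^esub>"
    proof (cases "in_coset q h m")
      case True
      then obtain k where k: "k \<in> carrier G" "m = h \<otimes>\<^bsub>G\<^esub> \<theta> q k" by (auto simp: in_coset_def)
      have "\<not> in_coset p g k"
        using False hg k by (auto simp: in_coset_def)
      then have "S g p \<otimes>\<^bsub>D\<^esub> V k p = \<zero>\<^bsub>D\<^esub>" by (intro S_V_other g k p)
      moreover have "V k \<one>\<^bsub>P\<^esub> \<otimes>\<^bsub>D\<^esub> V \<one>\<^bsub>G\<^esub> p = V k p"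
        using V_mult[of k "\<one>\<^bsub>G\<^esub>" "\<one>\<^bsub>P\<^esub>" p] p k by (simp add: \<theta>_one)
      ultimately show ?thesis
        using S_V_same[OF h q k(1)] k assms by (simp add: D.m_assoc)
    next
      case False
      then show ?thesis using S_V_other[OF h m q] assms by simp
    qed
    then show ?thesis
      using L S_V_other[OF _ m _ False] assms by simp
  qed
qed (use assms in simp_all)

section \<open>The covariant representation given by a system\<close>

definition rep :: "'p \<Rightarrow> ('g \<Rightarrow> 'r) \<Rightarrow> 'd" where
  "rep p = lin_ext R D (\<lambda>g r. \<rho> r \<otimes>\<^bsub>D\<^esub> V g p)"

lemma \<rho>_mult_hom: "d \<in> carrier D \<Longrightarrow> (\<lambda>r. \<rho> r \<otimes>\<^bsub>D\<^esub> d) \<in> hom (add_monoid R) (add_monoid D)"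
  by (auto simp: hom_def ring_hom_add[OF \<rho>_hom] D.l_distr)

lemma
  assumes p: "p \<in> carrier P"
  shows rep_closed: "x \<in> FG \<Longrightarrow> rep p x \<in> carrier D"
    and rep_add: "\<lbrakk>x \<in> FG; y \<in> FG\<rbrakk> \<Longrightarrow> rep p (\<lambda>g. x g \<oplus>\<^bsub>R\<^esub> y g) = rep p x \<oplus>\<^bsub>D\<^esub> rep p y"
    and rep_monomial: "\<lbrakk>g \<in> carrier G; r \<in> carrier R\<rbrakk> \<Longrightarrow> rep p (monomial R g r) = \<rho> r \<otimes>\<^bsub>D\<^esub> V g p"
    and rep_zero: "rep p (\<lambda>_. \<zero>\<^bsub>R\<^esub>) = \<zero>\<^bsub>D\<^esub>"
  unfolding rep_def
  using R.lin_ext_hom[OF D.is_abelian_group, of "carrier G" "\<lambda>g r. \<rho> r \<otimes>\<^bsub>D\<^esub> V g p"] \<rho>_mult_hom p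
  by simp_all

text \<open>On monomials, the scalar \<rho>(s) has to be moved past \<open>V g p\<close>. After that
  the claim is the product rule for \<open>V\<close>.\<close>

lemma rep_mult:
  assumes p: "p \<in> carrier P" and q: "q \<in> carrier P" and x: "x \<in> FG" and y: "y \<in> FG"
  shows "rep p x \<otimes>\<^bsub>D\<^esub> rep q y = rep (p \<otimes>\<^bsub>P\<^esub> q) (pair p x y)"
proof (rule R.biadditive_eq[where f = "\<lambda>x y. rep p x \<otimes>\<^bsub>D\<^esub> rep q y"
      and g = "\<lambda>x y. rep (p \<otimes>\<^bsub>P\<^esub> q) (pair p x y)" and h = "(\<oplus>\<^bsub>D\<^esub>)", OF _ _ _ _ _ _ _ x y])
  fix g r h s assume *: "g \<in> carrier G" "r \<in> carrier R" "h \<in> carrier G" "s \<in> carrier R"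
  have "rep p (monomial R g r) \<otimes>\<^bsub>D\<^esub> rep q (monomial R h s) = \<rho> r \<otimes>\<^bsub>D\<^esub> (V g p \<otimes>\<^bsub>D\<^esub> \<rho> s) \<otimes>\<^bsub>D\<^esub> V h q"
    using * p q by (simp add: rep_monomial D.m_assoc)
  also have "\<dots> = \<rho> r \<otimes>\<^bsub>D\<^esub> \<rho> s \<otimes>\<^bsub>D\<^esub> (V g p \<otimes>\<^bsub>D\<^esub> V h q)"
    using * p q by (simp add: \<rho>_V D.m_assoc)
  also have "\<dots> = rep (p \<otimes>\<^bsub>P\<^esub> q) (pair p (monomial R g r) (monomial R h s))"
    using * p q by (simp add: R.conv_monomial rep_monomial V_mult ring_hom_mult[OF \<rho>_hom])
  finally show "rep p (monomial R g r) \<otimes>\<^bsub>D\<^esub> rep q (monomial R h s) =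
      rep (p \<otimes>\<^bsub>P\<^esub> q) (pair p (monomial R g r) (monomial R h s))" .
next
  fix a a' b assume "a \<in> FG" "a' \<in> FG" "b \<in> FG"
  then show "rep (p \<otimes>\<^bsub>P\<^esub> q) (pair p (\<lambda>x. a x \<oplus>\<^bsub>R\<^esub> a' x) b) =
      rep (p \<otimes>\<^bsub>P\<^esub> q) (pair p a b) \<oplus>\<^bsub>D\<^esub> rep (p \<otimes>\<^bsub>P\<^esub> q) (pair p a' b)"
    using p q by (subst R.conv_add_left) (auto simp: rep_add pair_closed)
next
  fix a b b' assume "a \<in> FG" "b \<in> FG" "b' \<in> FG"
  then show "rep (p \<otimes>\<^bsub>P\<^esub> q) (pair p a (\<lambda>x. b x \<oplus>\<^bsub>R\<^esub> b' x)) =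
      rep (p \<otimes>\<^bsub>P\<^esub> q) (pair p a b) \<oplus>\<^bsub>D\<^esub> rep (p \<otimes>\<^bsub>P\<^esub> q) (pair p a b')"
    using p q by (subst R.conv_add_right) (auto simp: rep_add pair_closed)
qed (use p q in \<open>auto simp: rep_add rep_closed rep_zero D.l_distr D.r_distr
    R.conv_zero_left R.conv_zero_right\<close>)

text \<open>The inverse of \<open>x \<otimes> d \<mapsto> \<nu>\<^sub>p(x) d\<close> is \<open>d \<mapsto> \<Sum>\<^sub>t 1\<^sub>t \<otimes> \<delta>\<^sup>*\<^sub>t\<^sub>,\<^sub>p d\<close>.\<close>

lemma rep_tensor_iso:
  assumes p: "p \<in> carrier P"
    and ls: "\<And>s d. \<lbrakk>s \<in> FG; d \<in> carrier D\<rbrakk> \<Longrightarrow> ls s d = rep \<one>\<^bsub>P\<^esub> s \<otimes>\<^bsub>D\<^esub> d"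
  shows "\<exists>\<phi>\<in>iso (tensor_product (base_ring diagram) (fibre diagram p) (pair p) D ls) (add_monoid D).
    \<forall>x\<in>FG. \<forall>d\<in>carrier D.
      \<phi> (elem_tensor (base_ring diagram) (fibre diagram p) (pair p) D ls x d) = rep p x \<otimes>\<^bsub>D\<^esub> d"
proof -
  interpret M: abelian_group "fibre diagram p" by (rule fibre_abelian_group)
  interpret X: tensor_factors "base_ring diagram" "fibre diagram p" "pair p" D ls
    by unfold_locales (auto simp: diagram_simps pair_closed p ls rep_closed)
  interpret T: comm_group X.T by (rule X.tensor_comm_group)
  obtain \<phi> where \<phi>: "\<phi> \<in> hom X.T (add_monoid D)"
    and \<phi>_elem: "\<And>x d. \<lbrakk>x \<in> FG; d \<in> carrier D\<rbrakk> \<Longrightarrow> \<phi> (X.elem x d) = rep p x \<otimes>\<^bsub>D\<^esub> d"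
  proof (rule X.tensor_universal[OF D.a_comm_group, where b = "\<lambda>x d. rep p x \<otimes>\<^bsub>D\<^esub> d"])
    fix x s d assume "x \<in> carrier (fibre diagram p)" "s \<in> carrier (base_ring diagram)" "d \<in> carrier D"
    then show "rep p (pair p x s) \<otimes>\<^bsub>D\<^esub> d = rep p x \<otimes>\<^bsub>D\<^esub> ls s d"
      using rep_mult[OF p P.one_closed, of x s] p
      by (simp add: diagram_simps ls rep_closed flip: D.m_assoc)
  qed (auto simp: diagram_simps p rep_closed rep_add D.l_distr D.r_distr)
  obtain A where A: "left_transversal G (\<theta> p ` carrier G) A" using transversal_exists[OF p] .
  note AG = transversal_subset[OF A] and fin = transversal_finite[OF p A]
  define e where "e t = monomial R t \<one>\<^bsub>R\<^esub>" for t :: 'g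
  have e: "e t \<in> FG" if "t \<in> A" for t
    using AG that by (auto simp: e_def intro: R.fin_supp_monomial)
  define \<psi> where "\<psi> d = finprod X.T (\<lambda>t. X.elem (e t) (S t p \<otimes>\<^bsub>D\<^esub> d)) A" for d
  have term_closed: "X.elem (e t) (S t p \<otimes>\<^bsub>D\<^esub> d) \<in> carrier X.T" if "t \<in> A" "d \<in> carrier D" for t d
    by (rule X.elem_closed) (use that AG e p in \<open>auto simp: diagram_simps\<close>)
  have \<psi>_closed: "\<psi> d \<in> carrier X.T" if "d \<in> carrier D" for d
    unfolding \<psi>_def by (rule T.finprod_closed) (use that term_closed in auto)
  have \<psi>_add: "\<psi> (c \<oplus>\<^bsub>D\<^esub> d) = \<psi> c \<otimes>\<^bsub>X.T\<^esub> \<psi> d" if cd: "c \<in> carrier D" "d \<in> carrier D" for c d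
  proof -
    have "\<psi> (c \<oplus>\<^bsub>D\<^esub> d) =
        finprod X.T (\<lambda>t. X.elem (e t) (S t p \<otimes>\<^bsub>D\<^esub> c) \<otimes>\<^bsub>X.T\<^esub> X.elem (e t) (S t p \<otimes>\<^bsub>D\<^esub> d)) A"
      unfolding \<psi>_def
    proof (rule T.finprod_cong')
      fix t assume "t \<in> A"
      then show "X.elem (e t) (S t p \<otimes>\<^bsub>D\<^esub> (c \<oplus>\<^bsub>D\<^esub> d)) =
          X.elem (e t) (S t p \<otimes>\<^bsub>D\<^esub> c) \<otimes>\<^bsub>X.T\<^esub> X.elem (e t) (S t p \<otimes>\<^bsub>D\<^esub> d)"
        using cd AG e p by (subst X.elem_add_right[symmetric]) (auto simp: diagram_simps D.r_distr)
    qed (use cd term_closed in auto)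
    also have "\<dots> = \<psi> c \<otimes>\<^bsub>X.T\<^esub> \<psi> d"
      unfolding \<psi>_def by (rule T.finprod_multf) (use cd term_closed in auto)
    finally show ?thesis .
  qed
  have \<psi>_hom: "\<psi> \<in> hom (add_monoid D) X.T"
    by (auto simp: hom_def \<psi>_closed \<psi>_add)
  have \<psi>_monomial: "\<psi> (rep p (monomial R h r) \<otimes>\<^bsub>D\<^esub> d) = X.elem (monomial R h r) d"
    if h: "h \<in> carrier G" and r: "r \<in> carrier R" and d: "d \<in> carrier D" for h r d
  proof -
    obtain t k where t: "t \<in> A" and k: "k \<in> carrier G" and tk: "t \<otimes>\<^bsub>G\<^esub> \<theta> p k = h"
      and uniq: "\<And>t'. t' \<in> A \<Longrightarrow> in_coset p t' h \<longleftrightarrow> t' = t"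
      using transversal_unique[OF p A h] by blast
    have tG: "t \<in> carrier G" using t AG by auto
    have S_rep: "S t' p \<otimes>\<^bsub>D\<^esub> (rep p (monomial R h r) \<otimes>\<^bsub>D\<^esub> d) = \<rho> r \<otimes>\<^bsub>D\<^esub> (S t' p \<otimes>\<^bsub>D\<^esub> V h p) \<otimes>\<^bsub>D\<^esub> d"
      if "t' \<in> A" for t'
    proof -
      have t': "t' \<in> carrier G" using that AG by auto
      have "S t' p \<otimes>\<^bsub>D\<^esub> (rep p (monomial R h r) \<otimes>\<^bsub>D\<^esub> d) = (S t' p \<otimes>\<^bsub>D\<^esub> \<rho> r) \<otimes>\<^bsub>D\<^esub> V h p \<otimes>\<^bsub>D\<^esub> d"
        using t' h r d p by (simp add: rep_monomial D.m_assoc)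
      also have "\<dots> = \<rho> r \<otimes>\<^bsub>D\<^esub> (S t' p \<otimes>\<^bsub>D\<^esub> V h p) \<otimes>\<^bsub>D\<^esub> d"
        using t' h r d p by (simp add: \<rho>_S D.m_assoc)
      finally show ?thesis .
    qed
    \<comment> \<open>Only the representative \<open>t\<close> of the coset of \<open>h\<close>
      contributes. For it, the factor \<open>\<nu>\<^sub>1(r 1\<^sub>k)\<close> moves across the
      tensor sign, and 1_t acted on by r 1_k from the right is r 1_h.\<close>
    have "X.elem (e t') (S t' p \<otimes>\<^bsub>D\<^esub> (rep p (monomial R h r) \<otimes>\<^bsub>D\<^esub> d)) =
        (if t = t' then X.elem (monomial R h r) d else \<one>\<^bsub>X.T\<^esub>)" if "t' \<in> A" for t'
    proof (cases "t = t'")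
      case True
      have "X.elem (e t) (S t p \<otimes>\<^bsub>D\<^esub> (rep p (monomial R h r) \<otimes>\<^bsub>D\<^esub> d)) = X.elem (e t) (ls (monomial R k r) d)"
        using S_rep[OF t] S_V_same[OF tG p k] k r d by (simp add: tk ls R.fin_supp_monomial rep_monomial)
      also have "\<dots> = X.elem (pair p (e t) (monomial R k r)) d"
        by (rule X.elem_balanced[symmetric]) (use e t k r d in \<open>auto simp: diagram_simps R.fin_supp_monomial\<close>)
      also have "pair p (e t) (monomial R k r) = monomial R h r"
        using r by (simp add: e_def R.conv_monomial tk)
      finally show ?thesis using True by simp
    next
      case False
      then have "S t' p \<otimes>\<^bsub>D\<^esub> V h p = \<zero>\<^bsub>D\<^esub>"
        using S_V_other[of t' h p] uniq that h p AG by auto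
      then show ?thesis
        using S_rep[OF that] False r d e[OF that] by (simp add: X.elem_zero_right diagram_simps)
    qed
    moreover have "X.elem (monomial R h r) d \<in> carrier X.T"
      by (rule X.elem_closed) (use h r d in \<open>auto simp: diagram_simps R.fin_supp_monomial\<close>)
    ultimately have "\<psi> (rep p (monomial R h r) \<otimes>\<^bsub>D\<^esub> d) =
        finprod X.T (\<lambda>t'. if t = t' then X.elem (monomial R h r) d else \<one>\<^bsub>X.T\<^esub>) A"
      unfolding \<psi>_def by (intro T.finprod_cong') auto
    also have "\<dots> = X.elem (monomial R h r) d"
      using T.finprod_singleton[OF t fin, of "\<lambda>_. X.elem (monomial R h r) d"]
        \<open>X.elem (monomial R h r) d \<in> carrier X.T\<close> by simp
    finally show ?thesis .
  qed
  have \<psi>_elem: "\<psi> (rep p x \<otimes>\<^bsub>D\<^esub> d) = X.elem x d" if x: "x \<in> FG" and d: "d \<in> carrier D" for x d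
  proof (rule R.fin_supp_hom_eq[where f = "\<lambda>x. \<psi> (rep p x \<otimes>\<^bsub>D\<^esub> d)" and g = "\<lambda>x. X.elem x d"
        and h = "(\<otimes>\<^bsub>X.T\<^esub>)", OF _ _ _ _ x])
    fix a b assume "a \<in> FG" "b \<in> FG"
    then show "\<psi> (rep p (\<lambda>x. a x \<oplus>\<^bsub>R\<^esub> b x) \<otimes>\<^bsub>D\<^esub> d) = \<psi> (rep p a \<otimes>\<^bsub>D\<^esub> d) \<otimes>\<^bsub>X.T\<^esub> \<psi> (rep p b \<otimes>\<^bsub>D\<^esub> d)"
      using p d by (simp add: rep_add rep_closed D.l_distr \<psi>_add)
    show "X.elem (\<lambda>x. a x \<oplus>\<^bsub>R\<^esub> b x) d = X.elem a d \<otimes>\<^bsub>X.T\<^esub> X.elem b d"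
      using X.elem_add_left[of a b d] \<open>a \<in> FG\<close> \<open>b \<in> FG\<close> d by (simp add: diagram_simps)
  next
    show "\<psi> (rep p (\<lambda>_. \<zero>\<^bsub>R\<^esub>) \<otimes>\<^bsub>D\<^esub> d) = X.elem (\<lambda>_. \<zero>\<^bsub>R\<^esub>) d"
      using \<psi>_monomial[OF G.one_closed R.zero_closed d] by (simp add: R.monomial_zero)
  qed (rule \<psi>_monomial[OF _ _ d])
  have "(\<psi> \<circ> \<phi>) \<tau> = id \<tau>" if "\<tau> \<in> carrier X.T" for \<tau>
  proof (rule X.tensor_hom_eq[OF X.tensor_group _ _ _ that])
    show "\<psi> \<circ> \<phi> \<in> hom X.T X.T" by (rule Group.hom_compose[OF \<phi> \<psi>_hom])
    show "id \<in> hom X.T X.T" by (auto simp: hom_def)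
  qed (auto simp: diagram_simps \<phi>_elem \<psi>_elem)
  \<comment> \<open>The first composite rested on relation (2); this one is relation (3) multiplied
    by \<open>d\<close>.\<close>
  moreover have "\<phi> (\<psi> d) = d" if d: "d \<in> carrier D" for d
  proof -
    have "\<phi> (\<psi> d) = finprod (add_monoid D) (\<lambda>t. \<phi> (X.elem (e t) (S t p \<otimes>\<^bsub>D\<^esub> d))) A"
      unfolding \<psi>_def by (rule hom_finprod[OF T.comm_group_axioms D.a_comm_group \<phi>])
        (use term_closed d in auto)
    also have "\<dots> = finsum D (\<lambda>t. (V t p \<otimes>\<^bsub>D\<^esub> S t p) \<otimes>\<^bsub>D\<^esub> d) A"
      unfolding finsum_def[symmetric]
    proof (rule D.finsum_cong')
      fix t assume "t \<in> A"
      then have "t \<in> carrier G" using AG by auto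
      then show "\<phi> (X.elem (e t) (S t p \<otimes>\<^bsub>D\<^esub> d)) = (V t p \<otimes>\<^bsub>D\<^esub> S t p) \<otimes>\<^bsub>D\<^esub> d"
        using p d e[OF \<open>t \<in> A\<close>]
        by (simp add: \<phi>_elem e_def rep_monomial ring_hom_one[OF \<rho>_hom] D.m_assoc)
    qed (use AG p d in auto)
    also have "\<dots> = finsum D (\<lambda>t. V t p \<otimes>\<^bsub>D\<^esub> S t p) A \<otimes>\<^bsub>D\<^esub> d"
      by (rule D.finsum_ldistr[symmetric, OF fin d]) (use AG p in auto)
    also have "\<dots> = d" using V_S_sum[OF p A] d by simp
    finally show ?thesis .
  qed
  ultimately have "bij_betw \<phi> (carrier X.T) (carrier D)"
    using \<psi>_closed hom_in_carrier[OF \<phi>] by (intro bij_betw_byWitness[where f' = \<psi>]) auto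
  then have "\<phi> \<in> iso X.T (add_monoid D)" using \<phi> by (simp add: iso_def)
  then show ?thesis using \<phi>_elem by blast
qed

lemma rep_covariant: "(\<lambda>p\<in>carrier P. \<lambda>x\<in>FG. rep p x) \<in> covariant_reps diagram D"
proof -
  let ?\<nu> = "\<lambda>p\<in>carrier P. \<lambda>x\<in>FG. rep p x"
  \<comment> \<open>The action through the restricted maps agrees with the one through
    \<open>rep\<close> on the carriers, which is all that \<open>rep_tensor_iso\<close> asks of
    \<open>ls\<close>.\<close>
  have iso: "\<exists>\<phi>\<in>iso (tensor_product (base_ring diagram) (fibre diagram p) (pair p) D
        (\<lambda>s d. ?\<nu> \<one>\<^bsub>P\<^esub> s \<otimes>\<^bsub>D\<^esub> d)) (add_monoid D). \<forall>x\<in>FG. \<forall>d\<in>carrier D.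
      \<phi> (elem_tensor (base_ring diagram) (fibre diagram p) (pair p) D (\<lambda>s d. ?\<nu> \<one>\<^bsub>P\<^esub> s \<otimes>\<^bsub>D\<^esub> d) x d)
        = ?\<nu> p x \<otimes>\<^bsub>D\<^esub> d"
    if "p \<in> carrier P" for p
    using rep_tensor_iso[OF that, of "\<lambda>s d. ?\<nu> \<one>\<^bsub>P\<^esub> s \<otimes>\<^bsub>D\<^esub> d"] that by simp
  have "?\<nu> \<in> (\<Pi>\<^sub>E p\<in>carrier P. hom (add_monoid (fibre diagram p)) (add_monoid D) \<inter> extensional FG)"
    by (auto simp: hom_def diagram_simps rep_closed rep_add R.fin_supp_add)
  then show ?thesis
    unfolding covariant_reps_def Let_def diagram_simps
    using iso rep_mult pair_closed by auto
qed

end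

section \<open>Covariant representations\<close>

context endo_action
begin

text \<open>The coordinate of \<open>x\<close> at 1_g in the right \<open>F\<^sub>1\<close>-module
  \<open>F\<^sub>p\<close>: restrict \<open>x\<close> to the coset of \<open>g\<close> and carry it
  back to the group along \<open>k \<mapsto> g \<theta>\<^sub>p(k)\<close>.\<close>

definition coset_coeff :: "'p \<Rightarrow> 'g \<Rightarrow> ('g \<Rightarrow> 'r) \<Rightarrow> 'g \<Rightarrow> 'r" where
  "coset_coeff p g x = (\<lambda>k. if k \<in> carrier G then x (g \<otimes>\<^bsub>G\<^esub> \<theta> p k) else \<zero>\<^bsub>R\<^esub>)"

text \<open>The support stays finite because \<open>k \<mapsto> g \<theta>\<^sub>p(k)\<close> is
  injective.\<close>

lemma coset_coeff_closed:
  assumes p: "p \<in> carrier P" and g: "g \<in> carrier G" and x: "x \<in> FG"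
  shows "coset_coeff p g x \<in> FG"
proof -
  let ?K = "{k. coset_coeff p g x k \<noteq> \<zero>\<^bsub>R\<^esub>}"
  have "inj_on (\<lambda>k. g \<otimes>\<^bsub>G\<^esub> \<theta> p k) ?K"
    by (rule inj_onI) (auto simp: coset_coeff_def split: if_splits intro: \<theta>_unique[OF p g])
  moreover have "(\<lambda>k. g \<otimes>\<^bsub>G\<^esub> \<theta> p k) ` ?K \<subseteq> {h. x h \<noteq> \<zero>\<^bsub>R\<^esub>}"
    by (auto simp: coset_coeff_def split: if_splits)
  ultimately have "finite ?K"
    using R.fin_supp_finite[OF x] finite_imageD finite_subset by blast
  then show ?thesis
    using R.fin_supp_value[OF x] by (auto simp: fin_supp_def coset_coeff_def)
qed

lemma coset_coeff_add:
  "coset_coeff p g (\<lambda>h. x h \<oplus>\<^bsub>R\<^esub> y h) = (\<lambda>h. coset_coeff p g x h \<oplus>\<^bsub>R\<^esub> coset_coeff p g y h)"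
  by (auto simp: coset_coeff_def)

lemma coset_coeff_zero: "coset_coeff p g (\<lambda>_. \<zero>\<^bsub>R\<^esub>) = (\<lambda>_. \<zero>\<^bsub>R\<^esub>)"
  by (auto simp: coset_coeff_def)

lemma coset_coeff_monomial:
  assumes "p \<in> carrier P" "g \<in> carrier G" "k \<in> carrier G"
  shows "coset_coeff p g (monomial R (g \<otimes>\<^bsub>G\<^esub> \<theta> p k) r) = monomial R k r"
  using assms \<theta>_unique[OF assms(1,2) _ assms(3)] by (auto simp: coset_coeff_def monomial_def)

lemma coset_coeff_monomial_other:
  "\<not> in_coset p g h \<Longrightarrow> coset_coeff p g (monomial R h r) = (\<lambda>_. \<zero>\<^bsub>R\<^esub>)"
  by (auto simp: coset_coeff_def monomial_def in_coset_def)

text \<open>This is right \<open>F\<^sub>1\<close>-linearity, needed to define a map on the tensor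
  product. It holds because \<open>h \<theta>\<^sub>p(l)\<close> lies in the coset of
  \<open>g\<close> exactly if \<open>h\<close> does. For the unit of \<open>P\<close>,
  \<open>pair\<close> is convolution in the group ring.\<close>

lemma coset_coeff_pair:
  assumes p: "p \<in> carrier P" and g: "g \<in> carrier G" and x: "x \<in> FG" and s: "s \<in> FG"
  shows "coset_coeff p g (pair p x s) = pair \<one>\<^bsub>P\<^esub> (coset_coeff p g x) s"
proof (rule R.biadditive_eq[where f = "\<lambda>x s. coset_coeff p g (pair p x s)"
      and g = "\<lambda>x s. pair \<one>\<^bsub>P\<^esub> (coset_coeff p g x) s" and h = "\<lambda>a b h. a h \<oplus>\<^bsub>R\<^esub> b h",
      OF _ _ _ _ _ _ _ x s])
  fix h r l t assume *: "h \<in> carrier G" "r \<in> carrier R" "l \<in> carrier G" "t \<in> carrier R"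
  show "coset_coeff p g (pair p (monomial R h r) (monomial R l t)) =
      pair \<one>\<^bsub>P\<^esub> (coset_coeff p g (monomial R h r)) (monomial R l t)"
  proof (cases "in_coset p g h")
    case True
    then obtain k where k: "k \<in> carrier G" "h = g \<otimes>\<^bsub>G\<^esub> \<theta> p k" by (auto simp: in_coset_def)
    have "h \<otimes>\<^bsub>G\<^esub> \<theta> p l = g \<otimes>\<^bsub>G\<^esub> \<theta> p (k \<otimes>\<^bsub>G\<^esub> l)"
      using p g k * by (simp add: \<theta>_mult G.m_assoc)
    then have "coset_coeff p g (pair p (monomial R h r) (monomial R l t)) =
        monomial R (k \<otimes>\<^bsub>G\<^esub> l) (r \<otimes>\<^bsub>R\<^esub> t)"
      using p g k * coset_coeff_monomial[OF p g, of "k \<otimes>\<^bsub>G\<^esub> l"] by (simp add: R.conv_monomial)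
    then show ?thesis
      using p g k * by (simp add: coset_coeff_monomial R.conv_monomial \<theta>_id)
  next
    case False
    have "\<not> in_coset p g (h \<otimes>\<^bsub>G\<^esub> \<theta> p l)"
    proof
      assume "in_coset p g (h \<otimes>\<^bsub>G\<^esub> \<theta> p l)"
      moreover have "in_coset p h (h \<otimes>\<^bsub>G\<^esub> \<theta> p l)" using * by (auto simp: in_coset_def)
      ultimately show False
        using False p g * by (simp flip: lcoset_eq_iff)
    qed
    then show ?thesis
      using False * by (simp add: R.conv_monomial coset_coeff_monomial_other R.conv_zero_left)
  qed
qed (use coset_coeff_closed[OF p g] in \<open>simp_all add: R.conv_add_left[where X = "carrier G" and Y = "carrier G"]
    R.conv_add_right[where X = "carrier G" and Y = "carrier G"]
    coset_coeff_add coset_coeff_zero R.conv_zero_left R.conv_zero_right\<close>)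

end

locale unital_covariant_rep = endo_action R P G \<theta> + D: ring D
  for R :: "'r ring" and P :: "'p monoid" and G :: "'g monoid" and \<theta> :: "'p \<Rightarrow> 'g \<Rightarrow> 'g"
    and D :: "'d ring" +
  fixes \<nu> :: "'p \<Rightarrow> ('g \<Rightarrow> 'r) \<Rightarrow> 'd"
  assumes \<nu>: "\<nu> \<in> covariant_reps diagram D"
    and \<nu>_one: "\<nu> \<one>\<^bsub>P\<^esub> (single R \<one>\<^bsub>G\<^esub>) = \<one>\<^bsub>D\<^esub>"
begin

text \<open>The ring \<open>R\<close> sits in the group ring as the functions supported at the
  identity. Their images give \<open>D\<close> its scalars and will serve as \<rho>.\<close>

definition \<nu>_coeff :: "'r \<Rightarrow> 'd" where
  "\<nu>_coeff r = \<nu> \<one>\<^bsub>P\<^esub> (monomial R \<one>\<^bsub>G\<^esub> r)"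

definition \<nu>_gen :: "'g \<Rightarrow> 'p \<Rightarrow> 'd" where
  "\<nu>_gen g p = \<nu> p (single R g)"

lemma \<nu>_closed: "\<lbrakk>p \<in> carrier P; x \<in> FG\<rbrakk> \<Longrightarrow> \<nu> p x \<in> carrier D"
  and \<nu>_add: "\<lbrakk>p \<in> carrier P; x \<in> FG; y \<in> FG\<rbrakk> \<Longrightarrow> \<nu> p (\<lambda>g. x g \<oplus>\<^bsub>R\<^esub> y g) = \<nu> p x \<oplus>\<^bsub>D\<^esub> \<nu> p y"
  and \<nu>_mult: "\<lbrakk>p \<in> carrier P; q \<in> carrier P; x \<in> FG; y \<in> FG\<rbrakk> \<Longrightarrow>
    \<nu> p x \<otimes>\<^bsub>D\<^esub> \<nu> q y = \<nu> (p \<otimes>\<^bsub>P\<^esub> q) (pair p x y)"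
proof -
  show "\<nu> p x \<otimes>\<^bsub>D\<^esub> \<nu> q y = \<nu> (p \<otimes>\<^bsub>P\<^esub> q) (pair p x y)"
    if "p \<in> carrier P" "q \<in> carrier P" "x \<in> FG" "y \<in> FG"
    using \<nu> that unfolding covariant_reps_def diagram_simps by simp
  have hom: "\<nu> p \<in> hom (add_monoid (fibre diagram p)) (add_monoid D)" if "p \<in> carrier P"
    using \<nu> that unfolding covariant_reps_def diagram_simps by (auto simp: PiE_iff)
  show "\<nu> p x \<in> carrier D" if "p \<in> carrier P" "x \<in> FG"
    using hom_in_carrier[OF hom] that by (simp add: diagram_simps)
  show "\<nu> p (\<lambda>g. x g \<oplus>\<^bsub>R\<^esub> y g) = \<nu> p x \<oplus>\<^bsub>D\<^esub> \<nu> p y" if "p \<in> carrier P" "x \<in> FG" "y \<in> FG"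
    using hom_mult[OF hom] that by (simp add: diagram_simps)
qed

lemma \<nu>_zero: "p \<in> carrier P \<Longrightarrow> \<nu> p (\<lambda>_. \<zero>\<^bsub>R\<^esub>) = \<zero>\<^bsub>D\<^esub>"
  using \<nu>_add[of p "\<lambda>_. \<zero>\<^bsub>R\<^esub>" "\<lambda>_. \<zero>\<^bsub>R\<^esub>"] \<nu>_closed[of p "\<lambda>_. \<zero>\<^bsub>R\<^esub>"]
    D.add.r_cancel_one[of "\<nu> p (\<lambda>_. \<zero>\<^bsub>R\<^esub>)" "\<nu> p (\<lambda>_. \<zero>\<^bsub>R\<^esub>)"]
  by (simp add: R.fin_supp_zero)

lemma \<nu>_coeff_closed: "r \<in> carrier R \<Longrightarrow> \<nu>_coeff r \<in> carrier D"
  by (simp add: \<nu>_coeff_def \<nu>_closed R.fin_supp_monomial)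

lemma \<nu>_gen_closed: "\<lbrakk>g \<in> carrier G; p \<in> carrier P\<rbrakk> \<Longrightarrow> \<nu>_gen g p \<in> carrier D"
  by (simp add: \<nu>_gen_def single_eq_monomial \<nu>_closed R.fin_supp_monomial)

lemma \<nu>_monomial:
  "\<lbrakk>p \<in> carrier P; g \<in> carrier G; r \<in> carrier R\<rbrakk> \<Longrightarrow> \<nu> p (monomial R g r) = \<nu>_coeff r \<otimes>\<^bsub>D\<^esub> \<nu>_gen g p"
  by (simp add: \<nu>_coeff_def \<nu>_gen_def single_eq_monomial \<nu>_mult R.fin_supp_monomial R.conv_monomial \<theta>_id)

text \<open>Multiplying 1_g by r 1_1 from either side gives r 1_g, because \<open>\<theta> p\<close>
  fixes the identity of the group.\<close>

lemma \<nu>_gen_coeff: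
  "\<lbrakk>p \<in> carrier P; g \<in> carrier G; r \<in> carrier R\<rbrakk> \<Longrightarrow> \<nu>_gen g p \<otimes>\<^bsub>D\<^esub> \<nu>_coeff r = \<nu>_coeff r \<otimes>\<^bsub>D\<^esub> \<nu>_gen g p"
  by (simp add: \<nu>_coeff_def \<nu>_gen_def single_eq_monomial \<nu>_mult R.fin_supp_monomial R.conv_monomial
      \<theta>_id \<theta>_one)

lemma \<nu>_gen_mult:
  "\<lbrakk>g \<in> carrier G; h \<in> carrier G; p \<in> carrier P; q \<in> carrier P\<rbrakk> \<Longrightarrow>
    \<nu>_gen g p \<otimes>\<^bsub>D\<^esub> \<nu>_gen h q = \<nu>_gen (g \<otimes>\<^bsub>G\<^esub> \<theta> p h) (p \<otimes>\<^bsub>P\<^esub> q)"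
  by (simp add: \<nu>_gen_def single_eq_monomial \<nu>_mult R.fin_supp_monomial R.conv_monomial)

lemma \<nu>_gen_one: "\<nu>_gen \<one>\<^bsub>G\<^esub> \<one>\<^bsub>P\<^esub> = \<one>\<^bsub>D\<^esub>"
  by (simp add: \<nu>_gen_def \<nu>_one)

lemma \<nu>_coeff_hom: "\<nu>_coeff \<in> ring_hom R D"
proof (rule ring_hom_memI)
  fix r s assume "r \<in> carrier R" "s \<in> carrier R"
  then show "\<nu>_coeff (r \<otimes>\<^bsub>R\<^esub> s) = \<nu>_coeff r \<otimes>\<^bsub>D\<^esub> \<nu>_coeff s"
    and "\<nu>_coeff (r \<oplus>\<^bsub>R\<^esub> s) = \<nu>_coeff r \<oplus>\<^bsub>D\<^esub> \<nu>_coeff s"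
    by (simp_all add: \<nu>_coeff_def \<nu>_mult R.fin_supp_monomial R.conv_monomial \<theta>_id R.monomial_add \<nu>_add)
next
  show "\<nu>_coeff \<one>\<^bsub>R\<^esub> = \<one>\<^bsub>D\<^esub>" using \<nu>_one by (simp add: \<nu>_coeff_def single_eq_monomial)
qed (rule \<nu>_coeff_closed)

context
  fixes p assumes p: "p \<in> carrier P"
begin

abbreviation ls :: "('g \<Rightarrow> 'r) \<Rightarrow> 'd \<Rightarrow> 'd" where "ls \<equiv> \<lambda>s d. \<nu> \<one>\<^bsub>P\<^esub> s \<otimes>\<^bsub>D\<^esub> d"

lemma \<nu>_tensor_factors: "tensor_factors (base_ring diagram) (fibre diagram p) (pair p) D ls"
proof -
  interpret M: abelian_group "fibre diagram p" by (rule fibre_abelian_group)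
  show ?thesis
    by unfold_locales (auto simp: diagram_simps pair_closed p \<nu>_closed)
qed

interpretation X: tensor_factors "base_ring diagram" "fibre diagram p" "pair p" D ls
  by (rule \<nu>_tensor_factors)

lemma \<nu>_tensor_iso:
  obtains \<phi> where "\<phi> \<in> iso X.T (add_monoid D)"
    "\<And>x d. \<lbrakk>x \<in> FG; d \<in> carrier D\<rbrakk> \<Longrightarrow> \<phi> (X.elem x d) = \<nu> p x \<otimes>\<^bsub>D\<^esub> d"
  using \<nu> p unfolding covariant_reps_def diagram_simps Let_def by blast

text \<open>The counterpart of \<open>cancel_V\<close> at a stage where no \<open>S\<close> and no
  relation (3) exist. Surjectivity of \<open>F\<^sub>p \<otimes> D \<rightarrow> D\<close> takes
  their place: writing 1 as the image of \<tau>, the products of \<open>x\<close> and of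
  \<open>y\<close> with this image are compared on elementary tensors.\<close>

lemma \<nu>_cancel:
  assumes x: "x \<in> carrier D" and y: "y \<in> carrier D"
    and eq: "\<And>h. h \<in> carrier G \<Longrightarrow> x \<otimes>\<^bsub>D\<^esub> \<nu>_gen h p = y \<otimes>\<^bsub>D\<^esub> \<nu>_gen h p"
  shows "x = y"
proof -
  obtain \<phi> where \<phi>: "\<phi> \<in> iso X.T (add_monoid D)"
    and \<phi>_elem: "\<And>x d. \<lbrakk>x \<in> FG; d \<in> carrier D\<rbrakk> \<Longrightarrow> \<phi> (X.elem x d) = \<nu> p x \<otimes>\<^bsub>D\<^esub> d"
    using \<nu>_tensor_iso by blast
  have \<phi>_hom: "\<phi> \<in> hom X.T (add_monoid D)" and \<phi>_surj: "\<phi> ` carrier X.T = carrier D"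
    using \<phi> by (auto simp: iso_def bij_betw_def)
  have "\<one>\<^bsub>D\<^esub> \<in> \<phi> ` carrier X.T" unfolding \<phi>_surj by simp
  then obtain \<tau> where \<tau>: "\<phi> \<tau> = \<one>\<^bsub>D\<^esub>" "\<tau> \<in> carrier X.T" by (auto elim!: imageE)
  have hom: "(\<lambda>\<tau>. z \<otimes>\<^bsub>D\<^esub> \<phi> \<tau>) \<in> hom X.T (add_monoid D)" if "z \<in> carrier D" for z
    using hom_in_carrier[OF \<phi>_hom] hom_mult[OF \<phi>_hom] that by (auto simp: hom_def D.r_distr)
  have eq': "x \<otimes>\<^bsub>D\<^esub> \<nu> p a = y \<otimes>\<^bsub>D\<^esub> \<nu> p a" if a: "a \<in> FG" for a
  proof (rule R.fin_supp_hom_eq[where f = "\<lambda>a. x \<otimes>\<^bsub>D\<^esub> \<nu> p a" and g = "\<lambda>a. y \<otimes>\<^bsub>D\<^esub> \<nu> p a"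
        and h = "(\<oplus>\<^bsub>D\<^esub>)", OF _ _ _ _ a])
    fix g r assume g: "g \<in> carrier G" and r: "r \<in> carrier R"
    \<comment> \<open>The coefficient is moved to the right of the generator, so that
      \<open>z\<close> stands next to \<open>\<nu>_gen g p\<close> and the hypothesis
      applies.\<close>
    have "z \<otimes>\<^bsub>D\<^esub> \<nu> p (monomial R g r) = z \<otimes>\<^bsub>D\<^esub> \<nu>_gen g p \<otimes>\<^bsub>D\<^esub> \<nu>_coeff r" if "z \<in> carrier D" for z
      using g r p that \<nu>_gen_closed \<nu>_coeff_closed
      by (simp add: \<nu>_monomial flip: \<nu>_gen_coeff D.m_assoc)
    then show "x \<otimes>\<^bsub>D\<^esub> \<nu> p (monomial R g r) = y \<otimes>\<^bsub>D\<^esub> \<nu> p (monomial R g r)"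
      using x y eq[OF g] by simp
  qed (use x y p in \<open>simp_all add: \<nu>_add \<nu>_closed \<nu>_zero D.r_distr\<close>)
  have "x \<otimes>\<^bsub>D\<^esub> \<phi> \<tau> = y \<otimes>\<^bsub>D\<^esub> \<phi> \<tau>"
  proof (rule X.tensor_hom_eq[OF D.a_group hom[OF x] hom[OF y] _ \<tau>(2)])
    fix a d assume "a \<in> carrier (fibre diagram p)" "d \<in> carrier D"
    then show "x \<otimes>\<^bsub>D\<^esub> \<phi> (X.elem a d) = y \<otimes>\<^bsub>D\<^esub> \<phi> (X.elem a d)"
      using x y p eq' by (simp add: diagram_simps \<phi>_elem \<nu>_closed flip: D.m_assoc)
  qed
  then show ?thesis using \<tau>(1) x y by simp
qed

text \<open>Here \<open>s\<close> is the image of the unit under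
  \<open>D \<cong> F\<^sub>p \<otimes> D \<rightarrow> F\<^sub>1 \<otimes> D \<cong> D\<close>, where the middle arrow is induced by the
  projection of \<open>F\<^sub>p\<close> to the part of \<open>F\<^sub>p\<close> supported on the coset of \<open>g\<close>.  All these
  maps are right \<open>D\<close>-linear.\<close>

lemma \<nu>_dual_exists:
  assumes g: "g \<in> carrier G"
  shows "\<exists>s\<in>carrier D. \<forall>h\<in>carrier G.
    s \<otimes>\<^bsub>D\<^esub> \<nu>_gen h p = \<nu> \<one>\<^bsub>P\<^esub> (coset_coeff p g (single R h))"
proof -
  obtain \<phi> where \<phi>: "\<phi> \<in> iso X.T (add_monoid D)"
    and \<phi>_elem: "\<And>x d. \<lbrakk>x \<in> FG; d \<in> carrier D\<rbrakk> \<Longrightarrow> \<phi> (X.elem x d) = \<nu> p x \<otimes>\<^bsub>D\<^esub> d"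
    using \<nu>_tensor_iso by blast
  have \<phi>_hom: "\<phi> \<in> hom X.T (add_monoid D)" and \<phi>_surj: "\<phi> ` carrier X.T = carrier D"
    and \<phi>_inj: "inj_on \<phi> (carrier X.T)"
    using \<phi> by (auto simp: iso_def bij_betw_def)
  have "\<one>\<^bsub>D\<^esub> \<in> \<phi> ` carrier X.T" unfolding \<phi>_surj by simp
  then obtain \<tau> where \<tau>: "\<phi> \<tau> = \<one>\<^bsub>D\<^esub>" "\<tau> \<in> carrier X.T" by (auto elim!: imageE)
  note cc = coset_coeff_closed[OF p g]
  obtain \<Gamma> where \<Gamma>: "\<Gamma> \<in> hom X.T (add_monoid D)" and \<Gamma>_elem:
    "\<And>x d. \<lbrakk>x \<in> FG; d \<in> carrier D\<rbrakk> \<Longrightarrow> \<Gamma> (X.elem x d) = \<nu> \<one>\<^bsub>P\<^esub> (coset_coeff p g x) \<otimes>\<^bsub>D\<^esub> d"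
  proof (rule X.tensor_universal[OF D.a_comm_group,
        where b = "\<lambda>x d. \<nu> \<one>\<^bsub>P\<^esub> (coset_coeff p g x) \<otimes>\<^bsub>D\<^esub> d"])
    fix x s d assume "x \<in> carrier (fibre diagram p)" "s \<in> carrier (base_ring diagram)" "d \<in> carrier D"
    then show "\<nu> \<one>\<^bsub>P\<^esub> (coset_coeff p g (pair p x s)) \<otimes>\<^bsub>D\<^esub> d =
        \<nu> \<one>\<^bsub>P\<^esub> (coset_coeff p g x) \<otimes>\<^bsub>D\<^esub> (\<nu> \<one>\<^bsub>P\<^esub> s \<otimes>\<^bsub>D\<^esub> d)"
      using \<nu>_mult[of "\<one>\<^bsub>P\<^esub>" "\<one>\<^bsub>P\<^esub>" "coset_coeff p g x" s] cc
      by (simp add: diagram_simps \<nu>_closed coset_coeff_pair[OF p g] flip: D.m_assoc)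
  qed (auto simp: diagram_simps \<nu>_closed \<nu>_add cc coset_coeff_add D.l_distr D.r_distr)
  have "\<Gamma> \<tau> \<otimes>\<^bsub>D\<^esub> \<nu>_gen h p = \<nu> \<one>\<^bsub>P\<^esub> (coset_coeff p g (single R h))" if h: "h \<in> carrier G" for h
  proof -
    let ?v = "\<nu>_gen h p"
    have v: "?v \<in> carrier D" using h p by (rule \<nu>_gen_closed)
    have sh: "single R h \<in> FG" using h by (simp add: single_eq_monomial R.fin_supp_monomial)
    \<comment> \<open>\<sigma> is right multiplication by \<open>\<nu>_gen h p\<close> on the tensor
      product. Both \<phi> and \<Gamma> turn it into right multiplication on
      \<open>D\<close>.\<close>
    obtain \<sigma> where \<sigma>: "\<sigma> \<in> hom X.T X.T"
      and \<sigma>_elem: "\<And>x d. \<lbrakk>x \<in> FG; d \<in> carrier D\<rbrakk> \<Longrightarrow> \<sigma> (X.elem x d) = X.elem x (d \<otimes>\<^bsub>D\<^esub> ?v)"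
    proof (rule X.tensor_universal[OF X.tensor_comm_group, where b = "\<lambda>x d. X.elem x (d \<otimes>\<^bsub>D\<^esub> ?v)"])
      fix x s d assume *: "x \<in> carrier (fibre diagram p)" "s \<in> carrier (base_ring diagram)" "d \<in> carrier D"
      then have "X.elem (pair p x s) (d \<otimes>\<^bsub>D\<^esub> ?v) = X.elem x (\<nu> \<one>\<^bsub>P\<^esub> s \<otimes>\<^bsub>D\<^esub> (d \<otimes>\<^bsub>D\<^esub> ?v))"
        using v by (intro X.elem_balanced) auto
      then show "X.elem (pair p x s) (d \<otimes>\<^bsub>D\<^esub> ?v) = X.elem x (\<nu> \<one>\<^bsub>P\<^esub> s \<otimes>\<^bsub>D\<^esub> d \<otimes>\<^bsub>D\<^esub> ?v)"
        using * v by (simp add: diagram_simps \<nu>_closed D.m_assoc)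
    qed (use v in \<open>auto simp: diagram_simps D.l_distr X.elem_closed X.elem_add_left[unfolded diagram_simps]
        X.elem_add_right[unfolded diagram_simps]\<close>)
    have R_hom: "(\<lambda>\<tau>. f \<tau> \<otimes>\<^bsub>D\<^esub> ?v) \<in> hom X.T (add_monoid D)" if "f \<in> hom X.T (add_monoid D)" for f
      using hom_in_carrier[OF that] hom_mult[OF that] v by (auto simp: hom_def D.l_distr)
    have "(\<phi> \<circ> \<sigma>) \<tau> = \<phi> \<tau> \<otimes>\<^bsub>D\<^esub> ?v"
      by (rule X.tensor_hom_eq[OF D.a_group Group.hom_compose[OF \<sigma> \<phi>_hom] R_hom[OF \<phi>_hom] _ \<tau>(2)])
        (use v p in \<open>simp add: diagram_simps \<sigma>_elem \<phi>_elem \<nu>_closed D.m_assoc\<close>)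
    also have "\<dots> = \<phi> (X.elem (single R h) \<one>\<^bsub>D\<^esub>)"
      using v sh \<tau>(1) p by (simp add: \<phi>_elem \<nu>_closed \<nu>_gen_def)
    \<comment> \<open>The image of \<sigma> \<tau> under \<phi> is \<open>\<nu>_gen h p\<close>,
      which is also the image of 1_h \<otimes> 1. Injectivity of \<phi> identifies the two tensors,
      and \<Gamma> can be evaluated on the elementary one.\<close>
    finally have "\<sigma> \<tau> = X.elem (single R h) \<one>\<^bsub>D\<^esub>"
      using inj_onD[OF \<phi>_inj, of "\<sigma> \<tau>" "X.elem (single R h) \<one>\<^bsub>D\<^esub>"] hom_in_carrier[OF \<sigma> \<tau>(2)] sh
      by (simp add: X.elem_closed diagram_simps)
    moreover have "(\<Gamma> \<circ> \<sigma>) \<tau> = \<Gamma> \<tau> \<otimes>\<^bsub>D\<^esub> ?v"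
      by (rule X.tensor_hom_eq[OF D.a_group Group.hom_compose[OF \<sigma> \<Gamma>] R_hom[OF \<Gamma>] _ \<tau>(2)])
        (use v cc in \<open>simp add: diagram_simps \<sigma>_elem \<Gamma>_elem \<nu>_closed D.m_assoc\<close>)
    ultimately show ?thesis
      using sh cc by (simp add: \<Gamma>_elem \<nu>_closed)
  qed
  moreover have "\<Gamma> \<tau> \<in> carrier D" using hom_in_carrier[OF \<Gamma> \<tau>(2)] by simp
  ultimately show ?thesis by blast
qed

end

text \<open>The choice is harmless: by \<open>\<nu>_cancel\<close>, at most one element has these
  products with all \<open>\<nu>_gen h p\<close>.\<close>

definition \<nu>_dual :: "'g \<Rightarrow> 'p \<Rightarrow> 'd" where
  "\<nu>_dual g p = (SOME s. s \<in> carrier D \<and> (\<forall>h\<in>carrier G.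
    s \<otimes>\<^bsub>D\<^esub> \<nu>_gen h p = \<nu> \<one>\<^bsub>P\<^esub> (coset_coeff p g (single R h))))"

lemma
  assumes "g \<in> carrier G" "p \<in> carrier P"
  shows \<nu>_dual_closed: "\<nu>_dual g p \<in> carrier D"
    and \<nu>_dual_gen: "h \<in> carrier G \<Longrightarrow>
      \<nu>_dual g p \<otimes>\<^bsub>D\<^esub> \<nu>_gen h p = \<nu> \<one>\<^bsub>P\<^esub> (coset_coeff p g (single R h))"
  using someI_ex[OF \<nu>_dual_exists[OF assms(2,1), unfolded Bex_def]] unfolding \<nu>_dual_def by blast+

lemma \<nu>_dual_same:
  "\<lbrakk>g \<in> carrier G; p \<in> carrier P; k \<in> carrier G\<rbrakk> \<Longrightarrow>
    \<nu>_dual g p \<otimes>\<^bsub>D\<^esub> \<nu>_gen (g \<otimes>\<^bsub>G\<^esub> \<theta> p k) p = \<nu>_gen k \<one>\<^bsub>P\<^esub>"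
  using \<nu>_dual_gen[of g p "g \<otimes>\<^bsub>G\<^esub> \<theta> p k"]
  by (simp add: single_eq_monomial coset_coeff_monomial \<nu>_gen_def)

lemma \<nu>_dual_other:
  "\<lbrakk>g \<in> carrier G; h \<in> carrier G; p \<in> carrier P; \<not> in_coset p g h\<rbrakk> \<Longrightarrow>
    \<nu>_dual g p \<otimes>\<^bsub>D\<^esub> \<nu>_gen h p = \<zero>\<^bsub>D\<^esub>"
  by (simp add: \<nu>_dual_gen single_eq_monomial coset_coeff_monomial_other \<nu>_zero)

text \<open>Relation (2) holds by construction of \<open>\<nu>_dual\<close>. Commutation with
  scalars and relation (3) are verified after right multiplication by each
  \<open>\<nu>_gen h p\<close>, which suffices by \<open>\<nu>_cancel\<close>.\<close>

lemma covariant_rep_system: "delta_system R P G \<theta> D \<nu>_coeff \<nu>_gen \<nu>_dual"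
proof unfold_locales
  fix r g p assume r: "r \<in> carrier R" and g: "g \<in> carrier G" and p: "p \<in> carrier P"
  show "\<nu>_dual g p \<otimes>\<^bsub>D\<^esub> \<nu>_coeff r = \<nu>_coeff r \<otimes>\<^bsub>D\<^esub> \<nu>_dual g p"
  proof (rule \<nu>_cancel[OF p])
    fix h assume h: "h \<in> carrier G"
    note cl = \<nu>_dual_closed[OF g p] \<nu>_coeff_closed[OF r] \<nu>_gen_closed
    have "\<nu>_dual g p \<otimes>\<^bsub>D\<^esub> \<nu>_coeff r \<otimes>\<^bsub>D\<^esub> \<nu>_gen h p = \<nu>_dual g p \<otimes>\<^bsub>D\<^esub> \<nu>_gen h p \<otimes>\<^bsub>D\<^esub> \<nu>_coeff r"
      using p h cl \<nu>_gen_coeff[OF p h r] by (simp add: D.m_assoc)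
    also have "\<dots> = \<nu>_coeff r \<otimes>\<^bsub>D\<^esub> (\<nu>_dual g p \<otimes>\<^bsub>D\<^esub> \<nu>_gen h p)"
    proof (cases "in_coset p g h")
      case True
      then obtain k where "k \<in> carrier G" "h = g \<otimes>\<^bsub>G\<^esub> \<theta> p k" by (auto simp: in_coset_def)
      then show ?thesis using g p r by (simp add: \<nu>_dual_same \<nu>_gen_coeff)
    next
      case False
      then show ?thesis using g p h cl by (simp add: \<nu>_dual_other)
    qed
    finally show "\<nu>_dual g p \<otimes>\<^bsub>D\<^esub> \<nu>_coeff r \<otimes>\<^bsub>D\<^esub> \<nu>_gen h p = \<nu>_coeff r \<otimes>\<^bsub>D\<^esub> \<nu>_dual g p \<otimes>\<^bsub>D\<^esub> \<nu>_gen h p"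
      using p h cl by (simp add: D.m_assoc)
  qed (use g p r in \<open>simp_all add: \<nu>_dual_closed \<nu>_coeff_closed\<close>)
next
  fix p T assume p: "p \<in> carrier P" and T: "left_transversal G (\<theta> p ` carrier G) T"
  note TG = transversal_subset[OF T] and fin = transversal_finite[OF p T]
  have cl: "t \<in> T \<Longrightarrow> \<nu>_gen t p \<in> carrier D" "t \<in> T \<Longrightarrow> \<nu>_dual t p \<in> carrier D" for t
    using TG p by (auto simp: \<nu>_gen_closed \<nu>_dual_closed)
  show "finsum D (\<lambda>t. \<nu>_gen t p \<otimes>\<^bsub>D\<^esub> \<nu>_dual t p) T = \<one>\<^bsub>D\<^esub>"
  proof (rule \<nu>_cancel[OF p])
    fix h assume h: "h \<in> carrier G"
    have hD: "\<nu>_gen h p \<in> carrier D" using h p by (rule \<nu>_gen_closed)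
    obtain t k where t: "t \<in> T" and k: "k \<in> carrier G" and tk: "t \<otimes>\<^bsub>G\<^esub> \<theta> p k = h"
      and uniq: "\<And>t'. t' \<in> T \<Longrightarrow> in_coset p t' h \<longleftrightarrow> t' = t"
      using transversal_unique[OF p T h] by blast
    have "finsum D (\<lambda>t. \<nu>_gen t p \<otimes>\<^bsub>D\<^esub> \<nu>_dual t p) T \<otimes>\<^bsub>D\<^esub> \<nu>_gen h p =
        finsum D (\<lambda>t. \<nu>_gen t p \<otimes>\<^bsub>D\<^esub> \<nu>_dual t p \<otimes>\<^bsub>D\<^esub> \<nu>_gen h p) T"
      by (rule D.finsum_ldistr[OF fin hD]) (use cl in auto)
    \<comment> \<open>By relation (2) the only term left is the one for the representative
      \<open>t\<close> of the coset of \<open>h\<close>, and \<open>V\<^sub>t\<^sub>,\<^sub>p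
      V\<^sub>k\<^sub>,\<^sub>1 = V\<^sub>h\<^sub>,\<^sub>p\<close>.\<close>
    also have "\<dots> = finsum D (\<lambda>t'. if t = t' then \<nu>_gen h p else \<zero>\<^bsub>D\<^esub>) T"
    proof (rule D.finsum_cong')
      fix t' assume t': "t' \<in> T"
      then have t'G: "t' \<in> carrier G" using TG by auto
      show "\<nu>_gen t' p \<otimes>\<^bsub>D\<^esub> \<nu>_dual t' p \<otimes>\<^bsub>D\<^esub> \<nu>_gen h p = (if t = t' then \<nu>_gen h p else \<zero>\<^bsub>D\<^esub>)"
      proof (cases "t = t'")
        case True
        have "\<nu>_dual t' p \<otimes>\<^bsub>D\<^esub> \<nu>_gen h p = \<nu>_gen k \<one>\<^bsub>P\<^esub>"
          using \<nu>_dual_same[OF t'G p k] True tk by simp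
        then show ?thesis
          using True t'G p k cl[OF t'] hD tk \<nu>_gen_mult[of t' k p "\<one>\<^bsub>P\<^esub>"] by (simp add: D.m_assoc)
      next
        case False
        then show ?thesis
          using \<nu>_dual_other[OF t'G h p] uniq[OF t'] cl[OF t'] hD by (simp add: D.m_assoc)
      qed
    qed (use hD in auto)
    also have "\<dots> = \<nu>_gen h p"
      using D.add.finprod_singleton[OF t fin, of "\<lambda>_. \<nu>_gen h p"] hD by simp
    finally show "finsum D (\<lambda>t. \<nu>_gen t p \<otimes>\<^bsub>D\<^esub> \<nu>_dual t p) T \<otimes>\<^bsub>D\<^esub> \<nu>_gen h p = \<one>\<^bsub>D\<^esub> \<otimes>\<^bsub>D\<^esub> \<nu>_gen h p"
      using hD by simp
  qed (use cl in \<open>auto intro!: D.finsum_closed\<close>)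
qed (auto simp: \<nu>_coeff_hom \<nu>_gen_closed \<nu>_dual_closed \<nu>_gen_coeff \<nu>_gen_mult \<nu>_gen_one
    \<nu>_dual_same \<nu>_dual_other)

end

section \<open>The algebra generated by \<open>\<delta>\<close> and \<open>\<delta>\<^sup>*\<close>\<close>

context endo_action
begin

abbreviation X :: "('g, 'p) gen set" where "X \<equiv> gens P G"
abbreviation F :: "(('g, 'p) gen list \<Rightarrow> 'r) ring" where "F \<equiv> free_algebra R X"
abbreviation E where "E \<equiv> all_delta_relations R P G \<theta>"
abbreviation I where "I \<equiv> relation_ideal R X E"
abbreviation A where "A \<equiv> delta_algebra R P G \<theta>"
abbreviation W where "W \<equiv> lists X - {[]}"

lemma gens_Delta [simp]: "Delta g p \<in> X \<longleftrightarrow> g \<in> carrier G \<and> p \<in> carrier P"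
  and gens_DeltaStar [simp]: "DeltaStar g p \<in> X \<longleftrightarrow> g \<in> carrier G \<and> p \<in> carrier P"
  by (auto simp: gens_def)

lemma \<delta>_monomial: "\<delta> R g p = monomial R [Delta g p] \<one>\<^bsub>R\<^esub>"
  and \<delta>s_monomial: "\<delta>s R g p = monomial R [DeltaStar g p] \<one>\<^bsub>R\<^esub>"
  by (simp_all add: \<delta>_def \<delta>s_def single_eq_monomial)

lemma \<delta>_closed: "\<lbrakk>g \<in> carrier G; p \<in> carrier P\<rbrakk> \<Longrightarrow> \<delta> R g p \<in> carrier F"
  and \<delta>s_closed: "\<lbrakk>g \<in> carrier G; p \<in> carrier P\<rbrakk> \<Longrightarrow> \<delta>s R g p \<in> carrier F"
  by (auto simp: R.free_algebra_carrier \<delta>_monomial \<delta>s_monomial intro!: R.fin_supp_monomial)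

sublocale F: nonunital_ring F
  by (rule R.free_algebra_nonunital_ring)

lemma relations_closed:
  assumes "(a, b) \<in> E"
  shows "a \<in> carrier F" "b \<in> carrier F"
proof -
  have "a \<in> carrier F \<and> b \<in> carrier F"
    using assms unfolding all_delta_relations_def
  proof (elim insertE)
    assume "(a, b) \<in> delta_relations R P G \<theta>"
    then show ?thesis
    proof (cases rule: delta_relations.cases)
      case (sum_over_cosets p T)
      then show ?thesis
        using transversal_subset[of "\<theta> p ` carrier G" T]
        by (auto intro!: F.finsum_closed F.m_closed \<delta>_closed \<delta>s_closed)
    qed (auto intro!: F.m_closed \<delta>_closed \<delta>s_closed)
  qed (simp add: delta_unit_relation_def \<delta>_closed \<delta>s_closed)
  then show "a \<in> carrier F" "b \<in> carrier F" by auto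
qed

lemma delta_relation_in_E: "x \<in> delta_relations R P G \<theta> \<Longrightarrow> x \<in> E"
  by (simp add: all_delta_relations_def)

lemma I_ideal: "algebra_ideal R X I"
  by (rule R.relation_ideal_is_ideal) (use relations_closed in auto)

sublocale Q: nonunital_ideal F I
  by (intro nonunital_ideal.intro nonunital_ideal_axioms.intro F.nonunital_ring_axioms)
    (use I_ideal in \<open>simp_all add: algebra_ideal_def\<close>)

abbreviation proj where "proj a \<equiv> I +>\<^bsub>F\<^esub> a"

lemma A_def: "A = F Quot I"
  by (simp add: delta_algebra_def presented_algebra_def)

lemma A_carrier: "carrier A = proj ` carrier F"
  unfolding A_def by (rule Q.quotient_carrier)

lemma proj_closed: "a \<in> carrier F \<Longrightarrow> proj a \<in> carrier A"
  by (simp add: A_carrier)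

lemma proj_add: "\<lbrakk>a \<in> carrier F; b \<in> carrier F\<rbrakk> \<Longrightarrow> proj (a \<oplus>\<^bsub>F\<^esub> b) = proj a \<oplus>\<^bsub>A\<^esub> proj b"
  by (simp add: A_def Q.quotient_add)

lemma proj_mult: "\<lbrakk>a \<in> carrier F; b \<in> carrier F\<rbrakk> \<Longrightarrow> proj (a \<otimes>\<^bsub>F\<^esub> b) = proj a \<otimes>\<^bsub>A\<^esub> proj b"
  by (simp add: A_def Q.quotient_mult)

lemma A_nonunital_ring: "nonunital_ring A"
  unfolding A_def by (rule Q.quotient_nonunital_ring)

lemma proj_hom: "proj \<in> hom (add_monoid F) (add_monoid A)"
  unfolding A_def by (rule Q.quotient_hom)

lemma proj_relation: "(a, b) \<in> E \<Longrightarrow> proj a = proj b"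
  using Q.rcos_eq_iff relations_closed relation_in_ideal by metis

lemma F_hom_minus:
  assumes f: "f \<in> hom (add_monoid F) (add_monoid F)" and ab: "a \<in> carrier F" "b \<in> carrier F"
  shows "f (a \<ominus>\<^bsub>F\<^esub> b) = f a \<ominus>\<^bsub>F\<^esub> f b"
proof -
  interpret f: group_hom "add_monoid F" "add_monoid F" f
    by (rule group_hom.intro[OF F.a_group F.a_group]) (rule group_hom_axioms.intro[OF f])
  show ?thesis
    using hom_mult[OF f, of a "\<ominus>\<^bsub>F\<^esub> b"] f.hom_inv[of b, folded a_inv_def] ab
    by (simp add: a_minus_def)
qed

text \<open>As long as no unit is known, scaling is not multiplication by an element of the algebra.
  Closure of the relation ideal under scalars is what lets a relation between words be given a
  coefficient.\<close>

lemma proj_lscale_cong: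
  assumes ab: "a \<in> carrier F" "b \<in> carrier F" and r: "r \<in> carrier R" and eq: "proj a = proj b"
  shows "proj (lscale R r a) = proj (lscale R r b)"
proof -
  have "lscale R r \<in> hom (add_monoid F) (add_monoid F)"
    using r R.lscale_closed[OF r] R.lscale_add[OF r]
    by (auto simp: hom_def R.free_algebra_carrier R.free_algebra_add)
  then have "lscale R r (a \<ominus>\<^bsub>F\<^esub> b) = lscale R r a \<ominus>\<^bsub>F\<^esub> lscale R r b"
    by (rule F_hom_minus) (use ab in auto)
  moreover have "lscale R r (a \<ominus>\<^bsub>F\<^esub> b) \<in> I"
    using I_ideal eq Q.rcos_eq_iff[OF ab] r by (auto simp: algebra_ideal_def)
  ultimately show ?thesis
    using ab R.lscale_closed[OF r] by (subst Q.rcos_eq_iff) (auto simp: R.free_algebra_carrier)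
qed

text \<open>The coefficient is kept inside the class, so that products can be computed before the
  algebra is known to have a unit. Afterwards \<open>cls unit r\<close> is the image of the scalar
  \<open>r\<close>.\<close>

definition cls :: "('g, 'p) gen list \<Rightarrow> 'r \<Rightarrow> (('g, 'p) gen list \<Rightarrow> 'r) set" where
  "cls w r = proj (monomial R w r)"

lemma monomial_closed: "\<lbrakk>w \<in> W; r \<in> carrier R\<rbrakk> \<Longrightarrow> monomial R w r \<in> carrier F"
  unfolding R.free_algebra_carrier by (rule R.fin_supp_monomial)

lemma cls_closed: "\<lbrakk>w \<in> W; r \<in> carrier R\<rbrakk> \<Longrightarrow> cls w r \<in> carrier A"
  unfolding cls_def by (intro proj_closed monomial_closed)

lemma cls_mult:
  "\<lbrakk>v \<in> W; w \<in> W; r \<in> carrier R; s \<in> carrier R\<rbrakk> \<Longrightarrow> cls v r \<otimes>\<^bsub>A\<^esub> cls w s = cls (v @ w) (r \<otimes>\<^bsub>R\<^esub> s)"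
  unfolding cls_def
  by (simp add: monomial_closed R.free_algebra_mult R.conv_monomial flip: proj_mult del: Diff_iff)

lemma cls_lscale_cong:
  assumes "v \<in> W" "w \<in> W" "r \<in> carrier R" "s \<in> carrier R" "t \<in> carrier R" "cls v s = cls w t"
  shows "cls v (r \<otimes>\<^bsub>R\<^esub> s) = cls w (r \<otimes>\<^bsub>R\<^esub> t)"
  using proj_lscale_cong[OF monomial_closed monomial_closed, of v s w t r] assms
  by (simp add: cls_def R.lscale_monomial)

abbreviation unit where "unit \<equiv> [Delta \<one>\<^bsub>G\<^esub> \<one>\<^bsub>P\<^esub>]"

lemma unit_word: "unit \<in> W" by simp

lemma cls_relation:
  assumes "(a, b) \<in> E"
  shows "a = monomial R v \<one>\<^bsub>R\<^esub> \<Longrightarrow> b = monomial R w \<one>\<^bsub>R\<^esub> \<Longrightarrow> cls v \<one>\<^bsub>R\<^esub> = cls w \<one>\<^bsub>R\<^esub>"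
  using proj_relation[OF assms] by (simp add: cls_def)

lemma \<delta>_mult_monomial:
  "\<delta> R g p \<otimes>\<^bsub>F\<^esub> \<delta> R h q = monomial R [Delta g p, Delta h q] \<one>\<^bsub>R\<^esub>"
  "\<delta>s R g p \<otimes>\<^bsub>F\<^esub> \<delta>s R h q = monomial R [DeltaStar g p, DeltaStar h q] \<one>\<^bsub>R\<^esub>"
  "\<delta>s R g p \<otimes>\<^bsub>F\<^esub> \<delta> R h q = monomial R [DeltaStar g p, Delta h q] \<one>\<^bsub>R\<^esub>"
  "\<delta> R g p \<otimes>\<^bsub>F\<^esub> \<delta>s R h q = monomial R [Delta g p, DeltaStar h q] \<one>\<^bsub>R\<^esub>"
  by (simp_all add: R.free_algebra_mult \<delta>_monomial \<delta>s_monomial R.conv_monomial)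

lemma cls_\<delta>_mult:
  "\<lbrakk>g \<in> carrier G; h \<in> carrier G; p \<in> carrier P; q \<in> carrier P\<rbrakk> \<Longrightarrow>
    cls [Delta g p, Delta h q] \<one>\<^bsub>R\<^esub> = cls [Delta (g \<otimes>\<^bsub>G\<^esub> \<theta> p h) (p \<otimes>\<^bsub>P\<^esub> q)] \<one>\<^bsub>R\<^esub>"
  by (rule cls_relation[OF delta_relation_in_E[OF delta_relations.mult_delta]])
    (simp_all add: R.free_algebra_mult R.conv_monomial \<delta>_monomial)

lemma cls_\<delta>s_mult:
  "\<lbrakk>g \<in> carrier G; h \<in> carrier G; p \<in> carrier P; q \<in> carrier P\<rbrakk> \<Longrightarrow>
    cls [DeltaStar g p, DeltaStar h q] \<one>\<^bsub>R\<^esub> = cls [DeltaStar (h \<otimes>\<^bsub>G\<^esub> \<theta> q g) (q \<otimes>\<^bsub>P\<^esub> p)] \<one>\<^bsub>R\<^esub>"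
  by (rule cls_relation[OF delta_relation_in_E[OF delta_relations.mult_delta_star]])
    (simp_all add: R.free_algebra_mult R.conv_monomial \<delta>s_monomial)

lemma cls_\<delta>s_unit: "cls [DeltaStar \<one>\<^bsub>G\<^esub> \<one>\<^bsub>P\<^esub>] \<one>\<^bsub>R\<^esub> = cls unit \<one>\<^bsub>R\<^esub>"
  by (rule cls_relation[of "fst (delta_unit_relation R P G)" "snd (delta_unit_relation R P G)"])
    (simp_all add: all_delta_relations_def delta_unit_relation_def \<delta>_monomial \<delta>s_monomial)

lemma cls_unit_gen:
  assumes "x \<in> X"
  shows "cls unit \<one>\<^bsub>R\<^esub> \<otimes>\<^bsub>A\<^esub> cls [x] \<one>\<^bsub>R\<^esub> = cls [x] \<one>\<^bsub>R\<^esub>" "cls [x] \<one>\<^bsub>R\<^esub> \<otimes>\<^bsub>A\<^esub> cls unit \<one>\<^bsub>R\<^esub> = cls [x] \<one>\<^bsub>R\<^esub>"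
proof -
  have "cls unit \<one>\<^bsub>R\<^esub> \<otimes>\<^bsub>A\<^esub> cls [x] \<one>\<^bsub>R\<^esub> = cls [x] \<one>\<^bsub>R\<^esub> \<and> cls [x] \<one>\<^bsub>R\<^esub> \<otimes>\<^bsub>A\<^esub> cls unit \<one>\<^bsub>R\<^esub> = cls [x] \<one>\<^bsub>R\<^esub>"
  proof (cases x)
    case (Delta g p)
    then show ?thesis
      using assms by (simp add: cls_mult cls_\<delta>_mult \<theta>_id \<theta>_one)
  next
    case (DeltaStar g p)
    then show ?thesis
      \<comment> \<open>Relation (1) multiplies \<open>\<delta>\<close> with \<open>\<delta>\<close>
        and \<open>\<delta>\<^sup>*\<close> with \<open>\<delta>\<^sup>*\<close>, so here the unit
        is rewritten as \<open>\<delta>\<^sup>*\<^sub>1\<^sub>,\<^sub>1\<close>. This is the purpose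
        of the added unit relation.\<close>
      using assms unfolding cls_\<delta>s_unit[symmetric]
      by (simp add: cls_mult cls_\<delta>s_mult \<theta>_id \<theta>_one)
  qed
  then show "cls unit \<one>\<^bsub>R\<^esub> \<otimes>\<^bsub>A\<^esub> cls [x] \<one>\<^bsub>R\<^esub> = cls [x] \<one>\<^bsub>R\<^esub>" "cls [x] \<one>\<^bsub>R\<^esub> \<otimes>\<^bsub>A\<^esub> cls unit \<one>\<^bsub>R\<^esub> = cls [x] \<one>\<^bsub>R\<^esub>"
    by auto
qed

text \<open>The first letter of the word absorbs the unit on the left, the last letter absorbs it on
  the right.\<close>

lemma cls_unit_word:
  assumes w: "w \<in> W"
  shows "cls (unit @ w) \<one>\<^bsub>R\<^esub> = cls w \<one>\<^bsub>R\<^esub>" "cls (w @ unit) \<one>\<^bsub>R\<^esub> = cls w \<one>\<^bsub>R\<^esub>"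
proof -
  interpret A: nonunital_ring A by (rule A_nonunital_ring)
  obtain x v where xv: "w = x # v" using w by (cases w) auto
  have x: "x \<in> X" and v: "v \<in> lists X" using w xv by auto
  have "cls unit \<one>\<^bsub>R\<^esub> \<otimes>\<^bsub>A\<^esub> cls w \<one>\<^bsub>R\<^esub> = cls w \<one>\<^bsub>R\<^esub>"
  proof (cases "v = []")
    case True
    then show ?thesis using cls_unit_gen[OF x] xv by simp
  next
    case False
    then have "cls w \<one>\<^bsub>R\<^esub> = cls [x] \<one>\<^bsub>R\<^esub> \<otimes>\<^bsub>A\<^esub> cls v \<one>\<^bsub>R\<^esub>"
      using x v xv by (simp add: cls_mult)
    then show ?thesis
      using cls_unit_gen(1)[OF x] A.m_assoc[of "cls unit \<one>\<^bsub>R\<^esub>" "cls [x] \<one>\<^bsub>R\<^esub>" "cls v \<one>\<^bsub>R\<^esub>"] False x v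
      by (simp add: cls_closed)
  qed
  then show "cls (unit @ w) \<one>\<^bsub>R\<^esub> = cls w \<one>\<^bsub>R\<^esub>"
    using cls_mult[OF unit_word w R.one_closed R.one_closed] by simp
  obtain y u where yu: "w = u @ [y]" using w by (cases w rule: rev_cases) auto
  have y: "y \<in> X" and u: "u \<in> lists X" using w yu by auto
  have "cls w \<one>\<^bsub>R\<^esub> \<otimes>\<^bsub>A\<^esub> cls unit \<one>\<^bsub>R\<^esub> = cls w \<one>\<^bsub>R\<^esub>"
  proof (cases "u = []")
    case True
    then show ?thesis using cls_unit_gen[OF y] yu by simp
  next
    case False
    then have "cls w \<one>\<^bsub>R\<^esub> = cls u \<one>\<^bsub>R\<^esub> \<otimes>\<^bsub>A\<^esub> cls [y] \<one>\<^bsub>R\<^esub>"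
      using y u yu by (simp add: cls_mult)
    then show ?thesis
      using cls_unit_gen(2)[OF y] A.m_assoc[of "cls u \<one>\<^bsub>R\<^esub>" "cls [y] \<one>\<^bsub>R\<^esub>" "cls unit \<one>\<^bsub>R\<^esub>"] False y u
      by (simp add: cls_closed)
  qed
  then show "cls (w @ unit) \<one>\<^bsub>R\<^esub> = cls w \<one>\<^bsub>R\<^esub>"
    using cls_mult[OF w unit_word R.one_closed R.one_closed] by simp
qed

text \<open>The unit is absorbed for coefficient 1, and the identity is then scaled by
  \<open>cls_lscale_cong\<close>. For \<open>s\<close> equal to 1 both products become
  \<open>cls w r\<close>, so scalars commute with words.\<close>

lemma cls_coeff:
  assumes w: "w \<in> W" and r: "r \<in> carrier R" and s: "s \<in> carrier R"
  shows "cls unit r \<otimes>\<^bsub>A\<^esub> cls w s = cls w (r \<otimes>\<^bsub>R\<^esub> s)" "cls w s \<otimes>\<^bsub>A\<^esub> cls unit r = cls w (s \<otimes>\<^bsub>R\<^esub> r)"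
proof -
  have rs: "r \<otimes>\<^bsub>R\<^esub> s \<in> carrier R" "s \<otimes>\<^bsub>R\<^esub> r \<in> carrier R" using r s by simp_all
  have "unit @ w \<in> W" "w @ unit \<in> W" using w by auto
  then have "cls (unit @ w) (r \<otimes>\<^bsub>R\<^esub> s) = cls w (r \<otimes>\<^bsub>R\<^esub> s)" "cls (w @ unit) (s \<otimes>\<^bsub>R\<^esub> r) = cls w (s \<otimes>\<^bsub>R\<^esub> r)"
    using cls_lscale_cong[OF _ w rs(1) R.one_closed R.one_closed cls_unit_word(1)[OF w]]
      cls_lscale_cong[OF _ w rs(2) R.one_closed R.one_closed cls_unit_word(2)[OF w]] rs by simp_all
  then show "cls unit r \<otimes>\<^bsub>A\<^esub> cls w s = cls w (r \<otimes>\<^bsub>R\<^esub> s)" "cls w s \<otimes>\<^bsub>A\<^esub> cls unit r = cls w (s \<otimes>\<^bsub>R\<^esub> r)"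
    by (simp_all only: cls_mult[OF unit_word w r s] cls_mult[OF w unit_word s r])
qed

abbreviation A1 where "A1 \<equiv> A\<lparr>one := cls unit \<one>\<^bsub>R\<^esub>\<rparr>"

lemma A1_ring: "ring A1"
proof (rule nonunital_ring_update_one[OF A_nonunital_ring])
  interpret A: nonunital_ring A by (rule A_nonunital_ring)
  have c: "cls unit \<one>\<^bsub>R\<^esub> \<in> carrier A" by (rule cls_closed[OF unit_word R.one_closed])
  then show "cls unit \<one>\<^bsub>R\<^esub> \<in> carrier A" .
  have padd: "proj (\<lambda>x. a x \<oplus>\<^bsub>R\<^esub> b x) = proj a \<oplus>\<^bsub>A\<^esub> proj b" "proj a \<in> carrier A" "proj b \<in> carrier A"
    if "a \<in> fin_supp R W" "b \<in> fin_supp R W" for a b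
    using proj_add[of a b] that by (simp_all add: R.free_algebra_carrier R.free_algebra_add proj_closed)
  have pz: "proj (\<lambda>_. \<zero>\<^bsub>R\<^esub>) = \<zero>\<^bsub>A\<^esub>"
    using add_hom_zero[OF F.abelian_group_axioms A.abelian_group_axioms proj_hom]
    by (simp add: R.free_algebra_zero)
  fix d assume "d \<in> carrier A"
  then obtain a where a: "a \<in> fin_supp R W" and d: "d = proj a"
    by (auto simp: A_carrier R.free_algebra_carrier)
  show "cls unit \<one>\<^bsub>R\<^esub> \<otimes>\<^bsub>A\<^esub> d = d" unfolding d
  proof (rule R.fin_supp_hom_eq[where f = "\<lambda>a. cls unit \<one>\<^bsub>R\<^esub> \<otimes>\<^bsub>A\<^esub> proj a" and g = "\<lambda>a. proj a"
        and h = "(\<oplus>\<^bsub>A\<^esub>)", OF _ _ _ _ a])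
    fix w r assume "w \<in> W" "r \<in> carrier R"
    then show "cls unit \<one>\<^bsub>R\<^esub> \<otimes>\<^bsub>A\<^esub> proj (monomial R w r) = proj (monomial R w r)"
      using cls_coeff(1)[of w "\<one>\<^bsub>R\<^esub>" r] by (simp add: cls_def)
  qed (use c in \<open>simp_all only: padd pz A.r_distr A.m_zero\<close>)
  show "d \<otimes>\<^bsub>A\<^esub> cls unit \<one>\<^bsub>R\<^esub> = d" unfolding d
  proof (rule R.fin_supp_hom_eq[where f = "\<lambda>a. proj a \<otimes>\<^bsub>A\<^esub> cls unit \<one>\<^bsub>R\<^esub>" and g = "\<lambda>a. proj a"
        and h = "(\<oplus>\<^bsub>A\<^esub>)", OF _ _ _ _ a])
    fix w r assume "w \<in> W" "r \<in> carrier R"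
    then show "proj (monomial R w r) \<otimes>\<^bsub>A\<^esub> cls unit \<one>\<^bsub>R\<^esub> = proj (monomial R w r)"
      using cls_coeff(2)[of w "\<one>\<^bsub>R\<^esub>" r] by (simp add: cls_def)
  qed (use c in \<open>simp_all only: padd pz A.l_distr A.zero_m\<close>)
qed

lemma proj_hom1: "proj \<in> hom (add_monoid F) (add_monoid A1)"
  using proj_hom by simp

lemma cls_add:
  "\<lbrakk>w \<in> W; r \<in> carrier R; s \<in> carrier R\<rbrakk> \<Longrightarrow> cls w (r \<oplus>\<^bsub>R\<^esub> s) = cls w r \<oplus>\<^bsub>A\<^esub> cls w s"
  unfolding cls_def
  by (simp add: R.monomial_add monomial_closed R.free_algebra_add del: Diff_iff flip: proj_add)

text \<open>The relations hold in the quotient by construction. This instance makes the results on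
  systems, in particular covariance of \<open>rep\<close>, available for the presented algebra
  itself.\<close>

lemma A_system:
  "delta_system R P G \<theta> A1 (cls unit) (\<lambda>g p. cls [Delta g p] \<one>\<^bsub>R\<^esub>) (\<lambda>g p. cls [DeltaStar g p] \<one>\<^bsub>R\<^esub>)"
proof -
  interpret A1: ring A1 by (rule A1_ring)
  show ?thesis
  proof unfold_locales
    show "cls unit \<in> ring_hom R A1"
      by (rule ring_hom_memI) (simp_all add: cls_closed cls_coeff cls_add)
    show "cls [Delta g p] \<one>\<^bsub>R\<^esub> \<otimes>\<^bsub>A1\<^esub> cls unit r = cls unit r \<otimes>\<^bsub>A1\<^esub> cls [Delta g p] \<one>\<^bsub>R\<^esub>"
      "cls [DeltaStar g p] \<one>\<^bsub>R\<^esub> \<otimes>\<^bsub>A1\<^esub> cls unit r = cls unit r \<otimes>\<^bsub>A1\<^esub> cls [DeltaStar g p] \<one>\<^bsub>R\<^esub>"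
      if "r \<in> carrier R" "g \<in> carrier G" "p \<in> carrier P" for r g p
      using that by (simp_all add: cls_coeff)
  next
    fix g p k assume "g \<in> carrier G" "p \<in> carrier P" "k \<in> carrier G"
    then have "cls [DeltaStar g p, Delta (g \<otimes>\<^bsub>G\<^esub> \<theta> p k) p] \<one>\<^bsub>R\<^esub> = cls [Delta k \<one>\<^bsub>P\<^esub>] \<one>\<^bsub>R\<^esub>"
      by (intro cls_relation[OF delta_relation_in_E[OF delta_relations.star_delta_same_coset]])
        (auto simp: R.free_algebra_mult R.conv_monomial \<delta>_monomial \<delta>s_monomial)
    then show "cls [DeltaStar g p] \<one>\<^bsub>R\<^esub> \<otimes>\<^bsub>A1\<^esub> cls [Delta (g \<otimes>\<^bsub>G\<^esub> \<theta> p k) p] \<one>\<^bsub>R\<^esub> = cls [Delta k \<one>\<^bsub>P\<^esub>] \<one>\<^bsub>R\<^esub>"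
      using \<open>g \<in> carrier G\<close> \<open>p \<in> carrier P\<close> \<open>k \<in> carrier G\<close> by (simp add: cls_mult)
  next
    fix g h p assume *: "g \<in> carrier G" "h \<in> carrier G" "p \<in> carrier P" "\<not> in_coset p g h"
    then have "proj (\<delta>s R g p \<otimes>\<^bsub>F\<^esub> \<delta> R h p) = proj \<zero>\<^bsub>F\<^esub>"
      by (intro proj_relation delta_relation_in_E[OF delta_relations.star_delta_other_coset])
        (auto simp: in_coset_def)
    also have "\<dots> = \<zero>\<^bsub>A1\<^esub>"
      by (rule add_hom_zero[OF F.abelian_group_axioms A1.is_abelian_group proj_hom1])
    finally show "cls [DeltaStar g p] \<one>\<^bsub>R\<^esub> \<otimes>\<^bsub>A1\<^esub> cls [Delta h p] \<one>\<^bsub>R\<^esub> = \<zero>\<^bsub>A1\<^esub>"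
      using * by (simp add: cls_mult \<delta>_mult_monomial) (simp add: cls_def)
  next
    fix p T assume p: "p \<in> carrier P" and T: "left_transversal G (\<theta> p ` carrier G) T"
    note TG = transversal_subset[OF T]
    have "cls unit \<one>\<^bsub>R\<^esub> = proj (finsum F (\<lambda>t. \<delta> R t p \<otimes>\<^bsub>F\<^esub> \<delta>s R t p) T)"
      unfolding cls_def \<delta>_monomial[symmetric]
      by (rule proj_relation[OF delta_relation_in_E[OF delta_relations.sum_over_cosets[where \<theta> = \<theta>, OF p T]]])
    also have "\<dots> = finsum A1 (\<lambda>t. proj (\<delta> R t p \<otimes>\<^bsub>F\<^esub> \<delta>s R t p)) T"
      by (rule hom_finsum[OF F.abelian_group_axioms A1.is_abelian_group proj_hom1])
        (use TG p in \<open>auto intro!: F.m_closed \<delta>_closed \<delta>s_closed\<close>)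
    also have "\<dots> = finsum A1 (\<lambda>t. cls [Delta t p] \<one>\<^bsub>R\<^esub> \<otimes>\<^bsub>A1\<^esub> cls [DeltaStar t p] \<one>\<^bsub>R\<^esub>) T"
    proof (rule A1.finsum_cong')
      fix t assume "t \<in> T"
      then have "t \<in> carrier G" using TG by auto
      then show "proj (\<delta> R t p \<otimes>\<^bsub>F\<^esub> \<delta>s R t p) = cls [Delta t p] \<one>\<^bsub>R\<^esub> \<otimes>\<^bsub>A1\<^esub> cls [DeltaStar t p] \<one>\<^bsub>R\<^esub>"
        using p by (simp add: cls_mult \<delta>_mult_monomial) (simp add: cls_def)
    next
      show "(\<lambda>t. cls [Delta t p] \<one>\<^bsub>R\<^esub> \<otimes>\<^bsub>A1\<^esub> cls [DeltaStar t p] \<one>\<^bsub>R\<^esub>) \<in> T \<rightarrow> carrier A1"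
        using TG p by (auto simp: cls_mult cls_closed)
    qed simp
    finally show "finsum A1 (\<lambda>t. cls [Delta t p] \<one>\<^bsub>R\<^esub> \<otimes>\<^bsub>A1\<^esub> cls [DeltaStar t p] \<one>\<^bsub>R\<^esub>) T = \<one>\<^bsub>A1\<^esub>"
      by simp
  qed (simp_all add: cls_closed cls_mult cls_\<delta>_mult)
qed

end

section \<open>The universal property\<close>

context delta_system
begin

definition gen_val :: "('g, 'p) gen \<Rightarrow> 'd" where
  "gen_val x = (case x of Delta g p \<Rightarrow> V g p | DeltaStar g p \<Rightarrow> S g p)"

text \<open>Elements of the free algebra involve nonempty words only. Giving the empty word the
  value 1 makes concatenation multiplicative without a case distinction.\<close>

definition word_val :: "('g, 'p) gen list \<Rightarrow> 'd" where
  "word_val w = foldr (\<lambda>x d. gen_val x \<otimes>\<^bsub>D\<^esub> d) w \<one>\<^bsub>D\<^esub>"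

definition eval :: "(('g, 'p) gen list \<Rightarrow> 'r) \<Rightarrow> 'd" where
  "eval = lin_ext R D (\<lambda>w r. \<rho> r \<otimes>\<^bsub>D\<^esub> word_val w)"

lemma gen_val_closed: "x \<in> X \<Longrightarrow> gen_val x \<in> carrier D"
  by (auto simp: gen_val_def split: gen.split)

lemma \<rho>_gen_val: "\<lbrakk>x \<in> X; r \<in> carrier R\<rbrakk> \<Longrightarrow> gen_val x \<otimes>\<^bsub>D\<^esub> \<rho> r = \<rho> r \<otimes>\<^bsub>D\<^esub> gen_val x"
  by (auto simp: gen_val_def \<rho>_V \<rho>_S split: gen.split)

lemma word_val_simps: "word_val [] = \<one>\<^bsub>D\<^esub>" "word_val (x # w) = gen_val x \<otimes>\<^bsub>D\<^esub> word_val w"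
  by (simp_all add: word_val_def)

lemma word_val_closed: "w \<in> lists X \<Longrightarrow> word_val w \<in> carrier D"
  by (induction w) (auto simp: word_val_simps gen_val_closed)

lemma word_val_append:
  "\<lbrakk>v \<in> lists X; w \<in> lists X\<rbrakk> \<Longrightarrow> word_val (v @ w) = word_val v \<otimes>\<^bsub>D\<^esub> word_val w"
  by (induction v) (auto simp: word_val_simps gen_val_closed word_val_closed D.m_assoc)

lemma \<rho>_word_val:
  assumes "w \<in> lists X" "r \<in> carrier R"
  shows "word_val w \<otimes>\<^bsub>D\<^esub> \<rho> r = \<rho> r \<otimes>\<^bsub>D\<^esub> word_val w"
  using assms(1)
proof (induction w)
  case (Cons x w)
  then have "gen_val x \<otimes>\<^bsub>D\<^esub> word_val w \<otimes>\<^bsub>D\<^esub> \<rho> r = gen_val x \<otimes>\<^bsub>D\<^esub> \<rho> r \<otimes>\<^bsub>D\<^esub> word_val w"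
    using assms(2) by (simp add: gen_val_closed word_val_closed D.m_assoc)
  then show ?case
    using Cons assms(2) by (simp add: word_val_simps \<rho>_gen_val gen_val_closed word_val_closed D.m_assoc)
qed (use assms(2) in \<open>simp add: word_val_simps\<close>)

lemma
  shows eval_closed: "a \<in> fin_supp R W \<Longrightarrow> eval a \<in> carrier D"
    and eval_add: "\<lbrakk>a \<in> fin_supp R W; b \<in> fin_supp R W\<rbrakk> \<Longrightarrow>
      eval (\<lambda>w. a w \<oplus>\<^bsub>R\<^esub> b w) = eval a \<oplus>\<^bsub>D\<^esub> eval b"
    and eval_monomial: "\<lbrakk>w \<in> W; r \<in> carrier R\<rbrakk> \<Longrightarrow> eval (monomial R w r) = \<rho> r \<otimes>\<^bsub>D\<^esub> word_val w"
    and eval_zero: "eval (\<lambda>_. \<zero>\<^bsub>R\<^esub>) = \<zero>\<^bsub>D\<^esub>"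
  unfolding eval_def
  using R.lin_ext_hom[OF D.is_abelian_group, of W "\<lambda>w r. \<rho> r \<otimes>\<^bsub>D\<^esub> word_val w"]
    \<rho>_mult_hom word_val_closed
  by simp_all

lemma eval_hom: "eval \<in> hom (add_monoid F) (add_monoid D)"
  by (auto simp: hom_def R.free_algebra_carrier R.free_algebra_add eval_closed eval_add)

lemma eval_mult:
  assumes a: "a \<in> fin_supp R W" and b: "b \<in> fin_supp R W"
  shows "eval (conv R (@) a b) = eval a \<otimes>\<^bsub>D\<^esub> eval b"
proof (rule R.biadditive_eq[where f = "\<lambda>a b. eval (conv R (@) a b)"
      and g = "\<lambda>a b. eval a \<otimes>\<^bsub>D\<^esub> eval b" and h = "(\<oplus>\<^bsub>D\<^esub>)", OF _ _ _ _ _ _ _ a b])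
  have cl: "conv R (@) a b \<in> fin_supp R W" if "a \<in> fin_supp R W" "b \<in> fin_supp R W" for a b
    using that by (rule R.conv_closed) auto
  fix a a' b assume *: "a \<in> fin_supp R W" "a' \<in> fin_supp R W" "b \<in> fin_supp R W"
  show "eval (conv R (@) (\<lambda>x. a x \<oplus>\<^bsub>R\<^esub> a' x) b) = eval (conv R (@) a b) \<oplus>\<^bsub>D\<^esub> eval (conv R (@) a' b)"
    by (subst R.conv_add_left[OF *]) (intro eval_add cl *)
  show "eval (conv R (@) b (\<lambda>x. a x \<oplus>\<^bsub>R\<^esub> a' x)) = eval (conv R (@) b a) \<oplus>\<^bsub>D\<^esub> eval (conv R (@) b a')"
    by (subst R.conv_add_right[OF *(3,1,2)]) (intro eval_add cl *)
next
  fix v r w s assume *: "v \<in> W" "r \<in> carrier R" "w \<in> W" "s \<in> carrier R"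
  then have cl: "word_val v \<in> carrier D" "word_val w \<in> carrier D" by (auto intro: word_val_closed)
  have "eval (conv R (@) (monomial R v r) (monomial R w s)) =
      \<rho> r \<otimes>\<^bsub>D\<^esub> (\<rho> s \<otimes>\<^bsub>D\<^esub> word_val v) \<otimes>\<^bsub>D\<^esub> word_val w"
    using * cl
    by (simp add: R.conv_monomial eval_monomial word_val_append ring_hom_mult[OF \<rho>_hom] D.m_assoc)
  also have "\<rho> s \<otimes>\<^bsub>D\<^esub> word_val v = word_val v \<otimes>\<^bsub>D\<^esub> \<rho> s"
    using * by (simp add: \<rho>_word_val)
  finally show "eval (conv R (@) (monomial R v r) (monomial R w s)) =
      eval (monomial R v r) \<otimes>\<^bsub>D\<^esub> eval (monomial R w s)"
    using * cl by (simp add: eval_monomial D.m_assoc del: Diff_iff)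
qed (simp_all add: eval_add eval_closed eval_zero D.l_distr D.r_distr R.conv_zero_left R.conv_zero_right)

text \<open>Together with \<open>eval_rscale\<close> this closes the kernel of \<open>eval\<close>
  under both scalar actions, as \<open>algebra_ideal\<close> demands.\<close>

lemma eval_lscale:
  assumes r: "r \<in> carrier R" and a: "a \<in> fin_supp R W"
  shows "eval (lscale R r a) = \<rho> r \<otimes>\<^bsub>D\<^esub> eval a"
proof (rule R.fin_supp_hom_eq[where f = "\<lambda>a. eval (lscale R r a)" and g = "\<lambda>a. \<rho> r \<otimes>\<^bsub>D\<^esub> eval a"
      and h = "(\<oplus>\<^bsub>D\<^esub>)", OF _ _ _ _ a])
  show "eval (lscale R r (\<lambda>_. \<zero>\<^bsub>R\<^esub>)) = \<rho> r \<otimes>\<^bsub>D\<^esub> eval (\<lambda>_. \<zero>\<^bsub>R\<^esub>)"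
    using r by (simp add: lscale_def eval_zero)
  fix w s assume "w \<in> W" "s \<in> carrier R"
  then show "eval (lscale R r (monomial R w s)) = \<rho> r \<otimes>\<^bsub>D\<^esub> eval (monomial R w s)"
    using r by (simp add: R.lscale_monomial eval_monomial ring_hom_mult[OF \<rho>_hom] word_val_closed D.m_assoc)
qed (use r in \<open>simp_all add: R.lscale_add R.lscale_closed eval_add eval_closed D.r_distr\<close>)

lemma eval_rscale:
  assumes r: "r \<in> carrier R" and a: "a \<in> fin_supp R W"
  shows "eval (rscale R a r) = eval a \<otimes>\<^bsub>D\<^esub> \<rho> r"
proof (rule R.fin_supp_hom_eq[where f = "\<lambda>a. eval (rscale R a r)" and g = "\<lambda>a. eval a \<otimes>\<^bsub>D\<^esub> \<rho> r"
      and h = "(\<oplus>\<^bsub>D\<^esub>)", OF _ _ _ _ a])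
  show "eval (rscale R (\<lambda>_. \<zero>\<^bsub>R\<^esub>) r) = eval (\<lambda>_. \<zero>\<^bsub>R\<^esub>) \<otimes>\<^bsub>D\<^esub> \<rho> r"
    using r by (simp add: rscale_def eval_zero)
  fix w s assume "w \<in> W" "s \<in> carrier R"
  then show "eval (rscale R (monomial R w s) r) = eval (monomial R w s) \<otimes>\<^bsub>D\<^esub> \<rho> r"
    using r by (simp add: R.rscale_monomial eval_monomial ring_hom_mult[OF \<rho>_hom] word_val_closed
        D.m_assoc \<rho>_word_val)
qed (use r in \<open>simp_all add: R.rscale_add R.rscale_closed eval_add eval_closed D.l_distr\<close>)

lemma eval_\<delta>: "\<lbrakk>g \<in> carrier G; p \<in> carrier P\<rbrakk> \<Longrightarrow> eval (\<delta> R g p) = V g p"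
  and eval_\<delta>s: "\<lbrakk>g \<in> carrier G; p \<in> carrier P\<rbrakk> \<Longrightarrow> eval (\<delta>s R g p) = S g p"
  by (simp_all add: \<delta>_monomial \<delta>s_monomial eval_monomial ring_hom_one[OF \<rho>_hom] word_val_simps gen_val_def)

lemma eval_F_mult: "\<lbrakk>a \<in> carrier F; b \<in> carrier F\<rbrakk> \<Longrightarrow> eval (a \<otimes>\<^bsub>F\<^esub> b) = eval a \<otimes>\<^bsub>D\<^esub> eval b"
  by (simp add: R.free_algebra_mult R.free_algebra_carrier eval_mult)

text \<open>The two relations that are not axioms of \<open>delta_system\<close> are supplied by
  \<open>S_mult\<close> and \<open>S_one\<close>.\<close>

lemma eval_relation:
  assumes "(a, b) \<in> E"
  shows "eval a = eval b"
  using assms unfolding all_delta_relations_def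
proof (elim insertE)
  assume "(a, b) \<in> delta_relations R P G \<theta>"
  then show ?thesis
  proof (cases rule: delta_relations.cases)
    case (sum_over_cosets p T)
    note TG = transversal_subset[OF sum_over_cosets(4)]
    have "eval b = finsum D (\<lambda>t. eval (\<delta> R t p \<otimes>\<^bsub>F\<^esub> \<delta>s R t p)) T"
      unfolding sum_over_cosets
      by (rule hom_finsum[OF F.abelian_group_axioms D.is_abelian_group eval_hom])
        (use TG sum_over_cosets in \<open>auto intro!: F.m_closed \<delta>_closed \<delta>s_closed\<close>)
    also have "\<dots> = finsum D (\<lambda>t. V t p \<otimes>\<^bsub>D\<^esub> S t p) T"
      by (rule D.finsum_cong')
        (use TG sum_over_cosets in \<open>auto simp: eval_F_mult \<delta>_closed \<delta>s_closed eval_\<delta> eval_\<delta>s\<close>)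
    also have "\<dots> = eval a"
      using sum_over_cosets by (simp add: V_S_sum eval_\<delta> V_one)
    finally show ?thesis ..
  next
    case (star_delta_other_coset g h p)
    then show ?thesis
      using S_V_other[of g h p]
      by (simp add: eval_F_mult \<delta>_closed \<delta>s_closed eval_\<delta> eval_\<delta>s in_coset_def R.free_algebra_zero eval_zero)
  next
    case (star_delta_same_coset g h p k)
    then show ?thesis
      using S_V_same[of g p k] by (simp add: eval_F_mult \<delta>_closed \<delta>s_closed eval_\<delta> eval_\<delta>s)
  qed (simp_all add: eval_F_mult \<delta>_closed \<delta>s_closed eval_\<delta> eval_\<delta>s V_mult S_mult)
qed (simp add: delta_unit_relation_def eval_\<delta> eval_\<delta>s S_one V_one)

interpretation eval: group_hom "add_monoid F" "add_monoid D" eval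
  by (rule group_hom.intro[OF F.a_group D.a_group group_hom_axioms.intro[OF eval_hom]])

text \<open>Since the relation ideal is the least one containing the relations, this reduces the
  vanishing of \<open>eval\<close> on it to \<open>eval_relation\<close>.\<close>

lemma eval_kernel_ideal: "algebra_ideal R X (kernel (add_monoid F) (add_monoid D) eval)"
  unfolding algebra_ideal_def kernel_def
proof (intro conjI ballI)
  show "additive_subgroup {x \<in> carrier (add_monoid F). eval x = \<one>\<^bsub>add_monoid D\<^esub>} F"
    using eval.subgroup_kernel unfolding kernel_def by (rule additive_subgroupI)
qed (auto simp: eval_F_mult F.m_closed eval_lscale eval_rscale R.lscale_closed R.rscale_closed
    eval_closed R.free_algebra_carrier F.m_closed[unfolded R.free_algebra_carrier]
    eval_F_mult[unfolded R.free_algebra_carrier])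

lemma eval_ideal:
  assumes "a \<in> I"
  shows "eval a = \<zero>\<^bsub>D\<^esub>"
proof -
  have "I \<subseteq> kernel (add_monoid F) (add_monoid D) eval"
  proof (rule relation_ideal_least[OF eval_kernel_ideal])
    fix a b assume ab: "(a, b) \<in> E"
    note cl = relations_closed[OF ab]
    have "eval (a \<ominus>\<^bsub>F\<^esub> b) = eval a \<oplus>\<^bsub>D\<^esub> eval (\<ominus>\<^bsub>F\<^esub> b)"
      using hom_mult[OF eval_hom, of a "\<ominus>\<^bsub>F\<^esub> b"] cl by (simp add: a_minus_def)
    also have "\<dots> = \<zero>\<^bsub>D\<^esub>"
      using eval.hom_inv[of b, folded a_inv_def] eval.hom_closed[of b] cl eval_relation[OF ab]
      by (simp add: D.r_neg)
    finally show "a \<ominus>\<^bsub>F\<^esub> b \<in> kernel (add_monoid F) (add_monoid D) eval"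
      using cl by (simp add: kernel_def)
  qed
  then show ?thesis using assms by (auto simp: kernel_def)
qed

lemma induced_hom:
  obtains f where "f \<in> nondegenerate_homs A D"
    "\<And>a. a \<in> carrier F \<Longrightarrow> f (proj a) = eval a"
proof -
  \<comment> \<open>Any representative of the coset will do, since \<open>eval\<close> vanishes on
    the ideal.\<close>
  define f where "f = (\<lambda>Y\<in>carrier A. eval (SOME a. a \<in> Y))"
  have f: "f (proj a) = eval a" if a: "a \<in> carrier F" for a
  proof -
    have "(SOME b. b \<in> proj a) \<in> proj a" using someI[of "\<lambda>b. b \<in> proj a", OF Q.J.a_rcos_self[OF a]] .
    then obtain i where i: "i \<in> I" "(SOME b. b \<in> proj a) = i \<oplus>\<^bsub>F\<^esub> a"
      by (auto simp: a_r_coset_def')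
    then have "eval (SOME b. b \<in> proj a) = eval a"
      using hom_mult[OF eval_hom, of i a] eval.hom_closed[of a] a by (simp add: eval_ideal)
    then show ?thesis using a by (simp add: f_def proj_closed)
  qed
  have ev: "eval a \<in> carrier D" if "a \<in> carrier F" for a
    using eval.hom_closed[of a] that by simp
  have eval_F_add: "eval (a \<oplus>\<^bsub>F\<^esub> b) = eval a \<oplus>\<^bsub>D\<^esub> eval b" if "a \<in> carrier F" "b \<in> carrier F" for a b
    using that hom_mult[OF eval_hom, of a b] by simp
  have "f \<in> hom (add_monoid A) (add_monoid D)"
    by (auto simp: hom_def A_carrier f eval_F_add ev simp flip: proj_add)
  moreover have "f \<in> hom A D"
    by (auto simp: hom_def A_carrier f ev F.m_closed eval_F_mult simp flip: proj_mult)
  moreover have "generate (add_monoid D) {f a \<otimes>\<^bsub>D\<^esub> b | a b. a \<in> carrier A \<and> b \<in> carrier D} = carrier D"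
  proof
    have fc: "f a \<in> carrier D" if "a \<in> carrier A" for a
      using that ev by (auto simp: A_carrier f)
    then have "{f a \<otimes>\<^bsub>D\<^esub> b | a b. a \<in> carrier A \<and> b \<in> carrier D} \<subseteq> carrier (add_monoid D)"
      by auto
    then show "generate (add_monoid D) {f a \<otimes>\<^bsub>D\<^esub> b | a b. a \<in> carrier A \<and> b \<in> carrier D} \<subseteq> carrier D"
      using group.generate_incl[OF D.a_group] by auto
    show "carrier D \<subseteq> generate (add_monoid D) {f a \<otimes>\<^bsub>D\<^esub> b | a b. a \<in> carrier A \<and> b \<in> carrier D}"
    proof
      fix d assume d: "d \<in> carrier D"
      \<comment> \<open>\<open>\<delta>\<^sub>1\<^sub>,\<^sub>1\<close> is sent to 1, so every
        \<open>d\<close> is itself one of the products that have to generate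
        \<open>D\<close>.\<close>
      have u: "\<delta> R \<one>\<^bsub>G\<^esub> \<one>\<^bsub>P\<^esub> \<in> carrier F" by (simp add: \<delta>_closed)
      have "f (proj (\<delta> R \<one>\<^bsub>G\<^esub> \<one>\<^bsub>P\<^esub>)) \<otimes>\<^bsub>D\<^esub> d = d"
        using d by (simp add: f[OF u] eval_\<delta> V_one)
      then show "d \<in> generate (add_monoid D) {f a \<otimes>\<^bsub>D\<^esub> b | a b. a \<in> carrier A \<and> b \<in> carrier D}"
        using d proj_closed[OF u] by (intro generate.incl) (auto intro!: exI)
    qed
  qed
  ultimately have "f \<in> nondegenerate_homs A D"
    by (simp add: nondegenerate_homs_def f_def)
  then show thesis using f that by blast
qed

text \<open>Applied to the system of \<open>A_system\<close>, this turns every unital homomorphism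
  out of the presented algebra into a system in its target.\<close>

lemma ring_hom_system:
  assumes B: "ring B" and f: "f \<in> ring_hom D B"
  shows "delta_system R P G \<theta> B (\<lambda>r. f (\<rho> r)) (\<lambda>g p. f (V g p)) (\<lambda>g p. f (S g p))"
proof -
  interpret B: ring B by fact
  note fm = ring_hom_mult[OF f] and fc = ring_hom_closed[OF f]
  have f0: "f \<zero>\<^bsub>D\<^esub> = \<zero>\<^bsub>B\<^esub>" by (rule ring_hom_zero[OF f D.ring_axioms B])
  have f_hom: "f \<in> hom (add_monoid D) (add_monoid B)"
    using fc ring_hom_add[OF f] by (auto simp: hom_def)
  show ?thesis
  proof unfold_locales
    show "(\<lambda>r. f (\<rho> r)) \<in> ring_hom R B"
      using ring_hom_trans[OF \<rho>_hom f] by (simp add: comp_def)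
  next
    fix p T assume p: "p \<in> carrier P" and T: "left_transversal G (\<theta> p ` carrier G) T"
    note TG = transversal_subset[OF T]
    have "finsum B (\<lambda>t. f (V t p) \<otimes>\<^bsub>B\<^esub> f (S t p)) T = finsum B (\<lambda>t. f (V t p \<otimes>\<^bsub>D\<^esub> S t p)) T"
      by (rule B.finsum_cong') (use TG p in \<open>auto simp: fm fc\<close>)
    also have "\<dots> = f (finsum D (\<lambda>t. V t p \<otimes>\<^bsub>D\<^esub> S t p) T)"
      by (rule hom_finsum[symmetric, OF D.is_abelian_group B.is_abelian_group f_hom]) (use TG p in auto)
    finally show "finsum B (\<lambda>t. f (V t p) \<otimes>\<^bsub>B\<^esub> f (S t p)) T = \<one>\<^bsub>B\<^esub>"
      using V_S_sum[OF p T] ring_hom_one[OF f] by simp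
  qed (simp_all add: fc \<rho>_V \<rho>_S V_mult S_V_same S_V_other V_one f0 ring_hom_one[OF f] flip: fm)
qed

end

section \<open>The universal representation and representability\<close>

context endo_action
begin

interpretation A: delta_system R P G \<theta> A1 "cls unit" "\<lambda>g p. cls [Delta g p] \<one>\<^bsub>R\<^esub>"
  "\<lambda>g p. cls [DeltaStar g p] \<one>\<^bsub>R\<^esub>"
  by (rule A_system)

text \<open>\<open>delta_rep\<close> is split into an additive map \<open>s\<close> to the free
  algebra followed by the quotient map, which makes its additivity and its values on monomials
  accessible.\<close>

lemma delta_rep_sum:
  assumes p: "p \<in> carrier P"
  defines "s \<equiv> lin_ext R F (\<lambda>g r. lscale R r (\<delta> R g p))"
  shows delta_rep_eq: "x \<in> FG \<Longrightarrow> delta_rep R P G \<theta> p x = proj (s x)"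
    and delta_rep_sum_closed: "x \<in> FG \<Longrightarrow> s x \<in> carrier F"
    and delta_rep_sum_add: "\<lbrakk>x \<in> FG; y \<in> FG\<rbrakk> \<Longrightarrow> s (\<lambda>g. x g \<oplus>\<^bsub>R\<^esub> y g) = s x \<oplus>\<^bsub>F\<^esub> s y"
    and delta_rep_sum_monomial: "\<lbrakk>g \<in> carrier G; r \<in> carrier R\<rbrakk> \<Longrightarrow>
      s (monomial R g r) = monomial R [Delta g p] r"
    and delta_rep_sum_zero: "s (\<lambda>_. \<zero>\<^bsub>R\<^esub>) = \<zero>\<^bsub>F\<^esub>"
proof -
  have hom: "(\<lambda>r. lscale R r (\<delta> R g p)) \<in> hom (add_monoid R) (add_monoid F)" if "g \<in> carrier G" for g
    using that p
    by (auto simp: hom_def \<delta>_monomial R.lscale_monomial R.monomial_add monomial_closed R.free_algebra_add)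
  note ext = R.lin_ext_hom[OF F.abelian_group_axioms, of "carrier G" "\<lambda>g r. lscale R r (\<delta> R g p)", OF hom]
  show "x \<in> FG \<Longrightarrow> delta_rep R P G \<theta> p x = proj (s x)"
    using p by (simp add: delta_rep_def s_def lin_ext_def)
  show "x \<in> FG \<Longrightarrow> s x \<in> carrier F"
    "\<lbrakk>x \<in> FG; y \<in> FG\<rbrakk> \<Longrightarrow> s (\<lambda>g. x g \<oplus>\<^bsub>R\<^esub> y g) = s x \<oplus>\<^bsub>F\<^esub> s y"
    "s (\<lambda>_. \<zero>\<^bsub>R\<^esub>) = \<zero>\<^bsub>F\<^esub>"
    unfolding s_def using ext by simp_all
  show "\<lbrakk>g \<in> carrier G; r \<in> carrier R\<rbrakk> \<Longrightarrow> s (monomial R g r) = monomial R [Delta g p] r"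
    unfolding s_def using ext(3)[of g r] by (simp add: \<delta>_monomial R.lscale_monomial)
qed

text \<open>Serves both directions: it computes the representation obtained from a homomorphism, and
  it checks that the homomorphism built from \<nu> gives back \<nu>.\<close>

lemma delta_rep_hom_eq:
  assumes p: "p \<in> carrier P" and B: "abelian_group B" and f: "f \<in> hom (add_monoid A) (add_monoid B)"
    and g_add: "\<And>x y. \<lbrakk>x \<in> FG; y \<in> FG\<rbrakk> \<Longrightarrow> g (\<lambda>h. x h \<oplus>\<^bsub>R\<^esub> y h) = g x \<oplus>\<^bsub>B\<^esub> g y"
    and g_zero: "g (\<lambda>_. \<zero>\<^bsub>R\<^esub>) = \<zero>\<^bsub>B\<^esub>"
    and eq: "\<And>h r. \<lbrakk>h \<in> carrier G; r \<in> carrier R\<rbrakk> \<Longrightarrow> f (cls [Delta h p] r) = g (monomial R h r)"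
    and x: "x \<in> FG"
  shows "f (delta_rep R P G \<theta> p x) = g x"
proof (rule R.fin_supp_hom_eq[where f = "\<lambda>x. f (delta_rep R P G \<theta> p x)" and g = g
      and h = "(\<oplus>\<^bsub>B\<^esub>)", OF _ g_add _ _ x])
  interpret A: nonunital_ring A by (rule A_nonunital_ring)
  note s = delta_rep_sum[OF p]
  fix a b assume "a \<in> FG" "b \<in> FG"
  then show "f (delta_rep R P G \<theta> p (\<lambda>x. a x \<oplus>\<^bsub>R\<^esub> b x)) =
      f (delta_rep R P G \<theta> p a) \<oplus>\<^bsub>B\<^esub> f (delta_rep R P G \<theta> p b)"
    using hom_mult[OF f] by (simp add: s R.fin_supp_add proj_add proj_closed)
next
  fix h r assume "h \<in> carrier G" "r \<in> carrier R"
  then show "f (delta_rep R P G \<theta> p (monomial R h r)) = g (monomial R h r)"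
    using eq by (simp add: delta_rep_sum[OF p] R.fin_supp_monomial cls_def)
next
  interpret A: nonunital_ring A by (rule A_nonunital_ring)
  show "f (delta_rep R P G \<theta> p (\<lambda>_. \<zero>\<^bsub>R\<^esub>)) = g (\<lambda>_. \<zero>\<^bsub>R\<^esub>)"
    using add_hom_zero[OF A.abelian_group_axioms B f]
      add_hom_zero[OF F.abelian_group_axioms A.abelian_group_axioms proj_hom]
    by (simp add: delta_rep_sum[OF p] R.fin_supp_zero g_zero)
qed

lemma cls_factor: "\<lbrakk>w \<in> W; r \<in> carrier R\<rbrakk> \<Longrightarrow> cls w r = cls unit r \<otimes>\<^bsub>A\<^esub> cls w \<one>\<^bsub>R\<^esub>"
  by (simp add: cls_coeff)

text \<open>The composite with the universal representation is the representation of the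
  pushed-forward system, hence covariant by \<open>rep_covariant\<close>.\<close>

lemma ring_hom_delta_rep:
  fixes B :: "'b ring"
  assumes B: "ring B" and f: "f \<in> ring_hom A1 B" and p: "p \<in> carrier P" and x: "x \<in> FG"
  shows "f (delta_rep R P G \<theta> p x) =
    delta_system.rep R B (\<lambda>r. f (cls unit r)) (\<lambda>g p. f (cls [Delta g p] \<one>\<^bsub>R\<^esub>)) p x"
proof -
  interpret B: ring B by fact
  interpret S: delta_system R P G \<theta> B "\<lambda>r. f (cls unit r)" "\<lambda>g p. f (cls [Delta g p] \<one>\<^bsub>R\<^esub>)"
    "\<lambda>g p. f (cls [DeltaStar g p] \<one>\<^bsub>R\<^esub>)"
    by (rule A.ring_hom_system[OF B f])
  show ?thesis
  proof (rule delta_rep_hom_eq[OF p B.is_abelian_group _ _ _ _ x])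
    show "f \<in> hom (add_monoid A) (add_monoid B)"
      using ring_hom_closed[OF f] ring_hom_add[OF f] by (auto simp: hom_def)
    fix h r assume "h \<in> carrier G" "r \<in> carrier R"
    then show "f (cls [Delta h p] r) = S.rep p (monomial R h r)"
      using p ring_hom_mult[OF f, of "cls unit r" "cls [Delta h p] \<one>\<^bsub>R\<^esub>"] cls_factor[of "[Delta h p]" r]
      by (simp add: S.rep_monomial cls_closed)
  qed (use p in \<open>simp_all add: S.rep_add S.rep_zero\<close>)
qed

text \<open>Equality on the universal representation settles the \<open>\<delta>\<close> and the
  scalars. The \<open>\<delta>\<^sup>*\<close> follow by cancellation, and then all words and their
  combinations.\<close>

lemma ring_hom_unique:
  fixes B :: "'b ring"
  assumes B: "ring B" and f: "f \<in> ring_hom A1 B" and f': "f' \<in> ring_hom A1 B"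
    and eq: "\<And>p x. \<lbrakk>p \<in> carrier P; x \<in> FG\<rbrakk> \<Longrightarrow> f (delta_rep R P G \<theta> p x) = f' (delta_rep R P G \<theta> p x)"
    and Y: "Y \<in> carrier A"
  shows "f Y = f' Y"
proof -
  interpret B: ring B by fact
  interpret S: delta_system R P G \<theta> B "\<lambda>r. f (cls unit r)" "\<lambda>g p. f (cls [Delta g p] \<one>\<^bsub>R\<^esub>)"
    "\<lambda>g p. f (cls [DeltaStar g p] \<one>\<^bsub>R\<^esub>)"
    by (rule A.ring_hom_system[OF B f])
  interpret S': delta_system R P G \<theta> B "\<lambda>r. f' (cls unit r)" "\<lambda>g p. f' (cls [Delta g p] \<one>\<^bsub>R\<^esub>)"
    "\<lambda>g p. f' (cls [DeltaStar g p] \<one>\<^bsub>R\<^esub>)"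
    by (rule A.ring_hom_system[OF B f'])
  have \<Delta>: "f (cls [Delta g p] r) = f' (cls [Delta g p] r)"
    if "g \<in> carrier G" "p \<in> carrier P" "r \<in> carrier R" for g p r
    using eq[of p "monomial R g r"] that by (simp add: delta_rep_sum[OF that(2)] R.fin_supp_monomial cls_def)
  \<comment> \<open>By relation (2), the products with the images of the
    \<open>\<delta>\<^sub>h\<^sub>,\<^sub>p\<close> are 0 or the image of some
    \<open>\<delta>\<^sub>k\<^sub>,\<^sub>1\<close>, where the two maps already agree.\<close>
  have \<Delta>s: "f (cls [DeltaStar g p] \<one>\<^bsub>R\<^esub>) = f' (cls [DeltaStar g p] \<one>\<^bsub>R\<^esub>)"
    if g: "g \<in> carrier G" and p: "p \<in> carrier P" for g p
  proof (rule S.cancel_V[OF p])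
    fix h assume h: "h \<in> carrier G"
    show "f (cls [DeltaStar g p] \<one>\<^bsub>R\<^esub>) \<otimes>\<^bsub>B\<^esub> f (cls [Delta h p] \<one>\<^bsub>R\<^esub>) =
        f' (cls [DeltaStar g p] \<one>\<^bsub>R\<^esub>) \<otimes>\<^bsub>B\<^esub> f (cls [Delta h p] \<one>\<^bsub>R\<^esub>)"
    proof (cases "in_coset p g h")
      case True
      then obtain k where k: "k \<in> carrier G" "h = g \<otimes>\<^bsub>G\<^esub> \<theta> p k" by (auto simp: in_coset_def)
      then show ?thesis
        using S.S_V_same[OF g p k(1)] S'.S_V_same[OF g p k(1)] h p by (simp add: \<Delta> g)
    next
      case False
      then show ?thesis
        using S.S_V_other[OF g h p] S'.S_V_other[OF g h p] h p by (simp add: \<Delta>)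
    qed
  qed (use g p in simp_all)
  have gen: "f (cls [x] \<one>\<^bsub>R\<^esub>) = f' (cls [x] \<one>\<^bsub>R\<^esub>)" if "x \<in> X" for x
    using that by (cases x) (simp_all add: \<Delta> \<Delta>s)
  have word: "f (cls w \<one>\<^bsub>R\<^esub>) = f' (cls w \<one>\<^bsub>R\<^esub>)" if "w \<noteq> []" "w \<in> lists X" for w
    using that
  proof (induction w rule: list_nonempty_induct)
    case (single x)
    then show ?case using gen by simp
  next
    case (cons x w)
    then have "cls (x # w) \<one>\<^bsub>R\<^esub> = cls [x] \<one>\<^bsub>R\<^esub> \<otimes>\<^bsub>A1\<^esub> cls w \<one>\<^bsub>R\<^esub>"
      and "cls [x] \<one>\<^bsub>R\<^esub> \<in> carrier A1" "cls w \<one>\<^bsub>R\<^esub> \<in> carrier A1"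
      by (simp_all add: cls_mult cls_closed)
    then show ?case
      using cons gen ring_hom_mult[OF f] ring_hom_mult[OF f'] by simp
  qed
  have mono: "f (proj (monomial R w r)) = f' (proj (monomial R w r))" if w: "w \<in> W" and r: "r \<in> carrier R" for w r
  proof -
    have c: "cls w r = cls unit r \<otimes>\<^bsub>A1\<^esub> cls w \<one>\<^bsub>R\<^esub>" "cls unit r \<in> carrier A1" "cls w \<one>\<^bsub>R\<^esub> \<in> carrier A1"
      using cls_factor[OF w r] cls_closed[OF w R.one_closed] cls_closed[OF unit_word r] by simp_all
    have "f (cls w r) = f' (cls w r)"
      using c ring_hom_mult[OF f] ring_hom_mult[OF f'] word[of w] w r by (simp add: \<Delta>)
    then show ?thesis by (simp add: cls_def)
  qed
  obtain a where a: "a \<in> fin_supp R W" "Y = proj a" using Y by (auto simp: A_carrier R.free_algebra_carrier)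
  have hom: "h \<in> hom (add_monoid A1) (add_monoid B)" if "h \<in> ring_hom A1 B" for h
    using ring_hom_closed[OF that] ring_hom_add[OF that] by (auto simp: hom_def)
  have padd: "h (proj (\<lambda>x. a x \<oplus>\<^bsub>R\<^esub> b x)) = h (proj a) \<oplus>\<^bsub>B\<^esub> h (proj b)"
    if "h \<in> ring_hom A1 B" "a \<in> fin_supp R W" "b \<in> fin_supp R W" for h a b
    using ring_hom_add[OF that(1), of "proj a" "proj b"] proj_add[of a b] that
    by (simp add: R.free_algebra_carrier R.free_algebra_add proj_closed)
  have "f (proj a) = f' (proj a)"
  proof (rule R.fin_supp_hom_eq[where f = "\<lambda>a. f (proj a)" and g = "\<lambda>a. f' (proj a)" and h = "(\<oplus>\<^bsub>B\<^esub>)",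
        OF padd[OF f] padd[OF f'] mono _ a(1)])
    show "f (proj (\<lambda>_. \<zero>\<^bsub>R\<^esub>)) = f' (proj (\<lambda>_. \<zero>\<^bsub>R\<^esub>))"
      using mono[OF unit_word R.zero_closed] by (simp add: R.monomial_zero)
  qed
  then show ?thesis using a by simp
qed

text \<open>1_1 is the unit of \<open>F\<^sub>1\<close>, so its image fixes all
  \<open>\<nu>\<^sub>1(x)\<close>. Surjectivity of
  \<open>F\<^sub>1 \<otimes> D \<rightarrow> D\<close> extends this to \<open>D\<close>.\<close>

lemma covariant_rep_left_unit:
  assumes D: "nonunital_ring D" and \<nu>: "\<nu> \<in> covariant_reps diagram D" and d: "d \<in> carrier D"
  shows "\<nu> \<one>\<^bsub>P\<^esub> (single R \<one>\<^bsub>G\<^esub>) \<in> carrier D" "\<nu> \<one>\<^bsub>P\<^esub> (single R \<one>\<^bsub>G\<^esub>) \<otimes>\<^bsub>D\<^esub> d = d"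
proof -
  interpret D: nonunital_ring D by fact
  let ?e = "\<nu> \<one>\<^bsub>P\<^esub> (single R \<one>\<^bsub>G\<^esub>)"
  let ?ls = "\<lambda>s d. \<nu> \<one>\<^bsub>P\<^esub> s \<otimes>\<^bsub>D\<^esub> d"
  have hom: "\<nu> \<one>\<^bsub>P\<^esub> \<in> hom (add_monoid (fibre diagram \<one>\<^bsub>P\<^esub>)) (add_monoid D)"
    using \<nu> unfolding covariant_reps_def diagram_simps by (auto simp: PiE_iff)
  have cl: "\<nu> \<one>\<^bsub>P\<^esub> x \<in> carrier D" if "x \<in> FG" for x
    using hom_in_carrier[OF hom] that by (simp add: diagram_simps)
  have sG: "single R \<one>\<^bsub>G\<^esub> \<in> FG" by (simp add: single_eq_monomial R.fin_supp_monomial)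
  then show e: "?e \<in> carrier D" by (rule cl)
  have e_mult: "?e \<otimes>\<^bsub>D\<^esub> \<nu> \<one>\<^bsub>P\<^esub> x = \<nu> \<one>\<^bsub>P\<^esub> x" if x: "x \<in> FG" for x
  proof -
    have "?e \<otimes>\<^bsub>D\<^esub> \<nu> \<one>\<^bsub>P\<^esub> x = \<nu> \<one>\<^bsub>P\<^esub> (pair \<one>\<^bsub>P\<^esub> (single R \<one>\<^bsub>G\<^esub>) x)"
      using \<nu> sG x unfolding covariant_reps_def diagram_simps by simp
    also have "pair \<one>\<^bsub>P\<^esub> (single R \<one>\<^bsub>G\<^esub>) x = x"
    proof (rule R.fin_supp_hom_eq[where f = "pair \<one>\<^bsub>P\<^esub> (single R \<one>\<^bsub>G\<^esub>)" and g = "\<lambda>x. x"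
          and h = "\<lambda>a b g. a g \<oplus>\<^bsub>R\<^esub> b g", OF R.conv_add_right[OF sG] _ _ _ x])
      fix g r assume "g \<in> carrier G" "r \<in> carrier R"
      then show "pair \<one>\<^bsub>P\<^esub> (single R \<one>\<^bsub>G\<^esub>) (monomial R g r) = monomial R g r"
        by (simp add: single_eq_monomial R.conv_monomial \<theta>_id)
    qed (auto simp: R.conv_zero_right)
    finally show ?thesis .
  qed
  interpret M: abelian_group "fibre diagram \<one>\<^bsub>P\<^esub>" by (rule fibre_abelian_group)
  interpret X: tensor_factors "base_ring diagram" "fibre diagram \<one>\<^bsub>P\<^esub>" "pair \<one>\<^bsub>P\<^esub>" D ?ls
    by unfold_locales (auto simp: diagram_simps pair_closed cl D.m_closed)
  obtain \<phi> where \<phi>: "\<phi> \<in> iso X.T (add_monoid D)"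
    and \<phi>_elem: "\<And>x d. \<lbrakk>x \<in> FG; d \<in> carrier D\<rbrakk> \<Longrightarrow> \<phi> (X.elem x d) = \<nu> \<one>\<^bsub>P\<^esub> x \<otimes>\<^bsub>D\<^esub> d"
    using \<nu> P.one_closed unfolding covariant_reps_def diagram_simps Let_def by blast
  have \<phi>_hom: "\<phi> \<in> hom X.T (add_monoid D)" and \<phi>_surj: "\<phi> ` carrier X.T = carrier D"
    using \<phi> by (auto simp: iso_def bij_betw_def)
  have "d \<in> \<phi> ` carrier X.T" unfolding \<phi>_surj by (rule d)
  then obtain \<tau> where \<tau>: "d = \<phi> \<tau>" "\<tau> \<in> carrier X.T" by (rule imageE)
  have "?e \<otimes>\<^bsub>D\<^esub> \<phi> \<tau> = \<phi> \<tau>"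
  proof (rule X.tensor_hom_eq[OF D.a_group _ \<phi>_hom _ \<tau>(2)])
    show "(\<lambda>\<tau>. ?e \<otimes>\<^bsub>D\<^esub> \<phi> \<tau>) \<in> hom X.T (add_monoid D)"
      using hom_in_carrier[OF \<phi>_hom] hom_mult[OF \<phi>_hom] e by (auto simp: hom_def D.r_distr D.m_closed)
  qed (use e e_mult cl in \<open>simp add: diagram_simps \<phi>_elem flip: D.m_assoc\<close>)
  then show "?e \<otimes>\<^bsub>D\<^esub> d = d" using \<tau>(1) by simp
qed

lemma nondegenerate_hom_unital:
  assumes D: "local_unit_ring D" and f: "f \<in> nondegenerate_homs A D"
  defines "D1 \<equiv> D\<lparr>one := f (cls unit \<one>\<^bsub>R\<^esub>)\<rparr>"
  shows "ring D1" "f \<in> ring_hom A1 D1"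
proof -
  let ?e = "f (cls unit \<one>\<^bsub>R\<^esub>)"
  interpret D: nonunital_ring D using D by (simp add: local_unit_ring_def)
  have fa: "f \<in> hom (add_monoid A) (add_monoid D)" and fm: "f \<in> hom A D"
    and gen: "generate (add_monoid D) {f a \<otimes>\<^bsub>D\<^esub> b | a b. a \<in> carrier A \<and> b \<in> carrier D} = carrier D"
    using f by (auto simp: nondegenerate_homs_def)
  have c: "cls unit \<one>\<^bsub>R\<^esub> \<in> carrier A" by (rule cls_closed[OF unit_word R.one_closed])
  have e: "?e \<in> carrier D" using hom_in_carrier[OF fm c] .
  have "?e \<otimes>\<^bsub>D\<^esub> d = d" if "d \<in> carrier D" for d
  proof -
    \<comment> \<open>The elements fixed by \<open>?e\<close> form an additive subgroup. It contains
      the products \<open>f a \<otimes> b\<close>, and by nondegeneracy these generate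
      everything.\<close>
    have "subgroup {d \<in> carrier D. ?e \<otimes>\<^bsub>D\<^esub> d = d} (add_monoid D)"
    proof (rule group.subgroupI[OF D.a_group])
      show "{d \<in> carrier D. ?e \<otimes>\<^bsub>D\<^esub> d = d} \<noteq> {}" using e D.m_zero by blast
      fix a assume a: "a \<in> {d \<in> carrier D. ?e \<otimes>\<^bsub>D\<^esub> d = d}"
      have "?e \<otimes>\<^bsub>D\<^esub> (\<ominus>\<^bsub>D\<^esub> a) \<oplus>\<^bsub>D\<^esub> a = \<zero>\<^bsub>D\<^esub>"
        using a e D.r_distr[of "\<ominus>\<^bsub>D\<^esub> a" a ?e] by (simp add: D.l_neg D.m_zero)
      then have "?e \<otimes>\<^bsub>D\<^esub> (\<ominus>\<^bsub>D\<^esub> a) = \<ominus>\<^bsub>D\<^esub> a"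
        using D.minus_equality[of "?e \<otimes>\<^bsub>D\<^esub> (\<ominus>\<^bsub>D\<^esub> a)" a] a e by (simp add: D.m_closed)
      then show "inv\<^bsub>add_monoid D\<^esub> a \<in> {d \<in> carrier D. ?e \<otimes>\<^bsub>D\<^esub> d = d}"
        using a by (simp flip: a_inv_def)
    qed (use e in \<open>auto simp: D.r_distr\<close>)
    moreover have "{f a \<otimes>\<^bsub>D\<^esub> b | a b. a \<in> carrier A \<and> b \<in> carrier D} \<subseteq> {d \<in> carrier D. ?e \<otimes>\<^bsub>D\<^esub> d = d}"
    proof clarify
      fix a b assume a: "a \<in> carrier A" and b: "b \<in> carrier D"
      have fD: "f a \<in> carrier D" using hom_in_carrier[OF fm a] .
      have "?e \<otimes>\<^bsub>D\<^esub> f a = f (cls unit \<one>\<^bsub>R\<^esub> \<otimes>\<^bsub>A\<^esub> a)" using hom_mult[OF fm c a] by simp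
      also have "cls unit \<one>\<^bsub>R\<^esub> \<otimes>\<^bsub>A\<^esub> a = a" using A.D.l_one[of a] a by simp
      finally show "f a \<otimes>\<^bsub>D\<^esub> b \<in> carrier D \<and> ?e \<otimes>\<^bsub>D\<^esub> (f a \<otimes>\<^bsub>D\<^esub> b) = f a \<otimes>\<^bsub>D\<^esub> b"
        using D.m_assoc[OF e fD b] D.m_closed[OF fD b] by simp
    qed
    ultimately have "generate (add_monoid D) {f a \<otimes>\<^bsub>D\<^esub> b | a b. a \<in> carrier A \<and> b \<in> carrier D}
        \<subseteq> {d \<in> carrier D. ?e \<otimes>\<^bsub>D\<^esub> d = d}"
      by (intro group.generate_subgroup_incl[OF D.a_group])
    then show ?thesis using that unfolding gen by blast
  qed
  then show "ring D1" unfolding D1_def by (rule local_unit_ring_left_unit[OF D e])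
  show "f \<in> ring_hom A1 D1"
    unfolding D1_def
    using hom_in_carrier[OF fm] hom_mult[OF fm] hom_mult[OF fa] by (intro ring_hom_memI) simp_all
qed

lemma delta_rep_covariant: "delta_rep R P G \<theta> \<in> covariant_reps diagram A"
proof -
  have "delta_rep R P G \<theta> = (\<lambda>p\<in>carrier P. \<lambda>x\<in>FG. A.rep p x)"
  proof (rule extensionalityI[of _ "carrier P"])
    show "delta_rep R P G \<theta> \<in> extensional (carrier P)" by (simp add: delta_rep_def)
    fix p assume p: "p \<in> carrier P"
    show "delta_rep R P G \<theta> p = (\<lambda>p\<in>carrier P. \<lambda>x\<in>FG. A.rep p x) p"
    proof (rule extensionalityI[of _ FG])
      show "delta_rep R P G \<theta> p \<in> extensional FG" using p by (simp add: delta_rep_def)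
      fix x assume x: "x \<in> FG"
      show "delta_rep R P G \<theta> p x = (\<lambda>p\<in>carrier P. \<lambda>x\<in>FG. A.rep p x) p x"
        \<comment> \<open>For the identity homomorphism the pushed-forward system is the system of
          \<open>A_system\<close> itself.\<close>
        using ring_hom_delta_rep[OF A1_ring id_ring_hom p x] p x by simp
    qed (use p in simp)
  qed simp
  then show ?thesis
    using A.rep_covariant by (simp only: covariant_reps_update_one)
qed

lemma covariance_ring:
  "is_covariance_ring TYPE('d) diagram A (delta_rep R P G \<theta>)"
  unfolding is_covariance_ring_def diagram_simps
proof (intro conjI allI impI)
  let ?u = "delta_rep R P G \<theta>"
  show "local_unit_ring A"
    using A_nonunital_ring ring_has_local_units[OF A1_ring] by (simp add: local_unit_ring_def)
  show "?u \<in> covariant_reps diagram A" by (rule delta_rep_covariant)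
  fix D :: "'d ring" assume D: "local_unit_ring D"
  then have Dn: "nonunital_ring D" by (simp add: local_unit_ring_def)
  let ?\<Phi> = "\<lambda>f. \<lambda>p\<in>carrier P. \<lambda>x\<in>FG. f (?u p x)"
  \<comment> \<open>The unit of the algebra is a value of the universal representation, so
    \<open>f \<circ> u\<close> determines the element of \<open>D\<close> to be used as
    unit.\<close>
  have u1: "?u \<one>\<^bsub>P\<^esub> (single R \<one>\<^bsub>G\<^esub>) = cls unit \<one>\<^bsub>R\<^esub>"
    by (simp add: single_eq_monomial delta_rep_sum[OF P.one_closed] R.fin_supp_monomial cls_def)
  have sG: "single R \<one>\<^bsub>G\<^esub> \<in> FG" by (simp add: single_eq_monomial R.fin_supp_monomial)
  show "bij_betw ?\<Phi> (nondegenerate_homs A D) (covariant_reps diagram D)"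
    unfolding bij_betw_def
  proof (intro conjI inj_onI subset_antisym image_subsetI subsetI)
    fix f assume f: "f \<in> nondegenerate_homs A D"
    define D1 where "D1 = D\<lparr>one := f (cls unit \<one>\<^bsub>R\<^esub>)\<rparr>"
    note ring = nondegenerate_hom_unital[OF D f, folded D1_def]
    have "?\<Phi> f = (\<lambda>p\<in>carrier P. \<lambda>x\<in>FG. delta_system.rep R D1 (\<lambda>r. f (cls unit r))
        (\<lambda>g p. f (cls [Delta g p] \<one>\<^bsub>R\<^esub>)) p x)"
      by (intro restrict_ext ring_hom_delta_rep[OF ring])
    also have "\<dots> \<in> covariant_reps diagram D1"
      by (rule delta_system.rep_covariant[OF A.ring_hom_system[OF ring]])
    finally show "?\<Phi> f \<in> covariant_reps diagram D"
      by (simp only: D1_def covariant_reps_update_one)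
  next
    fix f f' assume f: "f \<in> nondegenerate_homs A D" and f': "f' \<in> nondegenerate_homs A D"
      and eq: "?\<Phi> f = ?\<Phi> f'"
    have eq': "f (?u p x) = f' (?u p x)" if "p \<in> carrier P" "x \<in> FG" for p x
      using fun_cong[OF fun_cong[OF eq, of p], of x] that by simp
    \<comment> \<open>Both homomorphisms thus become unital maps into the same ring, as
      \<open>ring_hom_unique\<close> requires.\<close>
    have one: "f (cls unit \<one>\<^bsub>R\<^esub>) = f' (cls unit \<one>\<^bsub>R\<^esub>)"
      using eq'[OF P.one_closed sG] by (simp add: u1)
    note ring = nondegenerate_hom_unital[OF D f] and ring' = nondegenerate_hom_unital[OF D f', folded one]
    show "f = f'"
    proof (rule extensionalityI[of _ "carrier A"])
      fix Y assume Y: "Y \<in> carrier A"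
      show "f Y = f' Y" by (rule ring_hom_unique[OF ring ring'(2) eq' Y])
    qed (use f f' in \<open>simp_all add: nondegenerate_homs_def\<close>)
  next
    fix \<nu> assume \<nu>: "\<nu> \<in> covariant_reps diagram D"
    define D1 where "D1 = D\<lparr>one := \<nu> \<one>\<^bsub>P\<^esub> (single R \<one>\<^bsub>G\<^esub>)\<rparr>"
    interpret Dn: nonunital_ring D by (rule Dn)
    have "ring D1"
      unfolding D1_def
      by (rule local_unit_ring_left_unit[OF D covariant_rep_left_unit[OF Dn \<nu>]]) auto
    then interpret D1: ring D1 .
    interpret N: unital_covariant_rep R P G \<theta> D1 \<nu>
    proof unfold_locales
      show "\<nu> \<in> covariant_reps diagram D1" using \<nu> by (simp only: D1_def covariant_reps_update_one)
    qed (simp add: D1_def)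
    interpret S: delta_system R P G \<theta> D1 N.\<nu>_coeff N.\<nu>_gen N.\<nu>_dual
      by (rule N.covariant_rep_system)
    obtain f where f: "f \<in> nondegenerate_homs A D1" and f_proj: "\<And>a. a \<in> carrier F \<Longrightarrow> f (proj a) = S.eval a"
      using S.induced_hom by blast
    \<comment> \<open>Being a nondegenerate homomorphism depends on addition and multiplication,
      which \<open>D1\<close> shares with \<open>D\<close>.\<close>
    have fD: "f \<in> nondegenerate_homs A D" using f by (simp add: nondegenerate_homs_def D1_def hom_def)
    have f_u: "f (?u p x) = \<nu> p x" if p: "p \<in> carrier P" and x: "x \<in> FG" for p x
    proof (rule delta_rep_hom_eq[OF p D1.is_abelian_group _ _ _ _ x])
      show "f \<in> hom (add_monoid A) (add_monoid D1)" using f by (simp add: nondegenerate_homs_def)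
      fix h r assume "h \<in> carrier G" "r \<in> carrier R"
      then show "f (cls [Delta h p] r) = \<nu> p (monomial R h r)"
        using p by (simp add: cls_def f_proj monomial_closed S.eval_monomial S.word_val_simps S.gen_val_def
            N.\<nu>_monomial)
    qed (use p in \<open>simp_all add: N.\<nu>_add N.\<nu>_zero\<close>)
    have "\<nu> = ?\<Phi> f"
    proof (rule extensionalityI[of _ "carrier P"])
      have \<nu>E: "\<nu> \<in> (\<Pi>\<^sub>E p\<in>carrier P. extensional FG)"
        using \<nu> unfolding covariant_reps_def diagram_simps by (auto simp: PiE_iff)
      then show "\<nu> \<in> extensional (carrier P)" by (simp add: PiE_iff)
      fix p assume p: "p \<in> carrier P"
      show "\<nu> p = ?\<Phi> f p"
      proof (rule extensionalityI[of _ FG])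
        show "\<nu> p \<in> extensional FG" using \<nu>E p by (auto simp: PiE_iff)
      qed (use p f_u in simp_all)
    qed simp
    then show "\<nu> \<in> ?\<Phi> ` nondegenerate_homs A D" using fD by blast
  qed
qed

end

theorem corollary9p4:
  fixes R :: "'r ring" and P :: "'p monoid" and G :: "'g monoid" and \<theta> :: "'p \<Rightarrow> 'g \<Rightarrow> 'g"
  assumes "ring R" and "monoid P" and "group G"
    and "\<And>p. p \<in> carrier P \<Longrightarrow> \<theta> p \<in> hom G G"
    and "\<And>p. p \<in> carrier P \<Longrightarrow> inj_on (\<theta> p) (carrier G)"
    and "\<And>p q g. \<lbrakk>p \<in> carrier P; q \<in> carrier P; g \<in> carrier G\<rbrakk> \<Longrightarrow> \<theta> p (\<theta> q g) = \<theta> (p \<otimes>\<^bsub>P\<^esub> q) g"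
    and "\<And>g. g \<in> carrier G \<Longrightarrow> \<theta> \<one>\<^bsub>P\<^esub> g = g"
    and "\<And>p. p \<in> carrier P \<Longrightarrow> finite (lcosets\<^bsub>G\<^esub> (\<theta> p ` carrier G))"
  shows "is_covariance_ring TYPE('d) (ring_diagram R (endo_diagram P G \<theta>))
    (delta_algebra R P G \<theta>) (delta_rep R P G \<theta>)"
  by (rule endo_action.covariance_ring)
    (intro endo_action.intro endo_action_axioms.intro assms; assumption)

end
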